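(* Let $a,b>0$, let $\mathcal{E}$ be the ellipse $\frac{x^2}{a}+\frac{y^2}{b}=1$ in the Minkowski plane, let $\gamma\in\mathbb{R}\setminus\{-b,0,a\}$, let $n$ be a positive integer, and let $\mathcal{K}$ be the elliptic curve $y^2=\varepsilon(a-x)(b+x)(\gamma-x)$ with $\varepsilon=\operatorname{sign}\gamma$. Denote by $Q_0$ a point of $\mathcal{K}$ with $x=0$, and by $Q_\gamma,Q_a,Q_{-b}$ the points of $\mathcal{K}$ with $x=\gamma$, $x=a$, $x=-b$ respectively. A billiard trajectory within $\mathcal{E}$ with caustic $\mathcal{C}_\gamma$ is $n$-elliptic periodic without being $n$-periodic if and only if one of the following conditions is satisfied on $\mathcal{K}$ (where $\sim$ is linear equivalence of divisors): (a) $\mathcal{C}_\gamma$ is an ellipse, $0<\gamma<a$, and $nQ_0-(n-1)Q_\gamma-Q_{-b}\sim0$; (b) $\mathcal{C}_\gamma$ is an ellipse, $-b<\gamma<0$, and $nQ_0-(n-1)Q_\gamma-Q_{a}\sim0$; (c) $\mathcal{C}_\gamma$ is a hyperbola, $n$ is even, and $nQ_0-(n-2)Q_\gamma-Q_{-b}-Q_a\sim0$; (d) $\mathcal{C}_\gamma$ is a hyperbola, $n$ is odd, and $nQ_0-(n-1)Q_\gamma-Q_a\sim0$; (e) $\mathcal{C}_\gamma$ is a hyperbola, $n$ is odd, and $nQ_0-(n-1)Q_\gamma-Q_{-b}\sim0$. Moreover, such trajectories are always symmetric with respect to the origin in Case (c); they are symmetric with respect to the $y$-axis in Cases (b) and (d),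 and with respect to the $x$-axis in Cases (a) and (e).
   Context: The Minkowski plane is $\mathbb{R}^2$ with the scalar product $\langle X,Y\rangle=X_1Y_1-X_2Y_2$; vectors $X,Y$ are orthogonal if $\langle X,Y\rangle=0$, and $v$ is light-like if $\langle v,v\rangle=0$. The family of conics confocal with $\mathcal{E}$ is $\mathcal{C}_\lambda:\ \frac{x^2}{a-\lambda}+\frac{y^2}{b+\lambda}=1$, $\lambda\in\mathbb{R}$; $\mathcal{C}_\lambda$ is an ellipse for $\lambda\in(-b,a)$ and a hyperbola for $\lambda<-b$ or $\lambda>a$. Billiard reflection: given a line $p$ that is not light-like and a vector $v$, write $v=u+w$ with $u$ parallel to $p$ and $w$ orthogonal to $p$ (in the Minkowski sense); the reflection of $v$ on $p$ is $u-w$. A billiard trajectory within $\mathcal{E}$ is a polygonal line with vertices on $\mathcal{E}$ such that the directions of consecutive segments are billiard reflections of each other with respect to the tangent line of $\mathcal{E}$ at the common vertex (the reflection is not defined where this tangent line is light-like). All lines containing segments of a given trajectory are tangent to the same conic $\mathcal{C}_\gamma$ of the confocal family, called the caustic of the trajectory; the caustic is non-degenerate when $\gamma\in\mathbb{R}\setminus\{-b,a\}$. A trajectory is $n$-periodic if it closes after $n$ reflections ($n$ is not required to be the minimal such number). Elliptic coordinates: a point inside $\mathcal{E}$ has elliptic coordinates $(\lambda_1,\lambda_2)$, $-b\le\lambda_1\le0\le\lambda_2\le a$, the parameters of the two conics $\mathcal{C}_{\lambda_1},\mathcal{C}_{\lambda_2}$ of the confocal family through it (with degenerate conics $\mathcal{C}_{-b}$,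 $\mathcal{C}_{a}$ being the $x$-axis and the $y$-axis); points symmetric with respect to the coordinate axes have the same elliptic coordinates. A billiard trajectory is $n$-elliptic periodic if it is $n$-periodic in elliptic coordinates, i.e. the motion expressed in the coordinates $(\lambda_1,\lambda_2)$ closes after $n$ reflections. The elliptic curve is understood as the smooth projective completion, with one point at infinity; the choice of which of the two points over $x=0$ is called $Q_0$ is immaterial. *)

theory Defs
  imports
    "HOL-Analysis.Analysis"
    "HOL-Computational_Algebra.Polynomial"
    "HOL-Library.Poly_Mapping"
begin

type_synonym plane = "real \<times> real"

section \<open>Billiards in the Minkowski plane\<close>

definition mink :: "plane \<Rightarrow> plane \<Rightarrow> real" where
  "mink X Y = fst X * fst Y - snd X * snd Y"

definition light_like :: "plane \<Rightarrow> bool" where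
  "light_like v \<longleftrightarrow> mink v v = 0"

definition ellipse :: "real \<Rightarrow> real \<Rightarrow> plane set" where
  "ellipse a b = {(x, y). x\<^sup>2 / a + y\<^sup>2 / b = 1}"

text \<open>The degenerate members of the confocal family are the coordinate axes.\<close>

definition confocal :: "real \<Rightarrow> real \<Rightarrow> real \<Rightarrow> plane set" where
  "confocal a b l =
     (if l = -b then {(x, y). y = 0}
      else if l = a then {(x, y). x = 0}
      else {(x, y). x\<^sup>2 / (a - l) + y\<^sup>2 / (b + l) = 1})"

text \<open>
  Tangency is projective: \<open>(x0, y0, z0)\<close> are homogeneous coordinates of the point of contact on
  the projective closure of the conic. The case \<open>z0 = 0\<close> makes the asymptotes of a hyperbola
  tangent lines, as is needed for trajectories with a segment through the centre.
  Only used for the non-degenerate conics.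
\<close>

definition tangent_to_confocal :: "real \<Rightarrow> real \<Rightarrow> real \<Rightarrow> plane set \<Rightarrow> bool" where
  "tangent_to_confocal a b l L \<longleftrightarrow>
     (\<exists>x0 y0 z0. (x0, y0, z0) \<noteq> (0, 0, 0) \<and>
        x0\<^sup>2 / (a - l) + y0\<^sup>2 / (b + l) = z0\<^sup>2 \<and>
        L = {(x, y). x0 * x / (a - l) + y0 * y / (b + l) = z0})"

text \<open>Direction of the tangent line \<open>x0 * x / a + y0 * y / b = 1\<close> at \<open>(x0, y0)\<close>.\<close>

definition tangent_dir :: "real \<Rightarrow> real \<Rightarrow> plane \<Rightarrow> plane" where
  "tangent_dir a b P = (- snd P / b, fst P / a)"

text \<open>\<open>v'\<close> is the reflection of \<open>v\<close> on the line with direction vector \<open>p\<close>.\<close>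

definition billiard_reflection :: "plane \<Rightarrow> plane \<Rightarrow> plane \<Rightarrow> bool" where
  "billiard_reflection p v v' \<longleftrightarrow>
     \<not> light_like p \<and>
     (\<exists>u w. v = u + w \<and> u \<in> span {p} \<and> mink w p = 0 \<and> v' = u - w)"

text \<open>
  A trajectory is given by its infinite sequence of vertices. The positive factor \<open>c\<close> accounts
  for the different lengths of consecutive segments.
\<close>

definition billiard_trajectory :: "real \<Rightarrow> real \<Rightarrow> (nat \<Rightarrow> plane) \<Rightarrow> bool" where
  "billiard_trajectory a b X \<longleftrightarrow>
     (\<forall>k. X k \<in> ellipse a b) \<and>
     (\<forall>k. X k \<noteq> X (Suc k)) \<and>
     (\<forall>k. \<exists>v' c. c > 0 \<and>
        billiard_reflection (tangent_dir a b (X (Suc k))) (X (Suc k) - X k) v' \<and>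
        X (Suc (Suc k)) - X (Suc k) = c *\<^sub>R v')"

definition has_caustic :: "real \<Rightarrow> real \<Rightarrow> real \<Rightarrow> (nat \<Rightarrow> plane) \<Rightarrow> bool" where
  "has_caustic a b l X \<longleftrightarrow>
     (\<forall>k. tangent_to_confocal a b l (affine hull {X k, X (Suc k)}))"

definition periodic :: "nat \<Rightarrow> (nat \<Rightarrow> plane) \<Rightarrow> bool" where
  "periodic n X \<longleftrightarrow> (\<forall>k. X (k + n) = X k)"

text \<open>
  \<open>l1 = l2\<close> is allowed: it occurs (with value 0) precisely at the four points of the ellipse where
  its tangent is light-like.
\<close>

definition elliptic_coords :: "real \<Rightarrow> real \<Rightarrow> plane \<Rightarrow> real \<times> real" where
  "elliptic_coords a b P =
     (THE (l1, l2). -b \<le> l1 \<and> l1 \<le> 0 \<and> 0 \<le> l2 \<and> l2 \<le> a \<and>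
        {l. P \<in> confocal a b l} = {l1, l2})"

text \<open>
  The whole motion, not just the sequence of vertices, has to repeat in elliptic coordinates;
  every segment is run through in unit time.
\<close>

definition elliptic_periodic :: "real \<Rightarrow> real \<Rightarrow> nat \<Rightarrow> (nat \<Rightarrow> plane) \<Rightarrow> bool" where
  "elliptic_periodic a b n X \<longleftrightarrow>
     (\<forall>k. \<forall>s\<in>{0..1}.
        elliptic_coords a b ((1 - s) *\<^sub>R X (k + n) + s *\<^sub>R X (Suc (k + n))) =
        elliptic_coords a b ((1 - s) *\<^sub>R X k + s *\<^sub>R X (Suc k)))"

definition trace_of :: "(nat \<Rightarrow> plane) \<Rightarrow> plane set" where
  "trace_of X = (\<Union>k. closed_segment (X k) (X (Suc k)))"

definition symmetric_origin :: "(nat \<Rightarrow> plane) \<Rightarrow> bool" where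
  "symmetric_origin X \<longleftrightarrow> (\<lambda>(x, y). (-x, -y)) ` trace_of X = trace_of X"

definition symmetric_x_axis :: "(nat \<Rightarrow> plane) \<Rightarrow> bool" where
  "symmetric_x_axis X \<longleftrightarrow> (\<lambda>(x, y). (x, -y)) ` trace_of X = trace_of X"

definition symmetric_y_axis :: "(nat \<Rightarrow> plane) \<Rightarrow> bool" where
  "symmetric_y_axis X \<longleftrightarrow> (\<lambda>(x, y). (-x, y)) ` trace_of X = trace_of X"


section \<open>Divisors on an elliptic curve\<close>

text \<open>
  We consider the curve \<open>y\<^sup>2 = f(x)\<close> over the complex numbers, for a cubic \<open>f\<close> with simple roots;
  its smooth projective completion has one more point. An element of \<open>\<complex>[x][y]\<close> is a
  \<open>complex poly poly\<close>, the outer variable being \<open>y\<close>.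
\<close>

datatype curve_point = At_Infinity | Affine complex complex

definition curve :: "complex poly \<Rightarrow> curve_point set" where
  "curve f = insert At_Infinity {Affine x y | x y. y\<^sup>2 = poly f x}"

definition curve_eqn :: "complex poly \<Rightarrow> complex poly poly" where
  "curve_eqn f = [:- f, 0, 1:]"

definition eval2 :: "complex poly poly \<Rightarrow> complex \<Rightarrow> complex \<Rightarrow> complex" where
  "eval2 G x y = poly (poly G [:y:]) x"

text \<open>The function \<open>x - x0\<close>, respectively \<open>y\<close> at the points with \<open>y0 = 0\<close>.\<close>

definition uniformizer :: "complex \<Rightarrow> complex \<Rightarrow> complex poly poly" where
  "uniformizer x0 y0 = (if y0 = 0 then [:0, 1:] else [:[:- x0, 1:]:])"

text \<open>
  Order of vanishing at an affine point: the largest power of the uniformizer \<open>t\<close> that divides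
  \<open>G\<close> in the local ring, i.e. \<open>G = t^k * U / V\<close> modulo the equation of the curve,
  with \<open>V\<close> not vanishing at the point.
\<close>

definition ord_affine ::
    "complex poly \<Rightarrow> complex \<Rightarrow> complex \<Rightarrow> complex poly poly \<Rightarrow> nat" where
  "ord_affine f x0 y0 G =
     (GREATEST k. \<exists>U V. eval2 V x0 y0 \<noteq> 0 \<and>
        curve_eqn f dvd V * G - uniformizer x0 y0 ^ k * U)"

text \<open>
  Pole order at infinity of \<open>p(x) + q(x) y\<close>: there \<open>x\<close> has a pole of order 2 and \<open>y\<close> one of
  order 3, and the two summands cannot cancel since their pole orders differ in parity.
\<close>

definition pole_order_infinity :: "complex poly \<Rightarrow> complex poly \<Rightarrow> nat" where
  "pole_order_infinity p q =
     (if q = 0 then 2 * degree p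
      else if p = 0 then 2 * degree q + 3
      else max (2 * degree p) (2 * degree q + 3))"

definition ord_at :: "complex poly \<Rightarrow> curve_point \<Rightarrow> complex poly \<Rightarrow> complex poly \<Rightarrow> int" where
  "ord_at f P p q =
     (case P of
        At_Infinity \<Rightarrow> - int (pole_order_infinity p q)
      | Affine x0 y0 \<Rightarrow> int (ord_affine f x0 y0 [:p, q:]))"

text \<open>
  Every element of the coordinate ring is uniquely \<open>p(x) + q(x) y\<close>, so every nonzero rational
  function is a quotient of two such nonzero expressions.
\<close>

definition principal_divisor :: "complex poly \<Rightarrow> (curve_point \<Rightarrow>\<^sub>0 int) \<Rightarrow> bool" where
  "principal_divisor f D \<longleftrightarrow>
     Poly_Mapping.keys D \<subseteq> curve f \<and>
     (\<exists>p q r s. (p, q) \<noteq> (0, 0) \<and> (r, s) \<noteq> (0, 0) \<and>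
        (\<forall>P\<in>curve f. Poly_Mapping.lookup D P = ord_at f P p q - ord_at f P r s))"

definition lin_equiv ::
    "complex poly \<Rightarrow> (curve_point \<Rightarrow>\<^sub>0 int) \<Rightarrow> (curve_point \<Rightarrow>\<^sub>0 int) \<Rightarrow> bool" where
  "lin_equiv f D E \<longleftrightarrow> principal_divisor f (D - E)"

definition K_poly :: "real \<Rightarrow> real \<Rightarrow> real \<Rightarrow> complex poly" where
  "K_poly a b g =
     smult (of_real (sgn g)) ([:of_real a, -1:] * [:of_real b, 1:] * [:of_real g, -1:])"

abbreviation Q_branch :: "real \<Rightarrow> curve_point" where
  "Q_branch x \<equiv> Affine (of_real x) 0"

end

theory Submission
  imports Defs "HOL-Computational_Algebra.Fundamental_Theorem_Algebra"
begin

text \<open>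
  Send a segment of the trajectory, starting at \<open>P = (x, y)\<close> with unit direction \<open>v = (u, w)\<close>, to the
  matrix \<open>L\<close> with rows \<open>(V, -U)\<close> and \<open>(-W, -V)\<close> over the polynomials in \<open>\<lambda>\<close>, where
  \<open>U = (a - \<lambda>)(b + \<lambda>) Q(v, v)\<close>, \<open>V = (a - \<lambda>)(b + \<lambda>) Q(P, v)\<close>, \<open>W = (a - \<lambda>)(b + \<lambda>) (1 - Q(P, P))\<close>
  and \<open>Q\<close> is the form \<open>x x' / (a - \<lambda>) + y y' / (b + \<lambda>)\<close>. Then \<open>V\<^sup>2 + U W\<close> is the cubic \<open>f\<close> that
  defines \<open>\<K>\<close>, and a bounce conjugates \<open>L\<close> by a matrix that acts on \<open>(u, x)\<close> at \<open>\<lambda> = a\<close> and on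
  \<open>(w, y)\<close> at \<open>\<lambda> = -b\<close> as the billiard does. If the trajectory returns after \<open>n\<close> bounces up to the
  symmetry \<open>(\<sigma>\<^sub>1, \<sigma>\<^sub>2)\<close>, then the product \<open>M\<close> of the \<open>n\<close> bounce matrices commutes with \<open>L\<close>, so that
  \<open>M = A + B L\<close> and \<open>A\<^sup>2 - B\<^sup>2 f = det M = \<lambda>\<^bsup>2n\<^esup>\<close> with \<open>A(a) = \<sigma>\<^sub>1 a\<^sup>n\<close> and \<open>A(-b) = \<sigma>\<^sub>2 (-b)\<^sup>n\<close>;
  conversely \<open>M\<close> can be recovered from such a solution, since \<open>M\<close> and \<open>A + B L\<close> have the same kernel
  to order \<open>2n\<close> at \<open>\<lambda> = 0\<close>. The function \<open>A + B y\<close> on \<open>\<K>\<close> has divisor \<open>2n Q\<^sub>0 - 2n \<infinity>\<close>, and the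
  values of \<open>A\<close> at the branch points tell which branch points occur in the divisor of its square
  root, which is the linear equivalence of the theorem. Over the reals, \<open>A\<close> has no zero where
  \<open>f \<ge> 0\<close>, and this excludes the symmetries that are missing from the list of cases.
\<close>

section \<open>Orders of complex polynomials\<close>

text \<open>A nonconstant complex \<open>p\<close> has a root \<open>z\<close>, which by the
  comparison of orders is a root of \<open>q\<close> too; splitting off its linear factor from both
  lowers the degree of \<open>p\<close>.\<close>

lemma poly_dvd_iff_order:
  fixes p q :: "complex poly"
  assumes "p \<noteq> 0" "q \<noteq> 0" "\<And>z. order z p \<le> order z q"
  shows "p dvd q"
  using assms
proof (induction "degree p" arbitrary: p q)
  case 0
  then show ?case by (simp add: is_unit_iff_degree unit_imp_dvd)
next
  case (Suc d)
  obtain z where z: "poly p z = 0"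
    using fundamental_theorem_of_algebra_alt[of p] Suc.hyps(2) by (metis degree_pCons_0 nat.simps(3))
  then obtain p' where p': "p = [:- z, 1:] * p'" by (meson dvdE poly_eq_0_iff_dvd)
  have "order z q \<noteq> 0"
    using Suc.prems z by (metis le_zero_eq order_root)
  then obtain q' where q': "q = [:- z, 1:] * q'"
    by (metis dvdE order_root poly_eq_0_iff_dvd)
  have nz: "p' \<noteq> 0" "q' \<noteq> 0" using Suc.prems p' q' by auto
  have "order w p' \<le> order w q'" for w
    using Suc.prems(3)[of w] Suc.prems(1,2) unfolding p' q' by (simp add: order_mult del: mult_pCons_left)
  moreover have "d = degree p'"
    using Suc.hyps(2) nz unfolding p' by (simp add: degree_mult_eq del: mult_pCons_left)
  ultimately have "p' dvd q'" using Suc.hyps(1) nz by blast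
  then show ?case unfolding p' q' by (rule mult_dvd_mono[OF dvd_refl])
qed

lemma poly_eq_smult_if_orders_eq:
  fixes p q :: "complex poly"
  assumes "p \<noteq> 0" "q \<noteq> 0" "\<And>z. order z p = order z q"
  obtains c where "c \<noteq> 0" "p = smult c q"
proof -
  let ?m = "\<Prod>z | poly p z = 0. [:- z, 1:] ^ order z p"
  have "{z. poly p z = 0} = {z. poly q z = 0}" using assms order_root by metis
  then have q: "smult (lead_coeff q) ?m = q"
    using complex_poly_decompose[of q] assms(3) by simp
  have "smult (lead_coeff p / lead_coeff q) (smult (lead_coeff q) ?m) = smult (lead_coeff p) ?m"
    using assms by simp
  then have "smult (lead_coeff p / lead_coeff q) q = p"
    unfolding q complex_poly_decompose by simp
  then show ?thesis using that[of "lead_coeff p / lead_coeff q"] assms by simp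
qed

text \<open>Halve the exponents in the decomposition into linear factors and take a complex root of
  the leading coefficient.\<close>

lemma square_if_orders_even:
  fixes p :: "complex poly"
  assumes "\<And>z. even (order z p)"
  shows "\<exists>q. p = q\<^sup>2"
proof -
  let ?m = "\<Prod>z | poly p z = 0. [:- z, 1:] ^ (order z p div 2)"
  have "[:- z, 1:] ^ order z p = ([:- z, 1:] ^ (order z p div 2))\<^sup>2" for z
    using assms[of z] by (metis dvd_div_mult_self power_mult)
  then have "p = smult (lead_coeff p) (?m\<^sup>2)"
    using complex_poly_decompose[of p] by (simp add: prod_power_distrib)
  also have "\<dots> = (smult (csqrt (lead_coeff p)) ?m)\<^sup>2"
    by (simp add: smult_power)
  finally show ?thesis by blast
qed

lemma order_prod_linear_power:
  fixes S :: "complex set"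
  assumes "finite S"
  shows "order z (\<Prod>r\<in>S. [:- r, 1:] ^ k r) = (if z \<in> S then k z else 0)"
  using assms
proof (induction S rule: finite_induct)
  case (insert x F)
  have nz: "[:- x, 1:] ^ k x * (\<Prod>r\<in>F. [:- r, 1:] ^ k r) \<noteq> 0"
    using insert by auto
  have o: "order z ([:- x, 1:] ^ k x) = (if z = x then k x else 0)"
  proof (cases "z = x")
    case True then show ?thesis using order_power_n_n by simp
  next
    case False
    have "poly ([:- x, 1:] ^ k x) z \<noteq> 0" using False by (simp add: poly_power)
    then show ?thesis using False by (simp add: order_0I)
  qed
  show ?case using insert order_mult[OF nz, of z] o by auto
qed (simp add: order_0I)

section \<open>Functions on the curve\<close>

lemma eval2_simps [simp]:
  "eval2 (G * H) x y = eval2 G x y * eval2 H x y"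
  "eval2 (G + H) x y = eval2 G x y + eval2 H x y"
  "eval2 (G - H) x y = eval2 G x y - eval2 H x y"
  "eval2 (G ^ k) x y = eval2 G x y ^ k"
  "eval2 [:p, q:] x y = poly p x + y * poly q x"
  "eval2 [:p:] x y = poly p x"
  "eval2 (smult p G) x y = poly p x * eval2 G x y"
  "eval2 1 x y = 1"
  by (simp_all add: eval2_def poly_power)

lemma eval2_curve_eqn: "eval2 (curve_eqn f) x y = y\<^sup>2 - poly f x"
  by (simp add: eval2_def curve_eqn_def power2_eq_square)

lemma curve_reduce: "\<exists>W p q. Z = curve_eqn f * W + [:p, q:]"
proof (induction Z)
  case 0
  have "0 = curve_eqn f * 0 + [:0, 0:]" by simp
  then show ?case by blast
next
  case (pCons c Z)
  then obtain W p q where W: "Z = curve_eqn f * W + [:p, q:]" by blast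
  have "pCons c Z = curve_eqn f * (pCons q W) + [:c + q * f, p:]"
    unfolding W by (simp add: curve_eqn_def algebra_simps)
  then show ?case by blast
qed

text \<open>Modulo the equation \<open>Z\<close> is \<open>p + q y\<close>, and evaluation at
  \<open>y\<close> and \<open>- y\<close> separates \<open>p\<close> from \<open>q\<close>. The
  exceptional roots of \<open>c\<close> make it possible to cancel a uniformizer where it is
  nonzero.\<close>

lemma zero_on_curve_dense:
  assumes "f \<noteq> 0" "c \<noteq> 0"
    and "\<And>x y. y\<^sup>2 = poly f x \<Longrightarrow> poly c x \<noteq> 0 \<Longrightarrow> eval2 Z x y = 0"
  shows "curve_eqn f dvd Z"
proof -
  obtain W p q where Z: "Z = curve_eqn f * W + [:p, q:]" using curve_reduce by blast
  have ev: "poly p x + y * poly q x = 0" if "y\<^sup>2 = poly f x" "poly c x \<noteq> 0" for x y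
    using assms(3)[OF that] that by (simp add: Z eval2_curve_eqn)
  have both: "poly p x = 0 \<and> poly f x * poly q x = 0" if "poly c x \<noteq> 0" for x
  proof -
    let ?y = "csqrt (poly f x)"
    have "poly p x + ?y * poly q x = 0" "poly p x + (- ?y) * poly q x = 0"
      using ev[of ?y x] ev[of "- ?y" x] that by auto
    then have "poly p x = 0" "?y * poly q x = 0" by (auto simp: algebra_simps)
    moreover have "poly f x * poly q x = ?y * (?y * poly q x)"
      by (metis mult.assoc power2_csqrt power2_eq_square)
    ultimately show ?thesis by simp
  qed
  have "poly (c * p) x = 0" for x using both[of x] by auto
  then have "c * p = 0" using poly_all_0_iff_0 by blast
  moreover have "poly (c * f * q) x = 0" for x using both[of x] by auto
  then have "c * f * q = 0" using poly_all_0_iff_0 by blast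
  ultimately have "p = 0" "q = 0" using assms by auto
  then show ?thesis using Z by simp
qed

lemma curve_eqn_dvd_iff:
  assumes "f \<noteq> 0"
  shows "curve_eqn f dvd Z \<longleftrightarrow> (\<forall>x y. y\<^sup>2 = poly f x \<longrightarrow> eval2 Z x y = 0)"
  using zero_on_curve_dense[of f 1 Z] assms by (auto simp: eval2_curve_eqn)

text \<open>The divisibility in \<open>ord_affine\<close> is tested at the points of the curve,
  which \<open>curve_eqn_dvd_iff\<close> justifies; local computations become identities between
  complex numbers.\<close>

definition vanishes ::
    "complex poly \<Rightarrow> complex \<Rightarrow> complex \<Rightarrow> nat \<Rightarrow> complex poly poly \<Rightarrow> bool" where
  "vanishes f x0 y0 k G \<longleftrightarrow> (\<exists>U V. eval2 V x0 y0 \<noteq> 0 \<and>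
     (\<forall>x y. y\<^sup>2 = poly f x \<longrightarrow>
        eval2 V x y * eval2 G x y = eval2 (uniformizer x0 y0) x y ^ k * eval2 U x y))"

text \<open>\<open>G\<close> is a local unit times a power of the uniformizer. Such representations
  can be multiplied and certify the \<open>GREATEST\<close> in \<open>ord_affine\<close>.\<close>

definition vanishes_exactly ::
    "complex poly \<Rightarrow> complex \<Rightarrow> complex \<Rightarrow> nat \<Rightarrow> complex poly poly \<Rightarrow> bool" where
  "vanishes_exactly f x0 y0 k G \<longleftrightarrow> (\<exists>U V. eval2 V x0 y0 \<noteq> 0 \<and> eval2 U x0 y0 \<noteq> 0 \<and>
     (\<forall>x y. y\<^sup>2 = poly f x \<longrightarrow>
        eval2 V x y * eval2 G x y = eval2 (uniformizer x0 y0) x y ^ k * eval2 U x y))"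

lemma vanishes_exactlyI:
  assumes "eval2 V x0 y0 \<noteq> 0" "eval2 U x0 y0 \<noteq> 0"
    and "\<And>x y. y\<^sup>2 = poly f x \<Longrightarrow>
      eval2 V x y * eval2 G x y = eval2 (uniformizer x0 y0) x y ^ k * eval2 U x y"
  shows "vanishes_exactly f x0 y0 k G"
  using assms unfolding vanishes_exactly_def by blast

lemma ord_affine_vanishes:
  assumes "f \<noteq> 0"
  shows "ord_affine f x0 y0 G = (GREATEST k. vanishes f x0 y0 k G)"
  unfolding ord_affine_def vanishes_def curve_eqn_dvd_iff[OF assms] by simp

lemma eval2_uniformizer:
  "eval2 (uniformizer x0 y0) x y = (if y0 = 0 then y else x - x0)"
  by (simp add: uniformizer_def)

text \<open>After cancelling the common power of the uniformizer, the unit \<open>V' * U\<close>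
  would agree on the whole curve with a function that vanishes at \<open>(x0, y0)\<close>.\<close>

lemma vanishes_le:
  assumes f: "f \<noteq> 0" "y0\<^sup>2 = poly f x0"
    and "vanishes_exactly f x0 y0 k G" "vanishes f x0 y0 l G"
  shows "l \<le> k"
proof (rule ccontr)
  assume "\<not> l \<le> k"
  then obtain d where d: "l = k + Suc d" using less_imp_Suc_add by fastforce
  let ?t = "uniformizer x0 y0"
  obtain U V where U: "eval2 V x0 y0 \<noteq> 0" "eval2 U x0 y0 \<noteq> 0"
    "\<And>x y. y\<^sup>2 = poly f x \<Longrightarrow> eval2 V x y * eval2 G x y = eval2 ?t x y ^ k * eval2 U x y"
    using assms(3) unfolding vanishes_exactly_def by blast
  obtain U' V' where U': "eval2 V' x0 y0 \<noteq> 0"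
    "\<And>x y. y\<^sup>2 = poly f x \<Longrightarrow> eval2 V' x y * eval2 G x y = eval2 ?t x y ^ l * eval2 U' x y"
    using assms(4) unfolding vanishes_def by blast
  let ?Z = "V' * U - V * ?t ^ Suc d * U'"
  \<comment> \<open>Chosen so that the uniformizer is nonzero wherever \<open>c\<close> is: if it is
    \<open>y\<close>, its zeros lie over the roots of \<open>f\<close>.\<close>
  define c where "c = (if y0 = 0 then f else [:- x0, 1:])"
  have Z0: "eval2 ?Z x y = 0" if "y\<^sup>2 = poly f x" "poly c x \<noteq> 0" for x y
  proof -
    have t: "eval2 ?t x y \<noteq> 0" using that by (auto simp: eval2_uniformizer c_def)
    have "eval2 ?t x y ^ k * eval2 ?Z x y
        = eval2 V' x y * (eval2 ?t x y ^ k * eval2 U x y) - eval2 V x y * (eval2 ?t x y ^ l * eval2 U' x y)"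
      by (simp add: d power_add algebra_simps)
    also have "\<dots> = 0"
      unfolding U(3)[OF that(1), symmetric] U'(2)[OF that(1), symmetric] by simp
    finally show ?thesis using t by simp
  qed
  have "curve_eqn f dvd ?Z"
    by (rule zero_on_curve_dense[where c = c]) (use Z0 f in \<open>auto simp: c_def\<close>)
  then have "eval2 ?Z x0 y0 = 0" using curve_eqn_dvd_iff f by blast
  moreover have "eval2 ?t x0 y0 = 0" by (simp add: eval2_uniformizer)
  ultimately show False using U(1,2) U'(1) by simp
qed

lemma vanishes_exactly_imp: "vanishes_exactly f x0 y0 k G \<Longrightarrow> vanishes f x0 y0 k G"
  unfolding vanishes_exactly_def vanishes_def by blast

lemma ord_affine_eqI:
  assumes "f \<noteq> 0" "y0\<^sup>2 = poly f x0" "vanishes_exactly f x0 y0 k G"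
  shows "ord_affine f x0 y0 G = k"
  unfolding ord_affine_vanishes[OF assms(1)]
  using Greatest_equality[of "\<lambda>k. vanishes f x0 y0 k G"] vanishes_le[OF assms(1,2,3)]
    vanishes_exactly_imp[OF assms(3)] by blast

lemma vanishes_exactly_mult:
  assumes "vanishes_exactly f x0 y0 k G" "vanishes_exactly f x0 y0 l H"
    and "\<And>x y. y\<^sup>2 = poly f x \<Longrightarrow> eval2 J x y = eval2 G x y * eval2 H x y"
  shows "vanishes_exactly f x0 y0 (k + l) J"
proof -
  let ?t = "uniformizer x0 y0"
  obtain U V where U: "eval2 V x0 y0 \<noteq> 0" "eval2 U x0 y0 \<noteq> 0"
    "\<And>x y. y\<^sup>2 = poly f x \<Longrightarrow> eval2 V x y * eval2 G x y = eval2 ?t x y ^ k * eval2 U x y"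
    using assms(1) unfolding vanishes_exactly_def by blast
  obtain U' V' where U': "eval2 V' x0 y0 \<noteq> 0" "eval2 U' x0 y0 \<noteq> 0"
    "\<And>x y. y\<^sup>2 = poly f x \<Longrightarrow> eval2 V' x y * eval2 H x y = eval2 ?t x y ^ l * eval2 U' x y"
    using assms(2) unfolding vanishes_exactly_def by blast
  have "eval2 (V * V') x y * eval2 J x y = eval2 ?t x y ^ (k + l) * eval2 (U * U') x y"
    if "y\<^sup>2 = poly f x" for x y
  proof -
    have "eval2 (V * V') x y * eval2 J x y
        = (eval2 V x y * eval2 G x y) * (eval2 V' x y * eval2 H x y)"
      by (simp add: assms(3)[OF that])
    then show ?thesis unfolding U(3)[OF that] U'(3)[OF that] by (simp add: power_add)
  qed
  then show ?thesis using U(1,2) U'(1,2)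
    by (intro vanishes_exactlyI[of "V * V'" _ _ "U * U'"]) auto
qed

lemma vanishes_add:
  assumes "vanishes f x0 y0 k G" "vanishes f x0 y0 k H"
    and "\<And>x y. y\<^sup>2 = poly f x \<Longrightarrow> eval2 J x y = eval2 G x y + eval2 H x y"
  shows "vanishes f x0 y0 k J"
proof -
  let ?t = "uniformizer x0 y0"
  obtain U V where U: "eval2 V x0 y0 \<noteq> 0"
    "\<And>x y. y\<^sup>2 = poly f x \<Longrightarrow> eval2 V x y * eval2 G x y = eval2 ?t x y ^ k * eval2 U x y"
    using assms(1) unfolding vanishes_def by blast
  obtain U' V' where U': "eval2 V' x0 y0 \<noteq> 0"
    "\<And>x y. y\<^sup>2 = poly f x \<Longrightarrow> eval2 V' x y * eval2 H x y = eval2 ?t x y ^ k * eval2 U' x y"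
    using assms(2) unfolding vanishes_def by blast
  have "eval2 (V * V') x y * eval2 J x y = eval2 ?t x y ^ k * eval2 (V' * U + V * U') x y"
    if "y\<^sup>2 = poly f x" for x y
  proof -
    have "eval2 (V * V') x y * eval2 J x y
        = eval2 V' x y * (eval2 V x y * eval2 G x y) + eval2 V x y * (eval2 V' x y * eval2 H x y)"
      by (simp add: assms(3)[OF that] algebra_simps)
    then show ?thesis unfolding U(2)[OF that] U'(2)[OF that] by (simp add: algebra_simps)
  qed
  then show ?thesis unfolding vanishes_def using U(1) U'(1)
    by (intro exI[of _ "V' * U + V * U'"] exI[of _ "V * V'"]) auto
qed

lemma vanishes_mono:
  assumes "vanishes f x0 y0 k G" "l \<le> k"
  shows "vanishes f x0 y0 l G"
proof -
  let ?t = "uniformizer x0 y0"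
  obtain U V where U: "eval2 V x0 y0 \<noteq> 0"
    "\<And>x y. y\<^sup>2 = poly f x \<Longrightarrow> eval2 V x y * eval2 G x y = eval2 ?t x y ^ k * eval2 U x y"
    using assms(1) unfolding vanishes_def by blast
  have "eval2 ?t x y ^ k * eval2 U x y = eval2 ?t x y ^ l * eval2 (?t ^ (k - l) * U) x y" for x y
    using assms(2) by (simp flip: power_add mult.assoc)
  then show ?thesis unfolding vanishes_def using U
    by (intro exI[of _ "?t ^ (k - l) * U"] exI[of _ V]) auto
qed

section \<open>Norms and orders on the curve of a cubic with simple roots\<close>

locale cubic_curve =
  fixes S :: "complex set" and c :: complex and f :: "complex poly"
  assumes card_S: "card S = 3" and c_nz: "c \<noteq> 0"
    and f_def: "f = smult c (\<Prod>r\<in>S. [:- r, 1:])"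
begin

lemma order_linear_self: "order z [:- z, 1:] = 1"
  for z :: complex
  using order_power_n_n[of z 1] by (simp del: mult_pCons_left)

lemma finite_S: "finite S"
  using card_S by (metis card.infinite zero_neq_numeral)

lemma f_nz: "f \<noteq> 0"
  using c_nz finite_S by (auto simp: f_def)

lemma order_f: "order z f = of_bool (z \<in> S)"
  using order_prod_linear_power[OF finite_S, of z "\<lambda>_. 1"] c_nz
  by (simp add: f_def order_smult)

lemma poly_f_eq_0_iff: "poly f z = 0 \<longleftrightarrow> z \<in> S"
  using order_f[of z] f_nz order_root[of f z] by (cases "z \<in> S") auto

lemma degree_f: "degree f = 3"
  using c_nz card_S finite_S by (simp add: f_def degree_prod_sum_eq)

text \<open>The product of \<open>p + q y\<close> and its conjugate \<open>p - q y\<close>, that is,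
  the norm from the function field of the curve to the rational functions in
  \<open>x\<close>.\<close>

definition curve_norm :: "complex poly \<Rightarrow> complex poly \<Rightarrow> complex poly" where
  "curve_norm p q = p\<^sup>2 - q\<^sup>2 * f"

lemma degree_q2f: "q \<noteq> 0 \<Longrightarrow> degree (q\<^sup>2 * f) = 2 * degree q + 3"
  using f_nz by (simp add: degree_mult_eq degree_power_eq degree_f)

lemma degree_p2: "degree (p\<^sup>2) = 2 * degree (p :: complex poly)"
  by (cases "p = 0") (simp_all add: degree_power_eq)

text \<open>As \<open>f\<close> is cubic, the two terms of the norm have degrees of different parity
  and cannot cancel.\<close>

lemma degree_curve_norm:
  assumes "(p, q) \<noteq> (0, 0)"
  shows "degree (curve_norm p q) = pole_order_infinity p q"
proof (cases "p = 0 \<or> q = 0")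
  case True
  then show ?thesis using assms degree_q2f
    by (auto simp: pole_order_infinity_def curve_norm_def degree_p2)
next
  case False
  then have "degree (p\<^sup>2) \<noteq> degree (q\<^sup>2 * f)"
    by (simp add: degree_q2f degree_p2) presburger
  then have "degree (curve_norm p q) = max (degree (p\<^sup>2)) (degree (q\<^sup>2 * f))"
    using degree_add_eq_left[of "- (q\<^sup>2 * f)" "p\<^sup>2"] degree_add_eq_right[of "p\<^sup>2" "- (q\<^sup>2 * f)"]
    unfolding curve_norm_def by (simp add: max_def)
  then show ?thesis using False by (simp add: pole_order_infinity_def degree_q2f degree_p2)
qed

lemma curve_norm_nz:
  assumes "(p, q) \<noteq> (0, 0)"
  shows "curve_norm p q \<noteq> 0"
proof (cases "q = 0")
  case True
  then show ?thesis using assms by (auto simp: curve_norm_def)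
next
  case False
  then have "degree (curve_norm p q) \<noteq> 0"
    using degree_curve_norm[OF assms] by (auto simp: pole_order_infinity_def)
  then show ?thesis by auto
qed

lemma curve_norm_mult:
  "curve_norm (p * r + q * s * f) (p * s + q * r) = curve_norm p q * curve_norm r s"
  by (simp add: curve_norm_def algebra_simps power2_eq_square)

lemma curve_mult_nz:
  assumes "(p, q) \<noteq> (0, 0)" "(r, s) \<noteq> (0, 0)"
  shows "(p * r + q * s * f, p * s + q * r) \<noteq> (0, 0)"
  using curve_norm_mult[of p r q s] curve_norm_nz[OF assms(1)] curve_norm_nz[OF assms(2)]
  by (auto simp: curve_norm_def)

abbreviation "exactly \<equiv> vanishes_exactly f"

abbreviation "ord \<equiv> \<lambda>x y p q. ord_affine f x y [:p, q:]"

lemma exactly_0: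
  assumes "poly p x + y * poly q x \<noteq> 0"
  shows "exactly x y 0 [:p, q:]"
  using assms by (intro vanishes_exactlyI[of 1 _ _ "[:p, q:]"]) auto

text \<open>Induction on the order of the norm at \<open>x\<close>. If both conjugates vanish over
  an unbranched point, the linear factor at \<open>x\<close> splits off; if only one does, it is the
  norm divided by a local unit; at a branch point \<open>y\<close> splits off.\<close>

lemma exactly_exists:
  assumes "(p, q) \<noteq> (0, 0)" "y\<^sup>2 = poly f x"
  shows "\<exists>k. exactly x y k [:p, q:]"
  using assms
proof (induction "order x (curve_norm p q)" arbitrary: p q rule: less_induct)
  case less
  let ?l = "[:- x, 1:]"
  have N: "curve_norm p q \<noteq> 0" using curve_norm_nz less.prems(1) .
  consider "poly p x + y * poly q x \<noteq> 0" | "y \<noteq> 0" "poly p x = 0" "poly q x = 0"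
    | "y \<noteq> 0" "poly p x + y * poly q x = 0" "poly p x - y * poly q x \<noteq> 0"
    | "y = 0" "poly p x = 0" by fastforce
  then show ?case
  proof cases
    case 1
    then show ?thesis using exactly_0 by blast
  next
    case 2
    then obtain p' q' where pq: "p = ?l * p'" "q = ?l * q'"
      by (metis dvdE poly_eq_0_iff_dvd)
    have nz: "(p', q') \<noteq> (0, 0)" using less.prems(1) pq by auto
    have "curve_norm p q = ?l * (?l * curve_norm p' q')"
      unfolding pq by (simp add: curve_norm_def algebra_simps power2_eq_square del: mult_pCons_left mult_pCons_right)
    then have "order x (curve_norm p q) = 2 + order x (curve_norm p' q')"
      using N by (simp add: order_mult order_linear_self del: mult_pCons_left mult_pCons_right)
    then have "order x (curve_norm p' q') < order x (curve_norm p q)" by simp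
    from less.hyps[OF this nz less.prems(2)]
    obtain k where k: "exactly x y k [:p', q':]" by blast
    have l: "exactly x y 1 [:?l, 0:]"
      using 2 by (intro vanishes_exactlyI[of 1 _ _ 1]) (auto simp: eval2_uniformizer)
    have "exactly x y (1 + k) [:p, q:]"
      by (rule vanishes_exactly_mult[OF l k]) (simp add: pq algebra_simps)
    then show ?thesis by blast
  next
    case 3
    let ?N = "curve_norm p q"
    obtain u where u: "?N = ?l ^ order x ?N * u" "\<not> ?l dvd u"
      using order_decomp[OF N] by blast
    have "exactly x y (order x ?N) [:p, q:]"
    proof (rule vanishes_exactlyI[of "[:p, - q:]" _ _ "[:u:]"])
      fix x' y' assume y': "y'\<^sup>2 = poly f x'"
      have "eval2 [:p, - q:] x' y' * eval2 [:p, q:] x' y' = poly ?N x'"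
        unfolding curve_norm_def by (simp add: y'[symmetric] algebra_simps power2_eq_square)
      also have "\<dots> = (x' - x) ^ order x ?N * poly u x'"
        by (subst u(1)) (simp add: poly_power)
      finally show "eval2 [:p, - q:] x' y' * eval2 [:p, q:] x' y'
          = eval2 (uniformizer x y) x' y' ^ order x ?N * eval2 [:u:] x' y'"
        using 3 by (simp add: eval2_uniformizer)
    qed (use 3 u in \<open>auto simp: poly_eq_0_iff_dvd\<close>)
    then show ?thesis by blast
  next
    case 4
    then obtain p' where p: "p = ?l * p'" by (metis dvdE poly_eq_0_iff_dvd)
    have xS: "x \<in> S" using 4 less.prems(2) poly_f_eq_0_iff by auto
    then obtain f1 where f1: "f = ?l * f1" by (metis dvdE poly_eq_0_iff_dvd poly_f_eq_0_iff)
    have f1nz: "f1 \<noteq> 0" using f_nz f1 by auto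
    have of1: "order x f1 = 0"
      using order_f[of x] xS f_nz unfolding f1 by (simp add: order_mult order_linear_self del: mult_pCons_left)
    then have f1x: "poly f1 x \<noteq> 0" using f1nz order_root by blast
    have nz: "(q * f1, p') \<noteq> (0, 0)" using less.prems(1) p f1nz by auto
    \<comment> \<open>From \<open>y^2 = f\<close> and \<open>f = l f1\<close>, with \<open>l\<close>
      the linear factor at \<open>x\<close>, one gets \<open>f1 (p + q y) = y (q f1 + p' y)\<close>;
      this line compares the norms.\<close>
    have "curve_norm p q * f1 = - (?l * curve_norm (q * f1) p')"
      unfolding curve_norm_def unfolding p f1
      by (simp add: algebra_simps power2_eq_square del: mult_pCons_left mult_pCons_right)
    then have "order x (curve_norm p q * f1) = order x (?l * curve_norm (q * f1) p')"
      by (metis order_uminus)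
    moreover have "?l * curve_norm (q * f1) p' \<noteq> 0" using curve_norm_nz[OF nz]
      by (metis mult_eq_0_iff pCons_eq_0_iff zero_neq_one)
    moreover have "curve_norm p q * f1 \<noteq> 0" using N f1nz by simp
    ultimately have "order x (curve_norm p q) = 1 + order x (curve_norm (q * f1) p')"
      using of1 by (simp add: order_mult order_linear_self del: mult_pCons_left mult_pCons_right)
    then have "order x (curve_norm (q * f1) p') < order x (curve_norm p q)" by simp
    from less.hyps[OF this nz less.prems(2)] obtain U V k where U: "eval2 V x y \<noteq> 0" "eval2 U x y \<noteq> 0"
      "\<And>x' y'. y'\<^sup>2 = poly f x' \<Longrightarrow>
        eval2 V x' y' * eval2 [:q * f1, p':] x' y' = eval2 (uniformizer x y) x' y' ^ k * eval2 U x' y'"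
      unfolding vanishes_exactly_def by blast
    have "exactly x y (Suc k) [:p, q:]"
    proof (rule vanishes_exactlyI[of "V * [:f1:]" _ _ U])
      fix x' y' assume y': "y'\<^sup>2 = poly f x'"
      have "poly f x' = (x' - x) * poly f1 x'" by (subst f1) (simp add: algebra_simps)
      then have "y' * y' = (x' - x) * poly f1 x'" using y' by (simp add: power2_eq_square)
      then have "poly f1 x' * eval2 [:p, q:] x' y' = y' * eval2 [:q * f1, p':] x' y'"
        by (simp add: p) algebra
      then have "eval2 (V * [:f1:]) x' y' * eval2 [:p, q:] x' y'
          = y' * (eval2 V x' y' * eval2 [:q * f1, p':] x' y')"
        by (metis eval2_simps(1,6) mult.assoc mult.left_commute)
      then show "eval2 (V * [:f1:]) x' y' * eval2 [:p, q:] x' y'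
          = eval2 (uniformizer x y) x' y' ^ Suc k * eval2 U x' y'"
        unfolding U(3)[OF y'] using 4 by (simp add: eval2_uniformizer)
    qed (use U f1x in auto)
    then show ?thesis by blast
  qed
qed

lemma exactly_ord:
  assumes "(p, q) \<noteq> (0, 0)" "y\<^sup>2 = poly f x"
  shows "exactly x y (ord x y p q) [:p, q:]"
  using exactly_exists[OF assms] ord_affine_eqI[OF f_nz assms(2)] by metis

lemma vanishes_iff_le_ord:
  assumes "(p, q) \<noteq> (0, 0)" "y\<^sup>2 = poly f x"
  shows "vanishes f x y k [:p, q:] \<longleftrightarrow> k \<le> ord x y p q"
  using exactly_ord[OF assms] vanishes_le[OF f_nz assms(2)] vanishes_mono vanishes_exactly_imp
  by meson

lemma ord_mult:
  assumes "(p, q) \<noteq> (0, 0)" "(r, s) \<noteq> (0, 0)" "y\<^sup>2 = poly f x"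
  shows "ord x y (p * r + q * s * f) (p * s + q * r) = ord x y p q + ord x y r s"
  by (rule ord_affine_eqI[OF f_nz assms(3)],
      rule vanishes_exactly_mult[OF exactly_ord[OF assms(1,3)] exactly_ord[OF assms(2,3)]])
     (simp add: algebra_simps power2_eq_square)

lemma ord_eq_0:
  assumes "y\<^sup>2 = poly f x" "poly p x + y * poly q x \<noteq> 0"
  shows "ord x y p q = 0"
  by (rule ord_affine_eqI[OF f_nz assms(1) exactly_0[OF assms(2)]])

lemma ord_conj:
  assumes "(p, q) \<noteq> (0, 0)" "y\<^sup>2 = poly f x"
  shows "ord x y p (- q) = ord x (- y) p q"
proof (rule ord_affine_eqI[OF f_nz assms(2)])
  define k where "k = ord x (- y) p q"
  define flip :: "complex poly poly \<Rightarrow> complex poly poly" where "flip U = pcompose U [:0, - 1:]" for U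
  have flip: "eval2 (flip U) x y = eval2 U x (- y)" for U x y
    by (simp add: eval2_def flip_def poly_pcompose)
  obtain U V where U: "eval2 V x (- y) \<noteq> 0" "eval2 U x (- y) \<noteq> 0"
    "\<And>x' y'. y'\<^sup>2 = poly f x' \<Longrightarrow> eval2 V x' y' * eval2 [:p, q:] x' y'
      = eval2 (uniformizer x (- y)) x' y' ^ k * eval2 U x' y'"
    using exactly_ord[of p q "- y" x] assms unfolding vanishes_exactly_def k_def by auto
  \<comment> \<open>At a branch point the uniformizer is \<open>y\<close> itself and changes sign
    under conjugation; elsewhere it depends on \<open>x\<close> only.\<close>
  define s :: complex where "s = (if y = 0 then (- 1) ^ k else 1)"
  show "exactly x y k [:p, - q:]"
  proof (rule vanishes_exactlyI[of "flip V" _ _ "[:[:s:]:] * flip U"])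
    fix x' y' assume y': "y'\<^sup>2 = poly f x'"
    have "eval2 (flip V) x' y' * eval2 [:p, - q:] x' y' = eval2 V x' (- y') * eval2 [:p, q:] x' (- y')"
      by (simp add: flip)
    also have "\<dots> = eval2 (uniformizer x (- y)) x' (- y') ^ k * eval2 U x' (- y')"
      using U(3)[of "- y'" x'] y' by simp
    also have "eval2 (uniformizer x (- y)) x' (- y') ^ k = eval2 (uniformizer x y) x' y' ^ k * s"
      by (simp add: eval2_uniformizer s_def power_minus' power_minus[of y'])
    finally show "eval2 (flip V) x' y' * eval2 [:p, - q:] x' y'
        = eval2 (uniformizer x y) x' y' ^ k * eval2 ([:[:s:]:] * flip U) x' y'"
      by (simp add: flip mult.assoc del: mult_pCons_left)
  qed (use U in \<open>auto simp: flip s_def simp del: mult_pCons_left\<close>)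
qed

text \<open>The function times its conjugate is the norm, and conjugation exchanges the points
  \<open>(x, y)\<close> and \<open>(x, - y)\<close>.\<close>

lemma ord_add_ord_conj:
  assumes "(p, q) \<noteq> (0, 0)" "y\<^sup>2 = poly f x"
  shows "ord x y p q + ord x (- y) p q = ord x y (curve_norm p q) 0"
proof -
  have "ord x y (p * p + q * (- q) * f) (p * (- q) + q * p) = ord x y p q + ord x y p (- q)"
    using assms by (intro ord_mult) auto
  moreover have "p * p + q * (- q) * f = curve_norm p q" "p * (- q) + q * p = 0"
    by (simp_all add: curve_norm_def power2_eq_square)
  ultimately show ?thesis using ord_conj[OF assms] by (metis add.commute)
qed

lemma ord_const_mult:
  assumes "p \<noteq> 0" "r \<noteq> 0" "y\<^sup>2 = poly f x"
  shows "ord x y (p * r) 0 = ord x y p 0 + ord x y r 0"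
  using ord_mult[of p 0 r 0 y x] assms by simp

lemma ord_linear:
  assumes "y\<^sup>2 = poly f x"
  shows "ord x y [:- x, 1:] 0 = (if y = 0 then 2 else 1)"
proof (cases "y = 0")
  case False
  have "exactly x y 1 [:[:- x, 1:], 0:]"
    using False by (intro vanishes_exactlyI[of 1 _ _ 1]) (auto simp: eval2_uniformizer)
  then show ?thesis using ord_affine_eqI[OF f_nz assms] False by simp
next
  case True
  have xS: "x \<in> S" using True assms poly_f_eq_0_iff by auto
  then obtain f1 where f1: "f = [:- x, 1:] * f1" by (metis dvdE poly_eq_0_iff_dvd poly_f_eq_0_iff)
  have f1nz: "f1 \<noteq> 0" using f_nz f1 by auto
  have "order x f1 = 0"
    using order_f[of x] xS f_nz unfolding f1 by (simp add: order_mult order_linear_self del: mult_pCons_left)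
  then have f1x: "poly f1 x \<noteq> 0" using f1nz order_root by blast
  have "exactly x y 2 [:[:- x, 1:], 0:]"
    using True f1x by (intro vanishes_exactlyI[of "[:f1:]" _ _ 1]) (auto simp: eval2_uniformizer f1 algebra_simps)
  then show ?thesis using ord_affine_eqI[OF f_nz assms] True by simp
qed

lemma ord_const:
  assumes "p \<noteq> 0" "y\<^sup>2 = poly f x"
  shows "ord x y p 0 = (if y = 0 then 2 else 1) * order x p"
proof -
  let ?l = "[:- x, 1:]"
  have *: "ord x y (?l ^ k) 0 = (if y = 0 then 2 else 1) * k" for k
  proof (induction k)
    case 0
    then show ?case using ord_eq_0[of y x 1 0] assms by simp
  next
    case (Suc k)
    then show ?case
      using ord_const_mult[of ?l "?l ^ k" y x] assms ord_linear[OF assms(2)]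
      by (simp del: mult_pCons_left)
  qed
  obtain u where u: "p = ?l ^ order x p * u" "\<not> ?l dvd u"
    using order_decomp[OF assms(1)] by blast
  have "u \<noteq> 0" "poly u x \<noteq> 0" using u by (auto simp: poly_eq_0_iff_dvd)
  then show ?thesis
    using ord_const_mult[of "?l ^ order x p" u y x] * assms(2) ord_eq_0[of y x u 0] u(1) by auto
qed

text \<open>A branch point is its own conjugate, so the norm has twice the order of the function
  there; \<open>ord_const\<close> contributes the same factor 2 on the other side.\<close>

lemma ord_branch:
  assumes "(p, q) \<noteq> (0, 0)" "z \<in> S"
  shows "ord z 0 p q = order z (curve_norm p q)"
  using ord_add_ord_conj[OF assms(1), of 0 z] ord_const[OF curve_norm_nz[OF assms(1)], of 0 z]
    assms(2) poly_f_eq_0_iff by simp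

lemma ord_sum_unbranched:
  assumes "(p, q) \<noteq> (0, 0)" "z \<notin> S" "y\<^sup>2 = poly f z"
  shows "ord z y p q + ord z (- y) p q = order z (curve_norm p q)"
proof -
  have "y \<noteq> 0" using assms(2,3) poly_f_eq_0_iff[of z] by auto
  then show ?thesis
    unfolding ord_add_ord_conj[OF assms(1,3)] ord_const[OF curve_norm_nz[OF assms(1)] assms(3)]
    by simp
qed

end

text \<open>\<open>A + B y\<close> has norm \<open>X^(2n)\<close>. The coefficient condition fixes
  the sign of \<open>A\<close>; a nonzero \<open>A(0)\<close> keeps the function and its conjugate
  from vanishing together over \<open>0\<close>, so the zeros lie at only one point there.\<close>

definition pell_solution :: "'a::field poly \<Rightarrow> nat \<Rightarrow> 'a poly \<Rightarrow> 'a poly \<Rightarrow> bool" where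
  "pell_solution f n A B \<longleftrightarrow>
     A\<^sup>2 - B\<^sup>2 * f = [:0, 1:] ^ (2 * n) \<and> degree A \<le> n \<and> coeff A n = 1 \<and> poly A 0 \<noteq> 0"

lemma order_X_power: "order z ([:0, 1:] ^ n) = (if z = 0 then n else 0)" for z :: complex
  using order_prod_linear_power[of "{0}" z "\<lambda>_. n"] by simp

lemma coeff_X_power: "coeff ([:0, 1:] ^ n) k = (if k = n then 1 else 0)"
  for n :: nat
  by (metis coeff_monom monom_altdef smult_1_left)

lemma vanishes_uminus:
  assumes "vanishes f x0 y0 k G"
  shows "vanishes f x0 y0 k (- G)"
proof -
  have "eval2 (- H) x y = - eval2 H x y" for H x y
    by (simp add: eval2_def)
  then show ?thesis using assms unfolding vanishes_def by (metis mult_minus_right)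
qed

section \<open>Pell solutions and divisors supported at branch points and over
  \<open>0\<close>\<close>

context cubic_curve
begin

lemma ord_y:
  assumes "y\<^sup>2 = poly f x"
  shows "ord x y 0 1 = (if y = 0 then 1 else 0)"
proof (cases "y = 0")
  case True
  then have "x \<in> S" using assms poly_f_eq_0_iff by simp
  then show ?thesis using True ord_branch[of 0 1 x] order_f[of x] by (simp add: curve_norm_def)
next
  case False
  then show ?thesis using ord_eq_0[of y x 0 1] assms by simp
qed

text \<open>\<open>2 p\<close> and \<open>2 q y\<close> are the sum and the difference of the
  function and its conjugate; \<open>y\<close> itself has order one at a branch point.\<close>

lemma ord_components:
  assumes nz: "(p, q) \<noteq> (0, 0)" and y: "y\<^sup>2 = poly f x"
    and k: "k \<le> ord x y p q" "k \<le> ord x (- y) p q"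
  shows "p \<noteq> 0 \<Longrightarrow> k \<le> (if y = 0 then 2 else 1) * order x p"
    and "q \<noteq> 0 \<Longrightarrow> k \<le> (if y = 0 then 2 else 1) * order x q + (if y = 0 then 1 else 0)"
proof -
  have v1: "vanishes f x y k [:p, q:]"
    using vanishes_iff_le_ord[OF nz y] k by blast
  have v2: "vanishes f x y k [:p, - q:]"
    using vanishes_iff_le_ord[of p "- q" y x k] nz y k ord_conj[OF nz y] by auto
  show "k \<le> (if y = 0 then 2 else 1) * order x p" if "p \<noteq> 0"
  proof -
    have "vanishes f x y k [:smult 2 p, 0:]"
      by (rule vanishes_add[OF v1 v2]) simp
    then have "k \<le> ord x y (smult 2 p) 0"
      using vanishes_iff_le_ord[of "smult 2 p" 0 y x k] y that by simp
    then show ?thesis using ord_const[of "smult 2 p" y x] that y by (simp add: order_smult)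
  qed
  show "k \<le> (if y = 0 then 2 else 1) * order x q + (if y = 0 then 1 else 0)" if "q \<noteq> 0"
  proof -
    have "vanishes f x y k [:0, smult 2 q:]"
      by (rule vanishes_add[OF v1 vanishes_uminus[OF v2]]) simp
    then have "k \<le> ord x y 0 (smult 2 q)"
      using vanishes_iff_le_ord[of 0 "smult 2 q" y x k] y that by simp
    also have "ord x y 0 (smult 2 q) = ord x y 0 1 + ord x y (smult 2 q) 0"
      using ord_mult[of 0 1 "smult 2 q" 0 y x] y that by simp
    finally show ?thesis
      using ord_const[of "smult 2 q" y x] ord_y[OF y] that y by (simp add: order_smult)
  qed
qed

text \<open>The coefficient function of \<open>n Q\<^sub>0 - (\<Sum>z\<in>S. k z Q\<^sub>z)\<close>.\<close>

definition branch_divisor :: "nat \<Rightarrow> complex \<Rightarrow> (complex \<Rightarrow> nat) \<Rightarrow> curve_point \<Rightarrow> int" where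
  "branch_divisor n y0 k P = (case P of At_Infinity \<Rightarrow> 0
     | Affine x y \<Rightarrow> if x \<in> S then - int (k x) else if x = 0 \<and> y = y0 then int n else 0)"

text \<open>Write the given function as \<open>h = (P + Q y) / R\<close>. Then \<open>m h^2\<close>
  has no poles except at infinity, hence is a polynomial function \<open>A + B y\<close>. Its parts
  \<open>\<alpha>\<close>, \<open>\<beta>\<close>, \<open>\<delta>\<close> below are the quotients
  of \<open>m P^2\<close>, \<open>m Q^2 f\<close> and \<open>m P Q\<close> by
  \<open>R^2\<close>.\<close>

lemma pell_if_principal:
  assumes S0: "0 \<notin> S" and n: "n \<ge> 1" and y0: "y0\<^sup>2 = poly f 0" and sum_k: "sum k S = n"
    and nz: "(p, q) \<noteq> (0, 0)" "(r, s) \<noteq> (0, 0)"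
    and D: "\<And>P. P \<in> curve f \<Longrightarrow> branch_divisor n y0 k P = ord_at f P p q - ord_at f P r s"
  shows "\<exists>A B. pell_solution f n A B \<and> (\<forall>z\<in>S. poly A z = (- 1) ^ k z * z ^ n)"
proof -
  let ?X = "[:0, 1:] :: complex poly"
  define P where "P = p * r + q * (- s) * f"
  define Q where "Q = p * (- s) + q * r"
  define R0 where "R0 = curve_norm r s"
  define m where "m = (\<Prod>z\<in>S. [:- z, 1:] ^ k z)"
  have nz': "(r, - s) \<noteq> (0, 0)" using nz by auto
  have PQ: "(P, Q) \<noteq> (0, 0)" unfolding P_def Q_def by (rule curve_mult_nz[OF nz(1) nz'])
  have R0: "R0 \<noteq> 0" unfolding R0_def by (rule curve_norm_nz[OF nz(2)])
  have m: "m \<noteq> 0" using finite_S by (simp add: m_def)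
  have order_m: "order z m = (if z \<in> S then k z else 0)" for z
    unfolding m_def by (rule order_prod_linear_power[OF finite_S])
  have degree_m: "degree m = n"
    using finite_S sum_k by (simp add: m_def degree_prod_sum_eq degree_power_eq)
  have ordPQ: "int (ord x y P Q) = branch_divisor n y0 k (Affine x y) + int (ord x y R0 0)"
    if y: "y\<^sup>2 = poly f x" for x y
  proof -
    have "ord x y P Q = ord x y p q + ord x y r (- s)"
      unfolding P_def Q_def by (rule ord_mult[OF nz(1) nz' y])
    moreover have "ord x y R0 0 = ord x y r s + ord x y r (- s)"
      using ord_add_ord_conj[OF nz(2) y] ord_conj[OF nz(2) y] by (simp add: R0_def)
    moreover have "Affine x y \<in> curve f" using y by (simp add: curve_def)
    ultimately show ?thesis using D[of "Affine x y"] by (simp add: ord_at_def)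
  qed
  define N where "N = curve_norm P Q"
  have N: "N \<noteq> 0" unfolding N_def by (rule curve_norm_nz[OF PQ])
  \<comment> \<open>Off \<open>S\<close> the orders at the two points over \<open>z\<close> are
    added; at a branch point there is one point, and \<open>m\<close> compensates the pole.\<close>
  have order_N: "order z N + order z m = order z (?X ^ n) + 2 * order z R0" for z
  proof (cases "z \<in> S")
    case True
    then have f0: "0\<^sup>2 = poly f z" using poly_f_eq_0_iff by simp
    have "int (order z N) = - int (k z) + int (2 * order z R0)"
      using ordPQ[OF f0] True ord_branch[OF PQ True] ord_const[OF R0 f0]
      by (simp add: N_def branch_divisor_def)
    moreover have "z \<noteq> 0" using True S0 by auto
    ultimately show ?thesis using True by (simp add: order_m order_X_power)
  next
    case False
    define y where "y = (if z = 0 then y0 else csqrt (poly f z))"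
    have y: "y\<^sup>2 = poly f z" "(- y)\<^sup>2 = poly f z" using y0 by (auto simp: y_def)
    have "y \<noteq> 0" using False y poly_f_eq_0_iff[of z] by auto
    then have "int (order z N) = (if z = 0 then int n else 0) + 2 * int (order z R0)"
      using ordPQ[OF y(1)] ordPQ[OF y(2)] ord_sum_unbranched[OF PQ False y(1)] False
        ord_const[OF R0 y(1)] ord_const[OF R0 y(2)]
      by (auto simp: branch_divisor_def N_def y_def)
    then show ?thesis using False by (auto simp: order_m order_X_power)
  qed
  have "order z (N * m) = order z (?X ^ n * R0\<^sup>2)" for z
    using order_N[of z] N m R0 by (simp add: order_mult power2_eq_square del: mult_pCons_left)
  then obtain d where d: "d \<noteq> 0" "N * m = smult d (?X ^ n * R0\<^sup>2)"
    using poly_eq_smult_if_orders_eq[of "N * m" "?X ^ n * R0\<^sup>2"] N m R0 by auto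
  \<comment> \<open>The constant \<open>d\<close> is absorbed into the denominator, so that
    \<open>\<alpha> - \<beta>\<close> becomes exactly \<open>X^n\<close>.\<close>
  define R where "R = smult (csqrt d) R0"
  have R: "R \<noteq> 0" and order_R: "order z R = order z R0" for z
    using d R0 by (auto simp: R_def order_smult)
  have Nm: "N * m = ?X ^ n * R\<^sup>2"
    unfolding d(2) R_def by (simp add: smult_power mult_smult_right del: mult_pCons_left)
  have le: "ord x y R0 0 - order x m \<le> ord x y P Q" if "y\<^sup>2 = poly f x" for x y
  proof -
    have "branch_divisor n y0 k (Affine x y) \<ge> - int (order x m)"
      by (simp add: branch_divisor_def order_m)
    then show ?thesis using ordPQ[OF that] by linarith
  qed
  have ordP: "2 * order z R \<le> 2 * order z P + order z m" if "P \<noteq> 0" for z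
  proof -
    define y where "y = csqrt (poly f z)"
    have y: "y\<^sup>2 = poly f z" "(- y)\<^sup>2 = poly f z" by (auto simp: y_def)
    have "y = 0 \<longleftrightarrow> z \<in> S" using y poly_f_eq_0_iff[of z] by auto
    then show ?thesis
      using ord_components(1)[OF PQ y(1) le[OF y(1)]] le[OF y(2)] that
        ord_const[OF R0 y(1)] ord_const[OF R0 y(2)]
      by (auto simp: order_m order_R split: if_splits)
  qed
  have ordQ: "2 * order z R \<le> 2 * order z Q + order z m + (if z \<in> S then 1 else 0)" if "Q \<noteq> 0" for z
  proof -
    define y where "y = csqrt (poly f z)"
    have y: "y\<^sup>2 = poly f z" "(- y)\<^sup>2 = poly f z" by (auto simp: y_def)
    have "y = 0 \<longleftrightarrow> z \<in> S" using y poly_f_eq_0_iff[of z] by auto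
    then show ?thesis
      using ord_components(2)[OF PQ y(1) le[OF y(1)]] le[OF y(2)] that
        ord_const[OF R0 y(1)] ord_const[OF R0 y(2)]
      by (auto simp: order_m order_R split: if_splits)
  qed
  have "R\<^sup>2 dvd P\<^sup>2 * m"
  proof (cases "P = 0")
    case False
    then show ?thesis using R m ordP
      by (intro poly_dvd_iff_order) (auto simp: order_mult power2_eq_square mult_2)
  qed simp
  then obtain \<alpha> where \<alpha>: "P\<^sup>2 * m = R\<^sup>2 * \<alpha>" by auto
  have "R\<^sup>2 dvd Q\<^sup>2 * f * m"
  proof (cases "Q = 0")
    case False
    have "2 * order z R \<le> 2 * order z Q + order z f + order z m" for z
      using ordQ[OF False, of z] order_f[of z] by (auto split: if_splits)
    then show ?thesis using R m f_nz False
      by (intro poly_dvd_iff_order) (auto simp: order_mult power2_eq_square mult_2)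
  qed simp
  then obtain \<beta> where \<beta>: "Q\<^sup>2 * f * m = R\<^sup>2 * \<beta>" by auto
  have "R\<^sup>2 dvd P * Q * m"
  proof (cases "P = 0 \<or> Q = 0")
    case False
    have "2 * order z R \<le> order z P + order z Q + order z m" for z
      using ordQ[of z] ordP[of z] False by (auto split: if_splits)
    then show ?thesis using R m False
      by (intro poly_dvd_iff_order) (auto simp: order_mult power2_eq_square mult_2)
  qed auto
  then obtain \<delta> where \<delta>: "P * Q * m = R\<^sup>2 * \<delta>" by auto
  have R4: "R\<^sup>2 \<noteq> 0" using R by simp
  have "R\<^sup>2 * (\<alpha> - \<beta>) = R\<^sup>2 * ?X ^ n"
    using Nm \<alpha> \<beta> by (simp add: N_def curve_norm_def algebra_simps del: mult_pCons_left)
  then have diff: "\<alpha> - \<beta> = ?X ^ n" using R4 by (metis mult_left_cancel)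
  have "(R\<^sup>2 * \<alpha>) * (R\<^sup>2 * \<beta>) = (R\<^sup>2 * \<delta>)\<^sup>2 * f"
    unfolding \<alpha>[symmetric] \<beta>[symmetric] \<delta>[symmetric] by (simp add: power2_eq_square algebra_simps)
  then have "(R\<^sup>2 * R\<^sup>2) * (\<alpha> * \<beta>) = (R\<^sup>2 * R\<^sup>2) * (\<delta>\<^sup>2 * f)"
    by (simp add: power2_eq_square algebra_simps)
  then have prod: "\<alpha> * \<beta> = \<delta>\<^sup>2 * f" using R4 by (metis mult_left_cancel mult_eq_0_iff)
  define A where "A = \<alpha> + \<beta>"
  define B where "B = 2 * \<delta>"
  have "A\<^sup>2 - B\<^sup>2 * f = (\<alpha> + \<beta>)\<^sup>2 - 4 * (\<delta>\<^sup>2 * f)"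
    unfolding A_def B_def by (simp add: power2_eq_square)
  also have "\<dots> = (\<alpha> - \<beta>)\<^sup>2" unfolding prod[symmetric] by (simp add: power2_eq_square algebra_simps)
  finally have pell: "A\<^sup>2 - B\<^sup>2 * f = ?X ^ (2 * n)"
    unfolding diff by (simp add: mult.commute[of 2] power_mult)
  have deg_\<alpha>: "2 * degree P + n = 2 * degree R + degree \<alpha>" if "P \<noteq> 0"
  proof -
    have "\<alpha> \<noteq> 0" using that \<alpha> m by auto
    then show ?thesis
      using arg_cong[OF \<alpha>, of degree] that m R by (simp add: degree_mult_eq degree_power_eq degree_m)
  qed
  have deg_\<beta>: "2 * degree Q + 3 + n = 2 * degree R + degree \<beta>" if "Q \<noteq> 0"
  proof -
    have "\<beta> \<noteq> 0" using that \<beta> m f_nz by auto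
    then show ?thesis using arg_cong[OF \<beta>, of degree] that m R f_nz
      by (simp add: degree_mult_eq degree_power_eq degree_m degree_f)
  qed
  have "P = 0 \<Longrightarrow> \<alpha> = 0" using \<alpha> R4 by simp
  have "Q = 0 \<Longrightarrow> \<beta> = 0" using \<beta> R4 by simp
  have degX: "degree (?X ^ n) = n" by (simp add: degree_power_eq)
  \<comment> \<open>A nonzero \<open>\<beta>\<close> has degree of parity opposite to
    \<open>n\<close>, so the leading term of \<open>X^n = \<alpha> - \<beta>\<close> comes from
    \<open>\<alpha>\<close>. This makes \<open>A = X^n + 2 \<beta>\<close> monic.\<close>
  have "degree \<beta> < n"
  proof (cases "Q = 0")
    case True
    then show ?thesis using \<open>Q = 0 \<Longrightarrow> \<beta> = 0\<close> n by simp
  next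
    case False
    show ?thesis
    proof (cases "P = 0")
      case True
      then have "- \<beta> = ?X ^ n" using diff \<open>P = 0 \<Longrightarrow> \<alpha> = 0\<close> by simp
      then have "degree \<beta> = n" using degX by (metis degree_minus)
      then show ?thesis using deg_\<beta>[OF False] by presburger
    next
      case P: False
      have ne: "degree \<alpha> \<noteq> degree \<beta>" using deg_\<alpha>[OF P] deg_\<beta>[OF False] by presburger
      show ?thesis
      proof (cases "degree \<alpha> < degree \<beta>")
        case True
        then have "degree \<beta> = n"
          using degree_add_eq_right[of \<alpha> "- \<beta>"] diff degX by simp
        then show ?thesis using deg_\<beta>[OF False] by presburger
      next
        case False
        then have "degree \<beta> < degree \<alpha>" using ne by simp
        moreover from this have "degree \<alpha> = n"
          using degree_add_eq_left[of "- \<beta>" \<alpha>] diff degX by simp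
        ultimately show ?thesis by simp
      qed
    qed
  qed
  moreover have \<alpha>_eq: "\<alpha> = ?X ^ n + \<beta>" using diff by (simp add: algebra_simps)
  moreover have "A = ?X ^ n + smult 2 \<beta>"
    unfolding A_def \<alpha>_eq by (metis add.assoc one_add_one smult_1_left smult_add_left)
  ultimately have A: "degree A \<le> n" "coeff A n = 1"
    using degX
    by (auto intro!: degree_add_le simp: coeff_X_power coeff_eq_0)
  have \<alpha>\<beta>: "\<alpha> \<noteq> 0" "P \<noteq> 0"
    using \<open>degree \<beta> < n\<close> \<alpha>_eq \<open>P = 0 \<Longrightarrow> \<alpha> = 0\<close> degX
    by (metis add.commute add_eq_0_iff degree_minus less_irrefl)+
  have oz: "2 * order z P + order z m = 2 * order z R + order z \<alpha>" for z
    using arg_cong[OF \<alpha>, of "order z"] m R \<alpha>\<beta> by (simp add: order_mult power2_eq_square)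
  have oz': "2 * order z Q + order z f + order z m = 2 * order z R + order z \<beta>" if "Q \<noteq> 0" for z
  proof -
    have "\<beta> \<noteq> 0" using that \<beta> m f_nz by auto
    then show ?thesis
      using arg_cong[OF \<beta>, of "order z"] m R f_nz that by (simp add: order_mult power2_eq_square)
  qed
  \<comment> \<open>Otherwise \<open>\<alpha>\<close> and \<open>\<beta>\<close>, which agree at
    \<open>0\<close>, both vanish there, \<open>P\<close> and \<open>Q\<close> contain one factor
    \<open>X\<close> more than \<open>R\<close>, and \<open>h\<close> vanishes at the second point
    over \<open>0\<close> as well.\<close>
  have A0: "poly A 0 \<noteq> 0"
  proof
    assume "poly A 0 = 0"
    moreover have "poly \<alpha> 0 = poly \<beta> 0" using n unfolding \<alpha>_eq by (simp add: poly_power)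
    ultimately have z: "poly \<alpha> 0 = 0" "poly \<beta> 0 = 0" by (auto simp: A_def)
    let ?e = "Suc (order 0 R)"
    have "order 0 \<alpha> \<noteq> 0" using z \<alpha>\<beta> order_root by blast
    then have "?e \<le> order 0 P" using oz[of 0] S0 by (simp add: order_m)
    then obtain P' where P': "P = ?X ^ ?e * P'"
      using order_divides[of 0 ?e P] by (auto simp del: mult_pCons_left power_Suc)
    have "?X ^ ?e dvd Q"
    proof (cases "Q = 0")
      case False
      then have "\<beta> \<noteq> 0" using \<beta> m f_nz by auto
      then have "order 0 \<beta> \<noteq> 0" using z order_root by blast
      then have "?e \<le> order 0 Q" using oz'[OF False, of 0] S0 order_f[of 0] by (simp add: order_m)
      then show ?thesis using order_divides[of 0 ?e Q] by (auto simp del: mult_pCons_left power_Suc)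
    qed simp
    then obtain Q' where Q': "Q = ?X ^ ?e * Q'" by auto
    have nz'': "(P', Q') \<noteq> (0, 0)" using PQ P' Q' by auto
    have my: "(- y0)\<^sup>2 = poly f 0" "- y0 \<noteq> 0" "- y0 \<noteq> y0"
      using y0 S0 poly_f_eq_0_iff[of 0] by auto
    have "ord 0 (- y0) P Q = ord 0 (- y0) (?X ^ ?e) 0 + ord 0 (- y0) P' Q'"
      unfolding P' Q' using ord_mult[of "?X ^ ?e" 0 P' Q' "- y0" 0] nz'' my(1)
      by (simp del: mult_pCons_left power_Suc)
    also have "ord 0 (- y0) (?X ^ ?e) 0 = ?e"
      using ord_const[of "?X ^ ?e" "- y0" 0] my by (simp add: order_X_power del: power_Suc)
    finally have "ord 0 (- y0) P Q \<ge> ?e" by simp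
    moreover have "ord 0 (- y0) P Q = order 0 R"
      using ordPQ[OF my(1)] S0 my ord_const[OF R0 my(1)] order_R[of 0]
      by (simp add: branch_divisor_def)
    ultimately show False by simp
  qed
  \<comment> \<open>\<open>A\<close> equals both \<open>X^n + 2 \<beta>\<close> and
    \<open>2 \<alpha> - X^n\<close>; the parity of \<open>k z\<close> decides which of
    \<open>\<alpha>\<close>, \<open>\<beta>\<close> has odd order at \<open>z\<close> or is zero,
    and hence vanishes there.\<close>
  have "poly A z = (- 1) ^ k z * z ^ n" if z: "z \<in> S" for z
  proof (cases "even (k z)")
    case True
    have "poly \<beta> z = 0"
    proof (cases "Q = 0")
      case False
      then have "\<beta> \<noteq> 0" using \<beta> m f_nz by auto
      moreover have "odd (order z \<beta>)"
        using oz'[OF False, of z] True z order_f[of z] by (simp add: order_m) presburger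
      ultimately show ?thesis using order_root[of \<beta> z] by (metis even_zero)
    qed (simp add: \<open>Q = 0 \<Longrightarrow> \<beta> = 0\<close>)
    then show ?thesis using True by (simp add: A_def \<alpha>_eq poly_power)
  next
    case False
    then have "odd (order z \<alpha>)" using oz[of z] z by (simp add: order_m) presburger
    then have "poly \<alpha> z = 0" using order_root[of \<alpha> z] by (metis even_zero)
    moreover from this have "poly \<beta> z = - (z ^ n)" unfolding \<alpha>_eq
      by (simp add: poly_power add_eq_0_iff)
    ultimately show ?thesis using False by (simp add: A_def)
  qed
  then show ?thesis using pell A A0 unfolding pell_solution_def by blast
qed

text \<open>\<open>(A + X^n) / 2\<close> and \<open>(A - X^n) / 2\<close> have product
  \<open>\<delta>^2 f\<close> and no common zero, so each is a square times linear factors of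
  \<open>f\<close>; those of the first are given by \<open>T\<close>. The function
  \<open>mT P + Q y\<close> built from the roots is a square root of \<open>mT (A + B y)\<close>, up
  to the sign of \<open>B\<close>.\<close>

lemma pell_factors:
  assumes S0: "0 \<notin> S" and n: "n \<ge> 1" and pell: "pell_solution f n A B"
  defines "T \<equiv> {z \<in> S. poly A z = - (z ^ n)}"
  shows "\<exists>P Q. smult (1 / 2) (A + [:0, 1:] ^ n) = (\<Prod>z\<in>T. [:- z, 1:]) * P\<^sup>2 \<and>
    curve_norm ((\<Prod>z\<in>T. [:- z, 1:]) * P) Q = (\<Prod>z\<in>T. [:- z, 1:]) * [:0, 1:] ^ n"
proof -
  let ?X = "[:0, 1:] :: complex poly"
  have A: "A\<^sup>2 - B\<^sup>2 * f = ?X ^ (2 * n)" "degree A \<le> n" "coeff A n = 1" "poly A 0 \<noteq> 0"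
    using pell by (auto simp: pell_solution_def)
  define \<alpha> where "\<alpha> = smult (1 / 2) (A + ?X ^ n)"
  define \<beta> where "\<beta> = smult (1 / 2) (A - ?X ^ n)"
  define \<delta> where "\<delta> = smult (1 / 2) B"
  have diff: "\<alpha> - \<beta> = ?X ^ n"
    by (simp add: \<alpha>_def \<beta>_def poly_eq_iff coeff_X_power field_simps)
  have "\<alpha> * \<beta> = smult (1 / 4) (A\<^sup>2 - (?X ^ n)\<^sup>2)"
    by (simp add: \<alpha>_def \<beta>_def power2_eq_square algebra_simps del: mult_pCons_left mult_pCons_right)
  also have "(?X ^ n)\<^sup>2 = ?X ^ (2 * n)" by (simp add: mult.commute[of 2] power_mult)
  also have "A\<^sup>2 - ?X ^ (2 * n) = B\<^sup>2 * f" using A(1) by (metis add_diff_cancel_left' diff_add_cancel diff_diff_eq2 add.commute)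
  also have "smult (1 / 4) (B\<^sup>2 * f) = \<delta>\<^sup>2 * f" by (simp add: \<delta>_def smult_power power2_eq_square)
  finally have prod: "\<alpha> * \<beta> = \<delta>\<^sup>2 * f" .
  have "coeff \<alpha> n = 1" using A(3) by (simp add: \<alpha>_def coeff_X_power)
  have \<alpha>: "\<alpha> \<noteq> 0" using \<open>coeff \<alpha> n = 1\<close> by auto
  have "B \<noteq> 0"
  proof
    assume "B = 0"
    then have "poly (A\<^sup>2) 0 = poly (?X ^ (2 * n)) 0" using A(1) by simp
    then show False using A(4) n by (simp add: poly_power power_0_left)
  qed
  then have "\<alpha> * \<beta> \<noteq> 0" using f_nz by (simp add: prod \<delta>_def)
  then have \<beta>: "\<beta> \<noteq> 0" by auto
  have \<delta>: "\<delta> \<noteq> 0" using \<open>B \<noteq> 0\<close> by (simp add: \<delta>_def)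
  have \<alpha>0: "poly \<alpha> 0 \<noteq> 0" using A(4) n by (simp add: \<alpha>_def poly_power power_0_left)
  have not_both: "poly \<alpha> z \<noteq> 0 \<or> poly \<beta> z \<noteq> 0" for z
  proof (rule ccontr)
    assume *: "\<not> ?thesis"
    then have "poly (?X ^ n) z = 0" unfolding diff[symmetric] by simp
    then have "z = 0" by (simp add: poly_power)
    then show False using * \<alpha>0 by simp
  qed
  have A_S: "poly A z = z ^ n \<or> poly A z = - (z ^ n)" if "z \<in> S" for z
  proof -
    have "(poly A z)\<^sup>2 = (z ^ n)\<^sup>2"
      using arg_cong[OF A(1), of "\<lambda>p. poly p z"] that poly_f_eq_0_iff[of z]
      by (simp add: poly_power power_mult mult.commute[of 2])
    then show ?thesis by (simp add: power2_eq_iff)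
  qed
  have fin: "finite T" "finite (S - T)" using finite_S by (auto simp: T_def)
  have \<alpha>T: "poly \<alpha> z = 0 \<longleftrightarrow> z \<in> T" if "z \<in> S" for z
    using A_S[OF that] that S0 by (auto simp: \<alpha>_def poly_power T_def)
  have \<beta>T: "poly \<beta> z = 0 \<longleftrightarrow> z \<notin> T" if "z \<in> S" for z
    using A_S[OF that] that S0 by (auto simp: \<beta>_def poly_power T_def)
  have o: "order z \<alpha> + order z \<beta> = 2 * order z \<delta> + of_bool (z \<in> S)" for z
    using arg_cong[OF prod, of "order z"] \<open>\<alpha> * \<beta> \<noteq> 0\<close> \<delta> f_nz order_f[of z]
    by (simp add: order_mult power2_eq_square)
  have o_\<alpha>: "order z \<alpha> = 0 \<or> order z \<beta> = 0" for z
    using not_both[of z] order_root by metis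
  define mT where "mT = (\<Prod>z\<in>T. [:- z, 1:])"
  define mU where "mU = (\<Prod>z\<in>S - T. [:- z, 1:])"
  have f_mTmU: "f = smult c (mT * mU)"
    using prod.subset_diff[of T S "\<lambda>z. [:- z, 1:]"] finite_S
    by (simp add: f_def mT_def mU_def T_def mult.commute)
  have m: "mT \<noteq> 0" "mU \<noteq> 0" using f_nz f_mTmU by auto
  have o_mT: "order z mT = of_bool (z \<in> T)" for z
    using order_prod_linear_power[OF fin(1), of z "\<lambda>_. 1"] by (simp add: mT_def)
  have o_mU: "order z mU = of_bool (z \<in> S - T)" for z
    using order_prod_linear_power[OF fin(2), of z "\<lambda>_. 1"] by (simp add: mU_def)
  have "order z mT \<le> order z \<alpha>" for z
    using \<alpha>T[of z] order_root[of \<alpha> z] \<alpha> by (cases "z \<in> T") (auto simp: o_mT T_def)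
  then have "mT dvd \<alpha>" using m \<alpha> by (intro poly_dvd_iff_order)
  then obtain \<alpha>' where \<alpha>': "\<alpha> = mT * \<alpha>'" by auto
  have "order z mU \<le> order z \<beta>" for z
    using \<beta>T[of z] order_root[of \<beta> z] \<beta> by (cases "z \<in> S - T") (auto simp: o_mU T_def)
  then have "mU dvd \<beta>" using m \<beta> by (intro poly_dvd_iff_order)
  then obtain \<beta>' where \<beta>': "\<beta> = mU * \<beta>'" by auto
  have "even (order z \<alpha>')" for z
  proof -
    have "order z \<alpha> = of_bool (z \<in> T) + order z \<alpha>'"
      using \<alpha> o_mT[of z] unfolding \<alpha>' by (simp add: order_mult)
    \<comment> \<open>At each point one of the two orders is zero, so the other is the full order of
      \<open>\<delta>^2 f\<close>, which is odd only at points of \<open>S\<close>.\<close>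
    moreover have "odd (order z \<alpha>) \<longleftrightarrow> z \<in> T"
    proof (cases "order z \<alpha> = 0")
      case True
      then have "poly \<alpha> z \<noteq> 0" using \<alpha> order_root by blast
      then have "z \<notin> T" using \<alpha>T[of z] by (auto simp: T_def)
      then show ?thesis using True by simp
    next
      case False
      then have "order z \<alpha> = 2 * order z \<delta> + of_bool (z \<in> S)" using o[of z] o_\<alpha>[of z] by simp
      moreover have "z \<in> S \<Longrightarrow> z \<in> T" using False \<alpha>T order_root by blast
      ultimately show ?thesis by (auto simp: T_def)
    qed
    ultimately show ?thesis by (cases "z \<in> T") auto
  qed
  then obtain P where P: "\<alpha>' = P\<^sup>2" using square_if_orders_even by blast
  have "even (order z \<beta>')" for z
  proof -
    have "order z \<beta> = of_bool (z \<in> S - T) + order z \<beta>'"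
      using \<beta> o_mU[of z] unfolding \<beta>' by (simp add: order_mult)
    moreover have "odd (order z \<beta>) \<longleftrightarrow> z \<in> S - T"
    proof (cases "order z \<beta> = 0")
      case True
      then have "poly \<beta> z \<noteq> 0" using \<beta> order_root by blast
      then have "z \<notin> S - T" using \<beta>T[of z] by auto
      then show ?thesis using True by simp
    next
      case False
      then have "order z \<beta> = 2 * order z \<delta> + of_bool (z \<in> S)" using o[of z] o_\<alpha>[of z] by simp
      moreover have "z \<in> S \<Longrightarrow> z \<notin> T" using False \<beta>T order_root by blast
      ultimately show ?thesis by auto
    qed
    ultimately show ?thesis by (cases "z \<in> S - T") auto
  qed
  then obtain Q0 where Q0: "\<beta>' = Q0\<^sup>2" using square_if_orders_even by blast
  \<comment> \<open>The scalar cancels the leading coefficient \<open>c\<close> of \<open>f\<close>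
    in \<open>Q1^2 f\<close>.\<close>
  define Q1 where "Q1 = smult (1 / csqrt c) Q0"
  have Q1: "Q1\<^sup>2 * f = mT * \<beta>"
    unfolding Q1_def f_mTmU \<beta>' Q0 using c_nz by (simp add: smult_power power_divide field_simps)
  have N1: "curve_norm (mT * P) Q1 = mT * ?X ^ n"
    unfolding curve_norm_def Q1 diff[symmetric] \<alpha>' P by (simp add: power2_eq_square algebra_simps)
  from N1 show ?thesis using \<alpha>' P unfolding \<alpha>_def mT_def by blast
qed

text \<open>Compare degrees in the factorization of \<open>(A + X^n) / 2\<close>, which has degree
  \<open>n\<close>. The values of \<open>A\<close> at two branch points thus determine the
  third.\<close>

lemma pell_parity:
  assumes "0 \<notin> S" "n \<ge> 1" "pell_solution f n A B"
  shows "even (n + card {z \<in> S. poly A z = - (z ^ n)})"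
proof -
  let ?T = "{z \<in> S. poly A z = - (z ^ n)}"
  let ?\<alpha> = "smult (1 / 2) (A + [:0, 1:] ^ n)"
  obtain P where P: "?\<alpha> = (\<Prod>z\<in>?T. [:- z, 1:]) * P\<^sup>2"
    using pell_factors[OF assms] by blast
  have A: "degree A \<le> n" "coeff A n = 1" using assms(3) by (auto simp: pell_solution_def)
  have c: "coeff ?\<alpha> n = 1" using A(2) by (simp add: coeff_X_power)
  moreover have "degree ?\<alpha> \<le> n" using A(1) by (auto intro!: degree_add_le simp: degree_power_eq)
  ultimately have "degree ?\<alpha> = n" by (metis le_antisym le_degree zero_neq_one)
  moreover have "?\<alpha> \<noteq> 0" using c by (metis coeff_0 zero_neq_one)
  ultimately have "n = card ?T + 2 * degree P"
    using finite_S unfolding P by (simp add: degree_mult_eq degree_power_eq degree_prod_sum_eq)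
  then show ?thesis by presburger
qed

text \<open>The function is \<open>(M + Q y) / R\<close>: the numerator has the zero
  \<open>n Q_0\<close> and simple zeros at the branch points of odd multiplicity, and
  \<open>R\<close> lowers the orders there to \<open>- k z\<close>.\<close>

lemma principal_if_pell:
  assumes S0: "0 \<notin> S" and n: "n \<ge> 1" and y0: "y0\<^sup>2 = poly f 0" and sum_k: "sum k S = n"
    and pell: "pell_solution f n A B"
    and A_S: "\<And>z. z \<in> S \<Longrightarrow> poly A z = (- 1) ^ k z * z ^ n"
  shows "\<exists>p q r s. (p, q) \<noteq> (0, 0) \<and> (r, s) \<noteq> (0, 0) \<and>
    (\<forall>P\<in>curve f. branch_divisor n y0 k P = ord_at f P p q - ord_at f P r s)"
proof -
  let ?X = "[:0, 1:] :: complex poly"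
  define T where "T = {z \<in> S. odd (k z)}"
  have "z \<in> S \<Longrightarrow> poly A z = - (z ^ n) \<longleftrightarrow> odd (k z)" for z
    using A_S[of z] S0 by (cases "even (k z)") auto
  then have T: "T = {z \<in> S. poly A z = - (z ^ n)}" by (auto simp: T_def)
  have fin: "finite T" using finite_S by (simp add: T_def)
  define mT where "mT = (\<Prod>z\<in>T. [:- z, 1:])"
  obtain P Q1 where PQ: "smult (1 / 2) (A + ?X ^ n) = mT * P\<^sup>2" "curve_norm (mT * P) Q1 = mT * ?X ^ n"
    using pell_factors[OF S0 n pell] unfolding mT_def T by blast
  note N1 = PQ(2)
  have m: "mT \<noteq> 0" using fin by (simp add: mT_def)
  have o_mT: "order z mT = of_bool (z \<in> T)" for z
    using order_prod_linear_power[OF fin, of z "\<lambda>_. 1"] by (simp add: mT_def)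
  have "poly A 0 \<noteq> 0" using pell by (simp add: pell_solution_def)
  moreover have "poly A 0 = 2 * poly (mT * P\<^sup>2) 0"
    unfolding PQ(1)[symmetric] using n by (simp add: poly_power power_0_left)
  ultimately have mTP: "poly mT 0 \<noteq> 0" "poly P 0 \<noteq> 0" by (auto simp: poly_power)
  have "(poly (mT * P) 0 + y0 * poly Q1 0) * (poly (mT * P) 0 - y0 * poly Q1 0)
      = poly (curve_norm (mT * P) Q1) 0"
    by (simp add: curve_norm_def y0[symmetric] algebra_simps power2_eq_square)
  also have "\<dots> = 0" unfolding N1 using n by (simp add: poly_power power_0_left)
  \<comment> \<open>The norm vanishes at \<open>0\<close>; the sign of \<open>Q\<close> is chosen so
    that the zero lies at \<open>(0, y0)\<close> and not at its conjugate.\<close>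
  finally obtain Q where Q: "Q = Q1 \<or> Q = - Q1" "poly (mT * P) 0 + y0 * poly Q 0 = 0"
    by fastforce
  define M where "M = mT * P"
  have N: "curve_norm M Q = mT * ?X ^ n"
    using N1 Q(1) by (auto simp: curve_norm_def M_def)
  have "P \<noteq> 0" using mTP by auto
  then have MQ: "(M, Q) \<noteq> (0, 0)" using m by (simp add: M_def)
  \<comment> \<open>Half of \<open>k z\<close>, rounded up: \<open>x - z\<close> has a double zero
    at the branch point, and the numerator a simple one when \<open>k z\<close> is odd.\<close>
  define d where "d z = (k z + of_bool (z \<in> T)) div 2" for z
  have d: "2 * d z = k z + of_bool (z \<in> T)" if "z \<in> S" for z
    using that by (auto simp: d_def T_def)
  define R where "R = (\<Prod>z\<in>S. [:- z, 1:] ^ d z)"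
  have R: "R \<noteq> 0" using finite_S by (simp add: R_def)
  have o_R: "order z R = (if z \<in> S then d z else 0)" for z
    unfolding R_def by (rule order_prod_linear_power[OF finite_S])
  have "branch_divisor n y0 k p = ord_at f p M Q - ord_at f p R 0" if p: "p \<in> curve f" for p
  proof (cases p)
    case At_Infinity
    have "degree (mT * ?X ^ n) = card T + n"
      using m by (simp add: degree_mult_eq degree_power_eq mT_def degree_prod_sum_eq fin del: mult_pCons_right)
    moreover have "2 * degree R = n + card T"
    proof -
      have "2 * degree R = (\<Sum>z\<in>S. 2 * d z)"
        using finite_S
        by (simp add: R_def degree_prod_sum_eq degree_power_eq sum_distrib_left)
      also have "\<dots> = (\<Sum>z\<in>S. k z + of_bool (z \<in> T))" using d by simp
      also have "\<dots> = n + (\<Sum>z\<in>S. of_bool (z \<in> T))" by (simp add: sum.distrib sum_k)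
      also have "(\<Sum>z\<in>S. of_bool (z \<in> T)) = card (S \<inter> T)" using finite_S by simp
      also have "S \<inter> T = T" by (auto simp: T_def)
      finally show ?thesis .
    qed
    ultimately show ?thesis
      using degree_curve_norm[OF MQ] unfolding N At_Infinity
      by (simp add: ord_at_def branch_divisor_def pole_order_infinity_def del: mult_pCons_right)
  next
    case (Affine x y)
    then have y: "y\<^sup>2 = poly f x" using p by (simp add: curve_def)
    have on: "order x (mT * ?X ^ n) = of_bool (x \<in> T) + (if x = 0 then n else 0)"
      using m o_mT[of x] order_X_power[of x n] by (simp add: order_mult del: mult_pCons_right)
    have T_S: "x \<in> T \<Longrightarrow> x \<in> S" by (simp add: T_def)
    show ?thesis
    proof (cases "x \<in> S")
      case True
      then have "y = 0" using y poly_f_eq_0_iff[of x] by simp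
      have x0: "x \<noteq> 0" using S0 True by auto
      have "ord x y M Q = of_bool (x \<in> T)"
        using ord_branch[OF MQ True] on x0 \<open>y = 0\<close> by (simp add: N del: mult_pCons_right)
      moreover have "ord x y R 0 = k x + of_bool (x \<in> T)"
        using ord_const[OF R y] \<open>y = 0\<close> o_R[of x] True d[OF True] by simp
      ultimately show ?thesis using True by (simp add: Affine ord_at_def branch_divisor_def)
    next
      case False
      then have "y \<noteq> 0" using y poly_f_eq_0_iff[of x] by auto
      have r0: "ord x y R 0 = 0"
        using ord_const[OF R y] o_R[of x] False by simp
      have sum: "ord x y M Q + ord x (- y) M Q = (if x = 0 then n else 0)"
        using ord_sum_unbranched[OF MQ False y] on False T_S by (auto simp: N simp del: mult_pCons_right)
      show ?thesis
      proof (cases "x = 0")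
        case x0: True
        have "poly (mT * P) 0 \<noteq> 0" using mTP by simp
        then have "poly M 0 + (- y0) * poly Q 0 \<noteq> 0" using Q(2) by (auto simp: M_def)
        then have z: "ord 0 (- y0) M Q = 0" using y0 by (intro ord_eq_0) auto
        have "y = y0 \<or> y = - y0" using y y0 x0 power2_eq_iff[of y y0] by metis
        then show ?thesis
        proof
          assume "y = y0"
          then show ?thesis using sum z r0 False x0
            by (simp add: Affine ord_at_def branch_divisor_def)
        next
          assume "y = - y0"
          then show ?thesis using z r0 False x0 \<open>y \<noteq> 0\<close>
            by (auto simp: Affine ord_at_def branch_divisor_def)
        qed
      next
        case False
        then show ?thesis using sum r0 \<open>x \<notin> S\<close> by (simp add: Affine ord_at_def branch_divisor_def)
      qed
    qed
  qed
  then show ?thesis using MQ R by blast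
qed

end

section \<open>The transfer matrices of the billiard\<close>

text \<open>One axiomatization serves the real orbit, where signs matter, and its complexification,
  to which the curve belongs. \<open>(x k, y k)\<close> are the vertices, \<open>(u k, w k)\<close>
  the directions normalized by \<open>unit\<close>, \<open>t k\<close> the parameter along the
  chord, and \<open>s k\<close> the multiple of the Minkowski normal added by the reflection.
  \<open>pairing\<close> is Joachimsthal's integral.\<close>

locale billiard_orbit =
  fixes a b g e v0 :: "'a::field_char_0" and x y u w t s :: "nat \<Rightarrow> 'a"
  assumes nz: "a \<noteq> 0" "b \<noteq> 0" "a + b \<noteq> 0" "g \<noteq> 0" "g \<noteq> a" "g \<noteq> - b" "v0 \<noteq> 0"
    and e: "e * e = 1"
    and on_ellipse: "b * (x k)\<^sup>2 + a * (y k)\<^sup>2 = a * b"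
    and pairing: "b * x k * u k + a * y k * w k = v0"
    and speed_nz: "b * (u k)\<^sup>2 + a * (w k)\<^sup>2 \<noteq> 0"
    and unit: "(u k)\<^sup>2 - (w k)\<^sup>2 = - e"
    and tangent: "(u k)\<^sup>2 * (b + g) + (w k)\<^sup>2 * (a - g) = (x k * w k - y k * u k)\<^sup>2"
    and t_nz: "t k \<noteq> 0"
    and move: "x (Suc k) = x k + t k * u k" "y (Suc k) = y k + t k * w k"
    and reflect: "u (Suc k) = u k + s k * x (Suc k) / a" "w (Suc k) = w k - s k * y (Suc k) / b"
begin

definition f :: "'a poly" where "f = smult e ([:a, -1:] * [:b, 1:] * [:g, -1:])"

definition U :: "nat \<Rightarrow> 'a poly" where
  "U k = [:b * (u k)\<^sup>2 + a * (w k)\<^sup>2, (u k)\<^sup>2 - (w k)\<^sup>2:]"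

definition V :: "nat \<Rightarrow> 'a poly" where
  "V k = [:v0, x k * u k - y k * w k:]"

text \<open>The vertex lies on the ellipse, the conic with parameter \<open>0\<close>, so
  \<open>W\<close> is divisible by \<open>X\<close>; this is the quotient.\<close>

definition W' :: "nat \<Rightarrow> 'a poly" where
  "W' k = [:a - b - (x k)\<^sup>2 + (y k)\<^sup>2, -1:]"

abbreviation X :: "'a poly" where "X \<equiv> [:0, 1:]"

abbreviation W :: "nat \<Rightarrow> 'a poly" where "W k \<equiv> X * W' k"

lemma t_eq: "t k * (b * (u k)\<^sup>2 + a * (w k)\<^sup>2) = - 2 * v0"
proof -
  have "t k * (t k * (b * (u k)\<^sup>2 + a * (w k)\<^sup>2) + 2 * v0) = 0"
    using on_ellipse[of "Suc k"] on_ellipse[of k] pairing[of k] unfolding move by algebra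
  then have "t k * (b * (u k)\<^sup>2 + a * (w k)\<^sup>2) + 2 * v0 = 0" using t_nz by simp
  then show ?thesis by algebra
qed

lemma pairing_end: "b * x (Suc k) * u k + a * y (Suc k) * w k = - v0"
  using t_eq[of k] pairing[of k] unfolding move by algebra

lemma reflect': "a * u (Suc k) = a * u k + s k * x (Suc k)" "b * w (Suc k) = b * w k - s k * y (Suc k)"
  using nz by (simp_all add: reflect field_simps)

text \<open>A chord turns the pairing \<open>v0\<close> into \<open>- v0\<close>, and
  \<open>s k\<close> is determined by the requirement that the reflection restores
  \<open>v0\<close>.\<close>

lemma s_eq: "s k * ((b * x (Suc k))\<^sup>2 - (a * y (Suc k))\<^sup>2) = 2 * v0 * a * b"
proof -
  have "a * b * v0 = b * b * x (Suc k) * (a * u (Suc k)) + a * a * y (Suc k) * (b * w (Suc k))"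
    unfolding pairing[of "Suc k", symmetric] by algebra
  also have "\<dots> = a * b * (b * x (Suc k) * u k + a * y (Suc k) * w k)
      + s k * ((b * x (Suc k))\<^sup>2 - (a * y (Suc k))\<^sup>2)"
    unfolding reflect' by algebra
  finally show ?thesis unfolding pairing_end by algebra
qed

lemma s_eq': "s k * (a - b - (x (Suc k))\<^sup>2 + (y (Suc k))\<^sup>2) = - 2 * v0"
proof -
  have "a * b * (s k * (a - b - (x (Suc k))\<^sup>2 + (y (Suc k))\<^sup>2) + 2 * v0) = 0"
    using s_eq[of k] on_ellipse[of "Suc k"] by algebra
  then have "s k * (a - b - (x (Suc k))\<^sup>2 + (y (Suc k))\<^sup>2) + 2 * v0 = 0" using nz by simp
  then show ?thesis by algebra
qed

text \<open>Lagrange's identity for the form \<open>b x^2 + a y^2\<close>, with the determinant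
  \<open>x w - y u\<close> eliminated by \<open>tangent\<close>.\<close>

lemma v0_square: "v0\<^sup>2 = e * a * b * g"
proof -
  have "v0\<^sup>2 = (b * (u 0)\<^sup>2 + a * (w 0)\<^sup>2) * (b * (x 0)\<^sup>2 + a * (y 0)\<^sup>2)
      - a * b * (x 0 * w 0 - y 0 * u 0)\<^sup>2"
    unfolding pairing[of 0, symmetric] by algebra
  also have "\<dots> = - (a * b * g) * ((u 0)\<^sup>2 - (w 0)\<^sup>2)"
    unfolding on_ellipse tangent[symmetric] by algebra
  finally show ?thesis unfolding unit by algebra
qed

text \<open>Coefficientwise: \<open>v0_square\<close> is the constant term, \<open>unit\<close> the
  leading one, and the facts \<open>1\<close> and \<open>2\<close> are the two in between.\<close>

lemma det_L: "(V k)\<^sup>2 + U k * W k = f"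
proof -
  have 1: "2 * v0 * (x k * u k - y k * w k)
      + (b * (u k)\<^sup>2 + a * (w k)\<^sup>2) * (a - b - (x k)\<^sup>2 + (y k)\<^sup>2) = e * ((a - b) * g - a * b)"
  proof -
    have "2 * v0 * (x k * u k - y k * w k)
        + (b * (u k)\<^sup>2 + a * (w k)\<^sup>2) * (a - b - (x k)\<^sup>2 + (y k)\<^sup>2)
      = ((u k)\<^sup>2 - (w k)\<^sup>2) * (b * (x k)\<^sup>2 + a * (y k)\<^sup>2)
        + (a - b) * (b * (u k)\<^sup>2 + a * (w k)\<^sup>2 - (x k * w k - y k * u k)\<^sup>2)"
      unfolding pairing[of k, symmetric] by algebra
    also have "\<dots> = ((u k)\<^sup>2 - (w k)\<^sup>2) * (a * b - (a - b) * g)"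
      unfolding on_ellipse tangent[symmetric] by algebra
    finally show ?thesis unfolding unit by algebra
  qed
  have 2: "(x k * u k - y k * w k)\<^sup>2 + ((u k)\<^sup>2 - (w k)\<^sup>2) * (a - b - (x k)\<^sup>2 + (y k)\<^sup>2)
      - (b * (u k)\<^sup>2 + a * (w k)\<^sup>2) = e * (b - a - g)"
  proof -
    have "(x k * u k - y k * w k)\<^sup>2 + ((u k)\<^sup>2 - (w k)\<^sup>2) * (a - b - (x k)\<^sup>2 + (y k)\<^sup>2)
        - (b * (u k)\<^sup>2 + a * (w k)\<^sup>2)
      = (x k * w k - y k * u k)\<^sup>2 + ((u k)\<^sup>2 - (w k)\<^sup>2) * (a - b) - (b * (u k)\<^sup>2 + a * (w k)\<^sup>2)"
      by algebra
    also have "\<dots> = ((u k)\<^sup>2 - (w k)\<^sup>2) * (a - b + g)"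
      unfolding tangent[symmetric] by algebra
    finally show ?thesis unfolding unit by algebra
  qed
  show ?thesis
    using 1 2 unit[of k] v0_square
    by (simp add: U_def V_def W'_def f_def power2_eq_square algebra_simps)
qed

text \<open>Moving the base point along the chord adds \<open>t k\<close> times \<open>U\<close>.
  Pairing the new vertex with the normal \<open>(x / a, - y / b)\<close> in the form behind
  \<open>V\<close> gives \<open>- W'\<close> on the ellipse, which is the contribution of the
  reflection.\<close>

lemma V_Suc: "V (Suc k) = V k + [:t k:] * U k - [:s k:] * W' (Suc k)"
proof -
  have 0: "v0 = v0 + t k * (b * (u k)\<^sup>2 + a * (w k)\<^sup>2) - s k * (a - b - (x (Suc k))\<^sup>2 + (y (Suc k))\<^sup>2)"
    using s_eq'[of k] t_eq[of k] by simp
  have 1: "x (Suc k) * u (Suc k) - y (Suc k) * w (Suc k)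
      = x k * u k - y k * w k + t k * ((u k)\<^sup>2 - (w k)\<^sup>2) + s k"
  proof -
    have "a * b * (x (Suc k) * u (Suc k) - y (Suc k) * w (Suc k))
      = a * b * (x (Suc k) * u k - y (Suc k) * w k + s k)"
      using reflect'[of k] on_ellipse[of "Suc k"] by algebra
    then have "x (Suc k) * u (Suc k) - y (Suc k) * w (Suc k)
      = x (Suc k) * u k - y (Suc k) * w k + s k" using nz by simp
    then show ?thesis unfolding move by algebra
  qed
  show ?thesis using 0 1 by (simp add: V_def U_def W'_def algebra_simps)
qed

lemma W_Suc: "W (Suc k) = W k - 2 * [:t k:] * V k - [:t k:]\<^sup>2 * U k"
proof -
  have 0: "0 = - (2 * t k * v0) - (t k)\<^sup>2 * (b * (u k)\<^sup>2 + a * (w k)\<^sup>2)"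
    using t_eq[of k] by algebra
  have 1: "a - b - (x (Suc k))\<^sup>2 + (y (Suc k))\<^sup>2 = a - b - (x k)\<^sup>2 + (y k)\<^sup>2
      - 2 * t k * (x k * u k - y k * w k) - (t k)\<^sup>2 * ((u k)\<^sup>2 - (w k)\<^sup>2)"
    unfolding move by algebra
  have "W (Suc k) = [:0, a - b - (x (Suc k))\<^sup>2 + (y (Suc k))\<^sup>2, - 1:]" by (simp add: W'_def)
  also have "\<dots> = [:- (2 * t k * v0) - (t k)\<^sup>2 * (b * (u k)\<^sup>2 + a * (w k)\<^sup>2),
      a - b - (x (Suc k))\<^sup>2 + (y (Suc k))\<^sup>2, - 1:]"
    unfolding 0[symmetric] ..
  also have "\<dots> = W k - 2 * [:t k:] * V k - [:t k:]\<^sup>2 * U k"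
    unfolding 1 by (simp add: V_def U_def W'_def power2_eq_square algebra_simps numeral_poly)
  finally show ?thesis .
qed

text \<open>The factor \<open>X\<close> clears the denominator of the reflection terms; the constant
  term on the right vanishes by \<open>t_eq\<close> and \<open>s_eq'\<close>.\<close>

lemma U_Suc:
  "X * U (Suc k) = X * U k + 2 * [:s k:] * (V k + [:t k:] * U k) - [:s k:]\<^sup>2 * W' (Suc k)"
proof -
  have 0: "2 * s k * (v0 + t k * (b * (u k)\<^sup>2 + a * (w k)\<^sup>2))
      - (s k)\<^sup>2 * (a - b - (x (Suc k))\<^sup>2 + (y (Suc k))\<^sup>2) = 0"
    using s_eq'[of k] t_eq[of k] by algebra
  have 1: "b * (u (Suc k))\<^sup>2 + a * (w (Suc k))\<^sup>2 = b * (u k)\<^sup>2 + a * (w k)\<^sup>2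
      + 2 * s k * (x k * u k - y k * w k + t k * ((u k)\<^sup>2 - (w k)\<^sup>2)) + (s k)\<^sup>2"
  proof -
    have "(a * b)\<^sup>2 * (b * (u (Suc k))\<^sup>2 + a * (w (Suc k))\<^sup>2)
      = b ^ 3 * (a * u (Suc k))\<^sup>2 + a ^ 3 * (b * w (Suc k))\<^sup>2"
      by algebra
    also have "\<dots> = (a * b)\<^sup>2 * (b * (u k)\<^sup>2 + a * (w k)\<^sup>2
          + 2 * s k * (x (Suc k) * u k - y (Suc k) * w k))
        + 2 * s k * (a * b * (b - a)) * (b * x (Suc k) * u k + a * y (Suc k) * w k)
        + s k * (b - a) * (s k * ((b * x (Suc k))\<^sup>2 - (a * y (Suc k))\<^sup>2))
        + (s k)\<^sup>2 * (a * b) * (b * (x (Suc k))\<^sup>2 + a * (y (Suc k))\<^sup>2)"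
      unfolding reflect' by algebra
    also have "\<dots> = (a * b)\<^sup>2 * (b * (u k)\<^sup>2 + a * (w k)\<^sup>2
      + 2 * s k * (x (Suc k) * u k - y (Suc k) * w k) + (s k)\<^sup>2)"
      unfolding pairing_end s_eq on_ellipse by algebra
    finally have "b * (u (Suc k))\<^sup>2 + a * (w (Suc k))\<^sup>2 = b * (u k)\<^sup>2 + a * (w k)\<^sup>2
      + 2 * s k * (x (Suc k) * u k - y (Suc k) * w k) + (s k)\<^sup>2" using nz by simp
    then show ?thesis unfolding move by algebra
  qed
  have 2: "(u (Suc k))\<^sup>2 - (w (Suc k))\<^sup>2 = (u k)\<^sup>2 - (w k)\<^sup>2" by (simp add: unit)
  have "X * U (Suc k) = [:0, b * (u (Suc k))\<^sup>2 + a * (w (Suc k))\<^sup>2, (u (Suc k))\<^sup>2 - (w (Suc k))\<^sup>2:]"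
    by (simp add: U_def)
  also have "\<dots> = X * U k + 2 * [:s k:] * (V k + [:t k:] * U k) - [:s k:]\<^sup>2 * W' (Suc k)"
    unfolding 1 2 using 0
    by (simp add: V_def U_def W'_def power2_eq_square algebra_simps numeral_poly)
  finally show ?thesis .
qed

end

text \<open>Up to the scalar \<open>B(0)\<close>, \<open>B\<close> is \<open>1 - E\<close> with
  \<open>E\<close> divisible by \<open>X\<close>; the inverse is a truncated geometric
  series.\<close>

lemma inverse_mod_X_power:
  fixes B :: "'a::field poly"
  assumes "poly B 0 \<noteq> 0"
  shows "\<exists>C. [:0, 1:] ^ m dvd 1 - B * C"
proof -
  define E where "E = 1 - smult (1 / poly B 0) B"
  have "poly E 0 = 0" using assms by (simp add: E_def)
  then have "[:0, 1:] dvd E" using poly_eq_0_iff_dvd[of E 0] by simp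
  then have "[:0, 1:] ^ m dvd E ^ m" by (rule dvd_power_same)
  moreover have "E ^ m = 1 - B * smult (1 / poly B 0) (\<Sum>i<m. E ^ i)"
    using one_diff_power_eq[of E m] by (simp add: E_def algebra_simps)
  ultimately show ?thesis by metis
qed

lemma X_dvd_iff: "[:0, 1:] dvd p \<longleftrightarrow> poly p 0 = 0"
  for p :: "'a::field poly"
  using poly_eq_0_iff_dvd[of p 0] by simp

text \<open>The hypotheses say that the matrix \<open>L\<close> with rows \<open>(V, - U)\<close>
  and \<open>(- W, - V)\<close> kills \<open>(u, x)\<close>, so \<open>A + B L\<close> acts on this
  vector as the scalar \<open>A\<close>.\<close>

lemma kernel_vector:
  fixes A B U V W u x :: "'a::comm_ring"
  assumes "V * u = U * x" "W * u = - V * x"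
  shows "(A + B * V) * u + - (B * U) * x = A * u"
    and "- (B * W) * u + (A - B * V) * x = A * x"
proof -
  have "(A + B * V) * u + - (B * U) * x = A * u + B * (V * u - U * x)"
    by (simp add: algebra_simps)
  then show "(A + B * V) * u + - (B * U) * x = A * u" using assms(1) by simp
  have "- (B * W) * u + (A - B * V) * x = A * x - B * (W * u + V * x)"
    by (simp add: algebra_simps)
  then show "- (B * W) * u + (A - B * V) * x = A * x" using assms(2) by simp
qed

lemma cramer_2:
  fixes \<alpha> \<beta> \<gamma> \<delta> p q :: "'a::comm_ring_1"
  assumes "p * \<alpha> + q * \<beta> = r" "p * \<gamma> + q * \<delta> = r'" "\<alpha> * \<delta> - \<beta> * \<gamma> = M"
  shows "M * p = r * \<delta> - r' * \<beta>" "M * q = r' * \<alpha> - r * \<gamma>"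
  unfolding assms[symmetric] by (simp_all add: algebra_simps)

section \<open>Products of bounce matrices and their relation to \<open>L\<close>\<close>

context billiard_orbit
begin

definition L :: "nat \<Rightarrow> 'a poly \<times> 'a poly \<Rightarrow> 'a poly \<times> 'a poly" where
  "L k = (\<lambda>(p, q). (V k * p - U k * q, - (W k * p) - V k * q))"

text \<open>At \<open>X = a\<close> this is \<open>a\<close> times the map from
  \<open>(u k, x k)\<close> to the next such pair, at \<open>X = - b\<close> it is
  \<open>- b\<close> times the map for \<open>(w k, y k)\<close>. The determinant is
  \<open>X^2\<close>.\<close>

definition bounce :: "nat \<Rightarrow> 'a poly \<times> 'a poly \<Rightarrow> 'a poly \<times> 'a poly" where
  "bounce k = (\<lambda>(p, q). (X * p + [:s k:] * (q + [:t k:] * p), X * (q + [:t k:] * p)))"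

primrec transfer :: "nat \<Rightarrow> 'a poly \<times> 'a poly \<Rightarrow> 'a poly \<times> 'a poly" where
  "transfer 0 z = z"
| "transfer (Suc k) z = bounce k (transfer k z)"

definition "m11 k = fst (transfer k (1, 0))"
definition "m21 k = snd (transfer k (1, 0))"
definition "m12 k = fst (transfer k (0, 1))"
definition "m22 k = snd (transfer k (0, 1))"

lemma m_0: "m11 0 = 1" "m21 0 = 0" "m12 0 = 0" "m22 0 = 1"
  by (simp_all add: m11_def m21_def m12_def m22_def)

lemma m_Suc:
  "m11 (Suc k) = X * m11 k + [:s k:] * (m21 k + [:t k:] * m11 k)"
  "m21 (Suc k) = X * (m21 k + [:t k:] * m11 k)"
  "m12 (Suc k) = X * m12 k + [:s k:] * (m22 k + [:t k:] * m12 k)"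
  "m22 (Suc k) = X * (m22 k + [:t k:] * m12 k)"
  by (simp_all add: m11_def m21_def m12_def m22_def bounce_def case_prod_beta)

lemma transfer_eq: "transfer k (p, q) = (m11 k * p + m12 k * q, m21 k * p + m22 k * q)"
proof (induction k)
  case (Suc k)
  show ?case
    unfolding transfer.simps Suc m_Suc bounce_def prod.case prod.inject by (intro conjI; algebra)
qed (simp add: m_0)

text \<open>The Lax equation of the billiard; compared entry by entry it reduces to
  \<open>V_Suc\<close>, \<open>W_Suc\<close> and \<open>U_Suc\<close>.\<close>

lemma L_bounce: "bounce k (L k z) = L (Suc k) (bounce k z)"
proof -
  obtain p q where z: "z = (p, q)" by (cases z)
  show ?thesis
    using V_Suc[of k] W_Suc[of k] U_Suc[of k]
    unfolding z L_def bounce_def prod.case prod.inject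
    by (intro conjI; algebra)
qed

lemma L_transfer: "transfer k (L 0 z) = L k (transfer k z)"
  by (induction k) (simp_all add: L_bounce)

lemma det_transfer: "m11 k * m22 k - m12 k * m21 k = X ^ (2 * k)"
proof (induction k)
  case (Suc k)
  have "m11 (Suc k) * m22 (Suc k) - m12 (Suc k) * m21 (Suc k)
      = X * X * (m11 k * m22 k - m12 k * m21 k)"
    unfolding m_Suc by algebra
  then show ?case unfolding Suc by (simp del: mult_pCons_left)
qed (simp add: m_0)

lemma degree_bound:
  assumes "degree p \<le> k" shows "degree (X * p) \<le> Suc k" "degree ([:c:] * p) \<le> k"
    "coeff (X * p) (Suc k) = coeff p k" "coeff ([:c:] * p) (Suc k) = 0"
  using assms by (auto simp: degree_pCons_le intro: order.trans[OF degree_smult_le] coeff_eq_0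
      order.trans[OF degree_pCons_le])

text \<open>The coefficient of \<open>X\<close> in a bounce matrix is lower triangular with ones on
  the diagonal, and this persists for products. The top coefficient of \<open>m21\<close> may be
  nonzero.\<close>

lemma m_degree:
  "degree (m11 k) \<le> k \<and> degree (m21 k) \<le> k \<and> degree (m12 k) \<le> k \<and> degree (m22 k) \<le> k
    \<and> coeff (m11 k) k = 1 \<and> coeff (m12 k) k = 0 \<and> coeff (m22 k) k = 1"
proof (induction k)
  case (Suc k)
  define q1 where "q1 = m21 k + [:t k:] * m11 k"
  define q2 where "q2 = m22 k + [:t k:] * m12 k"
  have q: "degree q1 \<le> k" "degree q2 \<le> k" "coeff q2 k = 1"
    using Suc degree_bound(2)[of "m11 k" k "t k"] degree_bound(2)[of "m12 k" k "t k"]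
    by (auto simp: q1_def q2_def intro!: degree_add_le)
  have "degree (X * m11 k + [:s k:] * q1) \<le> Suc k"
    using Suc q degree_bound(1)[of "m11 k" k] degree_bound(2)[of q1 k "s k"]
    by (intro degree_add_le) auto
  moreover have "degree (X * m12 k + [:s k:] * q2) \<le> Suc k"
    using Suc q degree_bound(1)[of "m12 k" k] degree_bound(2)[of q2 k "s k"]
    by (intro degree_add_le) auto
  ultimately show ?case
    using Suc q degree_bound(1,3)[of q1 k] degree_bound(1,3)[of q2 k]
      degree_bound(3)[of "m11 k" k] degree_bound(3)[of "m12 k" k]
      degree_bound(4)[of q1 k "s k"] degree_bound(4)[of q2 k "s k"]
    unfolding m_Suc q1_def[symmetric] q2_def[symmetric] coeff_add by simp
qed (simp add: m_0)

lemma s_nz: "s k \<noteq> 0"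
  using s_eq[of k] nz by auto

lemma m_at_0: "poly (m11 k) 0 \<noteq> 0" "poly (m21 k) 0 = 0" "k \<ge> 1 \<Longrightarrow> poly (m22 k) 0 = 0"
proof -
  have "poly (m11 k) 0 \<noteq> 0 \<and> poly (m21 k) 0 = 0"
    by (induction k) (use s_nz t_nz in \<open>auto simp: m_0 m_Suc\<close>)
  then show "poly (m11 k) 0 \<noteq> 0" "poly (m21 k) 0 = 0" by auto
  show "poly (m22 k) 0 = 0" if "k \<ge> 1"
    using that by (cases k) (auto simp: m_Suc)
qed

lemma transfer_at_a:
  "poly (m11 k) a * u 0 + poly (m12 k) a * x 0 = a ^ k * u k"
  "poly (m21 k) a * u 0 + poly (m22 k) a * x 0 = a ^ k * x k"
proof (induction k)
  case (Suc k)
  case 1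
  have "poly (m11 (Suc k)) a * u 0 + poly (m12 (Suc k)) a * x 0
     = a * (a ^ k * u k) + s k * (a ^ k * x k + t k * (a ^ k * u k))"
    unfolding Suc[symmetric] by (simp add: m_Suc algebra_simps)
  also have "\<dots> = a ^ k * (a * u k + s k * x (Suc k))" by (simp add: move algebra_simps)
  finally show ?case by (simp add: reflect'[symmetric])
  case 2
  have "poly (m21 (Suc k)) a * u 0 + poly (m22 (Suc k)) a * x 0
     = a * (a ^ k * x k + t k * (a ^ k * u k))"
    unfolding Suc[symmetric] by (simp add: m_Suc algebra_simps)
  then show ?case by (simp add: move algebra_simps)
qed (simp_all add: m_0)

lemma transfer_at_b:
  "poly (m11 k) (- b) * w 0 + poly (m12 k) (- b) * y 0 = (- b) ^ k * w k"
  "poly (m21 k) (- b) * w 0 + poly (m22 k) (- b) * y 0 = (- b) ^ k * y k"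
proof (induction k)
  case (Suc k)
  case 1
  have "poly (m11 (Suc k)) (- b) * w 0 + poly (m12 (Suc k)) (- b) * y 0
     = - b * ((- b) ^ k * w k) + s k * ((- b) ^ k * y k + t k * ((- b) ^ k * w k))"
    unfolding Suc[symmetric] by (simp add: m_Suc algebra_simps)
  also have "\<dots> = (- b) ^ k * - (b * w k - s k * y (Suc k))" by (simp add: move algebra_simps)
  finally show ?case by (simp add: reflect'[symmetric])
  case 2
  have "poly (m21 (Suc k)) (- b) * w 0 + poly (m22 (Suc k)) (- b) * y 0
     = - b * ((- b) ^ k * y k + t k * ((- b) ^ k * w k))"
    unfolding Suc[symmetric] by (simp add: m_Suc algebra_simps)
  then show ?case by (simp add: move algebra_simps)
qed (simp_all add: m_0)

text \<open>At \<open>X = a\<close> only the first coordinates survive: \<open>L\<close> is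
  \<open>a + b\<close> times the matrix with rows \<open>(x u, - u^2)\<close> and
  \<open>(x^2, - x u)\<close>.\<close>

lemma L_kernel_at_a:
  "poly (V k) a * u k = poly (U k) a * x k" "poly (W k) a * u k = - poly (V k) a * x k"
proof -
  have V: "poly (V k) a = (a + b) * x k * u k"
    using pairing[of k] by (simp add: V_def algebra_simps)
  have U: "poly (U k) a = (a + b) * (u k)\<^sup>2" by (simp add: U_def algebra_simps)
  have W: "poly (W k) a = - ((a + b) * (x k)\<^sup>2)"
    using on_ellipse[of k] by (simp add: W'_def) algebra
  show "poly (V k) a * u k = poly (U k) a * x k" unfolding V U by (simp add: power2_eq_square)
  show "poly (W k) a * u k = - poly (V k) a * x k" unfolding V W by (simp add: power2_eq_square)
qed

lemma L_kernel_at_b: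
  "poly (V k) (- b) * w k = poly (U k) (- b) * y k" "poly (W k) (- b) * w k = - poly (V k) (- b) * y k"
proof -
  have V: "poly (V k) (- b) = (a + b) * y k * w k"
    using pairing[of k] by (simp add: V_def algebra_simps)
  have U: "poly (U k) (- b) = (a + b) * (w k)\<^sup>2" by (simp add: U_def algebra_simps)
  have W: "poly (W k) (- b) = - ((a + b) * (y k)\<^sup>2)"
    using on_ellipse[of k] by (simp add: W'_def) algebra
  show "poly (V k) (- b) * w k = poly (U k) (- b) * y k" unfolding V U by (simp add: power2_eq_square)
  show "poly (W k) (- b) * w k = - poly (V k) (- b) * y k" unfolding V W by (simp add: power2_eq_square)
qed

lemma state_nz: "u k \<noteq> 0 \<or> x k \<noteq> 0" "w k \<noteq> 0 \<or> y k \<noteq> 0"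
  using tangent[of k] speed_nz[of k] nz by (auto simp: add_eq_0_iff)

lemma pderiv_f_nz:
  assumes "poly f z = 0"
  shows "poly (pderiv f) z \<noteq> 0"
proof -
  have e0: "e \<noteq> 0" using e by auto
  have "poly f z = e * ((a - z) * (b + z) * (g - z))" by (simp add: f_def algebra_simps)
  then have "z = a \<or> z = - b \<or> z = g"
    using assms e0 by (auto simp: eq_neg_iff_add_eq_0 add.commute)
  moreover have "poly (pderiv f) z
      = e * (- ((b + z) * (g - z)) + (a - z) * (g - z) - (a - z) * (b + z))"
    by (simp add: f_def pderiv_smult pderiv_mult pderiv_pCons algebra_simps)
  ultimately show ?thesis
    using e0 nz by (auto simp: add.commute eq_neg_iff_add_eq_0)
qed

text \<open>The entries of \<open>L\<close> do not change under the sign changes, so the product of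
  the bounces commutes with \<open>L 0\<close> and is a combination \<open>A + B L\<close> over the
  rational functions. The main point is that \<open>B\<close> is a polynomial.\<close>

lemma pell_if_periodic:
  assumes n: "n \<ge> 1" and sig: "\<sigma>\<^sub>1\<^sup>2 = 1" "\<sigma>\<^sub>2\<^sup>2 = 1"
    and per: "x n = \<sigma>\<^sub>1 * x 0" "u n = \<sigma>\<^sub>1 * u 0" "y n = \<sigma>\<^sub>2 * y 0" "w n = \<sigma>\<^sub>2 * w 0"
  shows "\<exists>A B. pell_solution f n A B \<and> poly A a = \<sigma>\<^sub>1 * a ^ n \<and> poly A (- b) = \<sigma>\<^sub>2 * (- b) ^ n"
proof -
  have sig': "\<sigma>\<^sub>1 * x 0 * (\<sigma>\<^sub>1 * u 0) = x 0 * u 0" "\<sigma>\<^sub>2 * y 0 * (\<sigma>\<^sub>2 * w 0) = y 0 * w 0"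
    using sig by algebra+
  have U: "U n = U 0" and V: "V n = V 0" and W: "W' n = W' 0"
    using sig by (simp_all add: U_def V_def W'_def per power_mult_distrib sig')
  have L: "L n = L 0" unfolding L_def U V W ..
  have c1: "m12 n * W 0 = U 0 * m21 n" "2 * V 0 * m21 n = W 0 * (m22 n - m11 n)"
    using L_transfer[of n "(1, 0)"] unfolding L unfolding L_def transfer_eq prod.case prod.inject
    by algebra+
  have c2: "U 0 * (m22 n - m11 n) = 2 * V 0 * m12 n"
    using L_transfer[of n "(0, 1)"] unfolding L unfolding L_def transfer_eq prod.case prod.inject
    by algebra
  have e0: "e \<noteq> 0" using e by auto
  define r where "r = (b * (u 0)\<^sup>2 + a * (w 0)\<^sup>2) / e"
  have U0: "U 0 = smult (- e) [:- r, 1:]"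
    using e0 unfolding U_def unit by (simp add: r_def)
  \<comment> \<open>Otherwise commutation makes \<open>V\<close> and \<open>W\<close> vanish at the
    zero \<open>r\<close> of \<open>U\<close>, and \<open>f = V^2 + U W\<close> has a double
    root.\<close>
  have "poly (m12 n) r = 0"
  proof (rule ccontr)
    assume m: "poly (m12 n) r \<noteq> 0"
    have Ur: "poly (U 0) r = 0" by (simp add: U0)
    have Vr: "poly (V 0) r = 0" using arg_cong[OF c2, of "\<lambda>p. poly p r"] m Ur by simp
    have Wr: "poly (W 0) r = 0" using arg_cong[OF c1(1), of "\<lambda>p. poly p r"] m Ur by simp
    have "poly f r = 0" unfolding det_L[of 0, symmetric] poly_add poly_mult poly_power Ur Vr by simp
    moreover have "poly (pderiv f) r = 0"
      unfolding det_L[of 0, symmetric] power2_eq_square pderiv_add pderiv_mult poly_add poly_mult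
      using Ur Vr Wr by simp
    ultimately show False using pderiv_f_nz by blast
  qed
  then obtain Z where Z: "m12 n = [:- r, 1:] * Z" by (metis dvdE poly_eq_0_iff_dvd)
  define B where "B = smult (1 / e) Z"
  have B12: "m12 n = - (B * U 0)" using e0 unfolding U0 Z B_def by simp
  have U0nz: "U 0 \<noteq> 0" using e0 by (simp add: U0)
  have "U 0 * m21 n = U 0 * - (B * W 0)" using c1(1) unfolding B12 by algebra
  then have B21: "m21 n = - (B * W 0)" using U0nz by (metis mult_left_cancel)
  have "U 0 * (m11 n - m22 n) = U 0 * (2 * B * V 0)" using c2 unfolding B12 by algebra
  then have B11: "m11 n - m22 n = 2 * B * V 0" using U0nz by (metis mult_left_cancel)
  \<comment> \<open>Half of the trace, since \<open>L\<close> has trace zero.\<close>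
  define A where "A = smult (1 / 2) (m11 n + m22 n)"
  have twoA: "2 * A = m11 n + m22 n"
    unfolding mult_2 A_def by (simp flip: smult_add_left)
  have A1: "m11 n = A + B * V 0" and A2: "m22 n = A - B * V 0"
  proof -
    have "2 * m11 n = 2 * (A + B * V 0)" using twoA B11 by algebra
    then show "m11 n = A + B * V 0" by (metis mult_left_cancel zero_neq_numeral)
    then show "m22 n = A - B * V 0" using B11 by algebra
  qed
  have "A\<^sup>2 - B\<^sup>2 * f = X ^ (2 * n)"
    unfolding det_transfer[symmetric] A1 A2 B12 B21 det_L[of 0, symmetric] by algebra
  moreover have "degree A \<le> n" "coeff A n = 1"
    using m_degree[of n] by (auto simp: A_def intro!: degree_add_le)
  moreover have "poly A 0 \<noteq> 0"
    using m_at_0(1)[of n] m_at_0(3)[OF n] by (simp add: A_def)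
  moreover have "poly A a = \<sigma>\<^sub>1 * a ^ n"
  proof -
    have "poly A a * u 0 = \<sigma>\<^sub>1 * a ^ n * u 0" "poly A a * x 0 = \<sigma>\<^sub>1 * a ^ n * x 0"
      using transfer_at_a[of n]
      unfolding A1 A2 B12 B21 per poly_add poly_diff poly_minus poly_mult[of B]
        kernel_vector[OF L_kernel_at_a[of 0]]
      by (simp_all add: mult_ac)
    then show ?thesis using state_nz(1)[of 0] by auto
  qed
  moreover have "poly A (- b) = \<sigma>\<^sub>2 * (- b) ^ n"
  proof -
    have "poly A (- b) * w 0 = \<sigma>\<^sub>2 * (- b) ^ n * w 0" "poly A (- b) * y 0 = \<sigma>\<^sub>2 * (- b) ^ n * y 0"
      using transfer_at_b[of n]
      unfolding A1 A2 B12 B21 per poly_add poly_diff poly_minus poly_mult[of B]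
        kernel_vector[OF L_kernel_at_b[of 0]]
      by (simp_all add: mult_ac)
    then show ?thesis using state_nz(2)[of 0] by auto
  qed
  ultimately show ?thesis unfolding pell_solution_def by blast
qed

section \<open>From a Pell solution back to a period\<close>

lemma f_at_0: "poly f 0 = v0\<^sup>2"
  unfolding v0_square by (simp add: f_def)

text \<open>By \<open>det_L\<close> the square of \<open>L\<close> is \<open>f\<close>, so
  \<open>L + \<eta>\<close> maps \<open>(L - \<eta>) (p, q)\<close> to
  \<open>(f - \<eta>^2) (p, q)\<close>; this is the first row.\<close>

lemma L_residue:
  assumes "L k (p, q) = (c * E\<^sub>1 + \<eta> * p, c * E\<^sub>2 + \<eta> * q)"
  shows "c * ((V k + \<eta>) * E\<^sub>1 - U k * E\<^sub>2) = (f - \<eta>\<^sup>2) * p"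
  using assms det_L[of k] unfolding L_def prod.case prod.inject by algebra

text \<open>
  The polynomial \<open>\<eta>\<close> approximates the square root of \<open>f\<close> that takes the value \<open>v0\<close> at \<open>0\<close>. Each
  bounce kills the eigenvector of \<open>L\<close> for the other square root to second order.
\<close>

lemma transfer_eigenvector:
  assumes \<eta>: "X ^ (2 * n) dvd f - \<eta>\<^sup>2" "poly \<eta> 0 = v0" and "k \<le> n"
  shows "\<exists>E\<^sub>1 E\<^sub>2. L k (transfer k z) = (X ^ (2 * k) * E\<^sub>1 + \<eta> * fst (transfer k z),
    X ^ (2 * k) * E\<^sub>2 + \<eta> * snd (transfer k z))"
  using \<open>k \<le> n\<close>
proof (induction k)
  case 0
  show ?case
    by (rule exI[of _ "fst (L 0 z) - \<eta> * fst z"], rule exI[of _ "snd (L 0 z) - \<eta> * snd z"])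
      (simp add: prod_eq_iff)
next
  case (Suc k)
  define M where "M = X ^ (2 * k)"
  obtain p q where pq: "transfer k z = (p, q)" by fastforce
  obtain E\<^sub>1 E\<^sub>2 where E: "L k (p, q) = (M * E\<^sub>1 + \<eta> * p, M * E\<^sub>2 + \<eta> * q)"
    using Suc pq unfolding M_def by fastforce
  have "M * X ^ (2 * n - 2 * k) = X ^ (2 * n)"
    using Suc.prems unfolding M_def by (simp flip: power_add del: mult_pCons_left)
  \<comment> \<open>By \<open>L_residue\<close> the first row of \<open>L + \<eta>\<close> kills the
    residue \<open>(E\<^sub>1, E\<^sub>2)\<close> at \<open>0\<close>. In view of
    \<open>t_eq\<close>, \<open>E\<^sub>2 + t k E\<^sub>1\<close> vanishes there, so the bounce
    produces a first factor \<open>X\<close>.\<close>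
  then have "M * X ^ (2 * n - 2 * k) dvd M * ((V k + \<eta>) * E\<^sub>1 - U k * E\<^sub>2)"
    unfolding L_residue[OF E] using \<eta>(1) by (metis dvd_mult2)
  then have "X ^ (2 * n - 2 * k) dvd (V k + \<eta>) * E\<^sub>1 - U k * E\<^sub>2"
    unfolding M_def by (subst (asm) dvd_times_left_cancel_iff) auto
  moreover have "X dvd X ^ (2 * n - 2 * k)" using Suc.prems by (intro dvd_power) auto
  ultimately have "poly ((V k + \<eta>) * E\<^sub>1 - U k * E\<^sub>2) 0 = 0"
    using X_dvd_iff dvd_trans by blast
  then have "2 * v0 * poly E\<^sub>1 0 = (b * (u k)\<^sup>2 + a * (w k)\<^sup>2) * poly E\<^sub>2 0"
    using \<eta>(2) by (simp add: V_def U_def)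
  then have "(b * (u k)\<^sup>2 + a * (w k)\<^sup>2) * (poly E\<^sub>2 0 + t k * poly E\<^sub>1 0) = 0"
    using t_eq[of k] by algebra
  then have "poly (E\<^sub>2 + [:t k:] * E\<^sub>1) 0 = 0" using speed_nz[of k] by simp
  then obtain r where r: "E\<^sub>2 + [:t k:] * E\<^sub>1 = X * r" using X_dvd_iff by (metis dvdE)
  define F where "F = E\<^sub>1 + [:s k:] * r"
  obtain p' q' where pq': "transfer (Suc k) z = (p', q')" by fastforce
  then have b: "p' = X * p + [:s k:] * (q + [:t k:] * p)" "q' = X * (q + [:t k:] * p)"
    unfolding transfer.simps pq bounce_def prod.case prod.inject by simp_all
  have F: "L (Suc k) (p', q') = (M * X * F + \<eta> * p', M * X * (X * r) + \<eta> * q')"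
    unfolding pq'[symmetric] transfer.simps pq L_bounce[symmetric] E
    unfolding bounce_def prod.case prod.inject F_def b using r by (intro conjI; algebra)
  \<comment> \<open>The same argument at the next vertex, where the second component of the residue
    already contains \<open>X\<close>, gives the second factor \<open>X\<close>.\<close>
  have "M * X * X ^ (2 * n - 2 * k - 1) = X ^ Suc (2 * k + (2 * n - 2 * k - 1))"
    unfolding M_def power_Suc power_add by algebra
  also have "Suc (2 * k + (2 * n - 2 * k - 1)) = 2 * n" using Suc.prems by simp
  finally have "M * X * X ^ (2 * n - 2 * k - 1) dvd M * X * ((V (Suc k) + \<eta>) * F - U (Suc k) * (X * r))"
    unfolding L_residue[OF F] using \<eta>(1) by (metis dvd_mult2)
  then have "X ^ (2 * n - 2 * k - 1) dvd (V (Suc k) + \<eta>) * F - U (Suc k) * (X * r)"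
    unfolding M_def by (subst (asm) dvd_times_left_cancel_iff) auto
  moreover have "X dvd X ^ (2 * n - 2 * k - 1)" using Suc.prems by (intro dvd_power) auto
  ultimately have "poly ((V (Suc k) + \<eta>) * F - U (Suc k) * (X * r)) 0 = 0"
    using X_dvd_iff dvd_trans by blast
  then have "poly F 0 = 0" using \<eta>(2) nz by (simp add: V_def)
  then obtain F' where F': "F = X * F'" using X_dvd_iff by (metis dvdE)
  have MXX: "X ^ (2 * Suc k) = M * X * X" unfolding M_def by (simp del: mult_pCons_left mult_pCons_right)
  have "L (Suc k) (p', q') = (X ^ (2 * Suc k) * F' + \<eta> * p', X ^ (2 * Suc k) * r + \<eta> * q')"
    unfolding F F' MXX by (simp only: mult.assoc)
  then show ?case unfolding pq' fst_conv snd_conv by blast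
qed

text \<open>Modulo \<open>X^(2n)\<close>, \<open>A / B\<close> is a square root
  \<open>\<eta>\<close> of \<open>f\<close>, so by \<open>transfer_eigenvector\<close> the product
  of the bounces times \<open>A - B L\<close> is divisible by \<open>X^(2n)\<close>. The degrees
  leave a constant cofactor, and multiplication by \<open>A + B L\<close> recovers the product.
  \<open>sgn\<close> selects the root with value \<open>v0\<close> at \<open>0\<close>.\<close>

lemma transfer_if_pell:
  assumes n: "n \<ge> 1" and pell: "pell_solution f n A B" and sgn: "poly A 0 = v0 * poly B 0"
  shows "m11 n = A + B * V 0" "m21 n = - (B * W 0)" "m12 n = - (B * U 0)" "m22 n = A - B * V 0"
proof -
  have P: "A\<^sup>2 - B\<^sup>2 * f = X ^ (2 * n)" "degree A \<le> n" "coeff A n = 1" "poly A 0 \<noteq> 0"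
    using pell by (auto simp: pell_solution_def)
  have B0: "poly B 0 \<noteq> 0" using sgn P(4) by auto
  obtain C where C: "X ^ (2 * n) dvd 1 - B * C" using inverse_mod_X_power[OF B0] by blast
  define \<eta> where "\<eta> = A * C"
  have "X ^ (2 * n) dvd A * (1 - B * C)" using C by simp
  moreover have "A * (1 - B * C) = A - B * \<eta>" unfolding \<eta>_def by algebra
  ultimately have \<eta>1: "X ^ (2 * n) dvd A - B * \<eta>" by simp
  have "f - \<eta>\<^sup>2 = f * (1 + B * C) * (1 - B * C) - C\<^sup>2 * X ^ (2 * n)"
    unfolding P(1)[symmetric] \<eta>_def by algebra
  then have \<eta>2: "X ^ (2 * n) dvd f - \<eta>\<^sup>2" using C by (metis dvd_diff dvd_mult dvd_triv_right)
  have "poly (A - B * \<eta>) 0 = 0"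
    using \<eta>1 n by (metis X_dvd_iff dvd_power dvd_trans mult_pos_pos zero_less_numeral less_le_trans zero_less_one)
  then have \<eta>3: "poly \<eta> 0 = v0" using sgn B0 by simp
  have *: "\<exists>c\<^sub>1 c\<^sub>2. transfer n ((A - B * V 0) * p + B * U 0 * q, B * W 0 * p + (A + B * V 0) * q)
      = (X ^ (2 * n) * c\<^sub>1, X ^ (2 * n) * c\<^sub>2)" for p q
  proof -
    obtain E\<^sub>1 E\<^sub>2 where E: "L n (transfer n (p, q)) = (X ^ (2 * n) * E\<^sub>1 + \<eta> * fst (transfer n (p, q)),
        X ^ (2 * n) * E\<^sub>2 + \<eta> * snd (transfer n (p, q)))"
      using transfer_eigenvector[OF \<eta>2 \<eta>3 order_refl] by blast
    obtain D where D: "A = B * \<eta> + X ^ (2 * n) * D" using \<eta>1 by (metis dvdE diff_eq_eq add.commute)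
    have 1: "m11 n * (V 0 * p - U 0 * q) + m12 n * (- (W 0 * p) - V 0 * q)
        = X ^ (2 * n) * E\<^sub>1 + \<eta> * (m11 n * p + m12 n * q)"
      "m21 n * (V 0 * p - U 0 * q) + m22 n * (- (W 0 * p) - V 0 * q)
        = X ^ (2 * n) * E\<^sub>2 + \<eta> * (m21 n * p + m22 n * q)"
      using E unfolding L_transfer[symmetric] unfolding L_def prod.case transfer_eq prod.inject fst_conv snd_conv
      by auto
    define M where "M = X ^ (2 * n)"
    have "m11 n * ((A - B * V 0) * p + B * U 0 * q) + m12 n * (B * W 0 * p + (A + B * V 0) * q)
      = M * (D * (m11 n * p + m12 n * q) - B * E\<^sub>1)"
      using 1(1) D unfolding M_def[symmetric] by algebra
    moreover have "m21 n * ((A - B * V 0) * p + B * U 0 * q) + m22 n * (B * W 0 * p + (A + B * V 0) * q)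
      = M * (D * (m21 n * p + m22 n * q) - B * E\<^sub>2)"
      using 1(2) D unfolding M_def[symmetric] by algebra
    ultimately show ?thesis unfolding transfer_eq M_def by blast
  qed
  \<comment> \<open>The leading terms of \<open>A^2\<close> and \<open>X^(2n)\<close> cancel, so
    \<open>B^2 f\<close>, which has odd degree for nonzero \<open>B\<close>, has degree below
    \<open>2n\<close>.\<close>
  have degB: "B = 0 \<or> degree B + 2 \<le> n"
  proof (cases "B = 0")
    case False
    have e0: "e \<noteq> 0" using e by auto
    have "degree f = 3" using e0 by (simp add: f_def)
    then have "f \<noteq> 0" by auto
    then have dB: "degree (B\<^sup>2 * f) = 2 * degree B + 3"
      using False \<open>degree f = 3\<close> by (simp add: degree_mult_eq degree_power_eq)
    have eq: "B\<^sup>2 * f = A\<^sup>2 - X ^ (2 * n)" unfolding P(1)[symmetric] by simp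
    have "degree (A\<^sup>2) \<le> 2 * n"
      using P(2) by (simp add: power2_eq_square mult_2 order.trans[OF degree_mult_le])
    then have "degree (B\<^sup>2 * f) \<le> 2 * n"
      unfolding eq by (intro degree_diff_le) (auto simp: degree_power_eq)
    moreover have "coeff (A\<^sup>2) (2 * n) = 1"
    proof -
      have "degree A = n" using P(2,3) le_degree[of A n] by simp
      then show ?thesis
        using P(3) coeff_mult_degree_sum[of A A] by (simp add: power2_eq_square mult_2)
    qed
    then have "coeff (B\<^sup>2 * f) (2 * n) = 0" unfolding eq by (simp add: coeff_X_power)
    ultimately have "degree (B\<^sup>2 * f) < 2 * n"
      using n dB by (metis False \<open>f \<noteq> 0\<close> le_neq_implies_less leading_coeff_0_iff mult_eq_0_iff power_not_zero)
    then show ?thesis using dB by simp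
  qed simp
  have dBU: "degree (B * c) \<le> n - 1" if "degree c \<le> 1" for c
    using degB that degree_mult_le[of B c] by auto
  have dBV: "degree (B * V 0) \<le> n - 1" "degree (B * U 0) \<le> n - 1"
    by (intro dBU; simp add: V_def U_def)+
  have "degree (W 0) \<le> 2" by (simp add: W'_def)
  then have dBW: "degree (B * W 0) \<le> n"
    using degB degree_mult_le[of B "W 0"] by auto
  have c0: "coeff (B * V 0) n = 0" "coeff (B * U 0) n = 0"
    using dBV n by (auto intro!: coeff_eq_0)
  have dA: "degree (A - B * V 0) \<le> n" "degree (A + B * V 0) \<le> n"
    using P(2) dBV by (auto intro!: degree_diff_le degree_add_le)
  have cm: "coeff (p * q) (2 * n) = coeff p n * coeff q n" if "degree p \<le> n" "degree q \<le> n" for p q :: "'a poly"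
  proof (cases "degree p = n \<and> degree q = n")
    case True
    then show ?thesis using coeff_mult_degree_sum[of p q] by (simp add: mult_2)
  next
    case False
    then have "degree p + degree q < 2 * n" "degree p < n \<or> degree q < n" using that by auto
    then have "coeff (p * q) (2 * n) = 0"
      using degree_mult_le[of p q] by (intro coeff_eq_0) simp
    then show ?thesis using \<open>degree p < n \<or> degree q < n\<close> by (auto simp: coeff_eq_0)
  qed
  have const: "c = [:coeff (X ^ (2 * n) * c) (2 * n):]" if "degree (X ^ (2 * n) * c) \<le> 2 * n" for c :: "'a poly"
  proof (cases "c = 0")
    case False
    then have "degree c = 0" using that by (simp add: degree_mult_eq degree_power_eq del: mult_pCons_left)
    then obtain d where "c = [:d:]" by (metis degree_eq_zeroE)
    then show ?thesis by (simp add: coeff_X_power)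
  qed simp
  have dmul: "degree (p * q) \<le> 2 * n" if "degree p \<le> n" "degree q \<le> n" for p q :: "'a poly"
    using degree_mult_le[of p q] that by simp
  note md = m_degree[of n]
  have dBU': "degree (B * U 0) \<le> n" "degree (B * V 0) \<le> n" "degree A \<le> n" using dBV P(2) by simp_all
  \<comment> \<open>The one entry of the constant cofactor that the top coefficients in
    \<open>m_degree\<close> leave open.\<close>
  define \<tau> where "\<tau> = coeff (m21 n * (A - B * V 0) + m22 n * (B * W 0)) (2 * n)"
  have K1: "m11 n * (A - B * V 0) + m12 n * (B * W 0) = X ^ (2 * n)"
    "m21 n * (A - B * V 0) + m22 n * (B * W 0) = X ^ (2 * n) * [:\<tau>:]"
  proof -
    obtain c\<^sub>1 c\<^sub>2 where c: "m11 n * (A - B * V 0) + m12 n * (B * W 0) = X ^ (2 * n) * c\<^sub>1"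
      "m21 n * (A - B * V 0) + m22 n * (B * W 0) = X ^ (2 * n) * c\<^sub>2"
      using *[of 1 0] unfolding transfer_eq by (auto simp del: mult_pCons_left)
    have "degree (X ^ (2 * n) * c\<^sub>1) \<le> 2 * n" unfolding c[symmetric]
      using md dA dBW by (intro degree_add_le dmul) auto
    from const[OF this] show "m11 n * (A - B * V 0) + m12 n * (B * W 0) = X ^ (2 * n)"
      unfolding c[symmetric] coeff_add using md dA dBW c(1)
      by (simp add: cm P(3) c0 del: mult_pCons_left)
    have "degree (X ^ (2 * n) * c\<^sub>2) \<le> 2 * n" unfolding c[symmetric]
      using md dA dBW by (intro degree_add_le dmul) auto
    from const[OF this] show "m21 n * (A - B * V 0) + m22 n * (B * W 0) = X ^ (2 * n) * [:\<tau>:]"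
      unfolding \<tau>_def c by simp
  qed
  have K2: "m11 n * (B * U 0) + m12 n * (A + B * V 0) = 0"
    "m21 n * (B * U 0) + m22 n * (A + B * V 0) = X ^ (2 * n)"
  proof -
    obtain c\<^sub>1 c\<^sub>2 where c: "m11 n * (B * U 0) + m12 n * (A + B * V 0) = X ^ (2 * n) * c\<^sub>1"
      "m21 n * (B * U 0) + m22 n * (A + B * V 0) = X ^ (2 * n) * c\<^sub>2"
      using *[of 0 1] unfolding transfer_eq by (auto simp del: mult_pCons_left)
    have "degree (X ^ (2 * n) * c\<^sub>1) \<le> 2 * n" unfolding c[symmetric]
      using md dA dBU' by (intro degree_add_le dmul) auto
    from const[OF this] show "m11 n * (B * U 0) + m12 n * (A + B * V 0) = 0"
      unfolding c[symmetric] coeff_add using md dA dBU' c(1)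
      by (simp add: cm P(3) c0 del: mult_pCons_left)
    have "degree (X ^ (2 * n) * c\<^sub>2) \<le> 2 * n" unfolding c[symmetric]
      using md dA dBU' by (intro degree_add_le dmul) auto
    from const[OF this] show "m21 n * (B * U 0) + m22 n * (A + B * V 0) = X ^ (2 * n)"
      unfolding c[symmetric] coeff_add using md dA dBU' c(2)
      by (simp add: cm P(3) c0 del: mult_pCons_left)
  qed
  have nzX: "X ^ (2 * n) \<noteq> 0" by simp
  define M where "M = X ^ (2 * n)"
  have detN: "(A - B * V 0) * (A + B * V 0) - B * W 0 * (B * U 0) = M"
    unfolding M_def P(1)[symmetric] det_L[of 0, symmetric] by algebra
  note C1 = cramer_2[OF K1(1) K2(1) detN] and C2 = cramer_2[OF K1(2) K2(2) detN]
  have "M * m11 n = M * (A + B * V 0)" "M * m12 n = M * - (B * U 0)"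
    using C1 unfolding M_def by (simp_all del: mult_pCons_left)
  then show m11: "m11 n = A + B * V 0" and m12: "m12 n = - (B * U 0)"
    using nzX unfolding M_def by (metis mult_left_cancel)+
  have "M * m21 n = M * ([:\<tau>:] * (A + B * V 0) - B * W 0)"
    using C2(1) unfolding M_def[symmetric] by (simp only: right_diff_distrib mult.assoc)
  then have m21: "m21 n = [:\<tau>:] * (A + B * V 0) - B * W 0"
    using nzX unfolding M_def by (metis mult_left_cancel)
  \<comment> \<open>At \<open>0\<close> both \<open>m21\<close> and \<open>W\<close> vanish, while
    \<open>A + B V\<close> takes the nonzero value \<open>2 A(0)\<close>; this forces
    \<open>\<tau>\<close> to be zero.\<close>
  have "poly (m21 n) 0 = \<tau> * (poly A 0 + poly B 0 * v0)" unfolding m21 by (simp add: V_def)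
  then have "\<tau> * (2 * poly A 0) = 0" using m_at_0(2)[of n] sgn by (simp add: mult.commute)
  then have \<tau>: "\<tau> = 0" using P(4) by simp
  then show "m21 n = - (B * W 0)" using m21 by simp
  have "M * m22 n = M * (A - B * V 0)"
    using C2(2) \<tau> unfolding M_def[symmetric] by simp
  then show "m22 n = A - B * V 0" using nzX unfolding M_def by (metis mult_left_cancel)
qed

text \<open>At \<open>0\<close> the equation gives \<open>A = v0 B\<close> up to the sign of
  \<open>B\<close>, which may be chosen. The product of the bounces is then \<open>A + B L\<close>,
  with \<open>(u 0, x 0)\<close> and \<open>(w 0, y 0)\<close> as eigenvectors at \<open>a\<close>
  and \<open>- b\<close>.\<close>

lemma periodic_if_pell:
  assumes n: "n \<ge> 1" and pell: "pell_solution f n A B"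
    and A: "poly A a = \<sigma>\<^sub>1 * a ^ n" "poly A (- b) = \<sigma>\<^sub>2 * (- b) ^ n"
  shows "x n = \<sigma>\<^sub>1 * x 0" "u n = \<sigma>\<^sub>1 * u 0" "y n = \<sigma>\<^sub>2 * y 0" "w n = \<sigma>\<^sub>2 * w 0"
proof -
  have P: "A\<^sup>2 - B\<^sup>2 * f = X ^ (2 * n)" using pell by (simp add: pell_solution_def)
  have "(poly A 0)\<^sup>2 - (poly B 0)\<^sup>2 * v0\<^sup>2 = 0"
    using arg_cong[OF P, of "\<lambda>p. poly p 0"] n by (simp add: f_at_0 poly_power power_0_left)
  then have "(poly A 0)\<^sup>2 = (v0 * poly B 0)\<^sup>2" by algebra
  then have "poly A 0 = v0 * poly B 0 \<or> poly A 0 = v0 * poly (- B) 0"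
    using power2_eq_iff by fastforce
  then obtain B' where B': "B' = B \<or> B' = - B" "poly A 0 = v0 * poly B' 0" by blast
  have "pell_solution f n A B'" using pell B'(1) by (auto simp: pell_solution_def)
  note m = transfer_if_pell[OF n this B'(2)]
  have a: "poly A a * u 0 = a ^ n * u n" "poly A a * x 0 = a ^ n * x n"
    using transfer_at_a[of n] unfolding m poly_add poly_diff poly_minus poly_mult[of B']
      kernel_vector[OF L_kernel_at_a[of 0]] by simp_all
  have b: "poly A (- b) * w 0 = (- b) ^ n * w n" "poly A (- b) * y 0 = (- b) ^ n * y n"
    using transfer_at_b[of n] unfolding m poly_add poly_diff poly_minus poly_mult[of B']
      kernel_vector[OF L_kernel_at_b[of 0]] by simp_all
  show "x n = \<sigma>\<^sub>1 * x 0" "u n = \<sigma>\<^sub>1 * u 0" "y n = \<sigma>\<^sub>2 * y 0" "w n = \<sigma>\<^sub>2 * w 0"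
    using a b nz unfolding A by (auto simp: mult.assoc mult.left_commute)
qed

text \<open>The sign changes commute with the dynamics: \<open>t_eq\<close> and \<open>s_eq\<close>
  determine \<open>t\<close> and \<open>s\<close> from squares of the coordinates.\<close>

lemma periodic_from_start:
  assumes sig: "\<sigma>\<^sub>1\<^sup>2 = 1" "\<sigma>\<^sub>2\<^sup>2 = 1"
    and "x n = \<sigma>\<^sub>1 * x 0" "u n = \<sigma>\<^sub>1 * u 0" "y n = \<sigma>\<^sub>2 * y 0" "w n = \<sigma>\<^sub>2 * w 0"
  shows "x (k + n) = \<sigma>\<^sub>1 * x k \<and> u (k + n) = \<sigma>\<^sub>1 * u k \<and> y (k + n) = \<sigma>\<^sub>2 * y k \<and> w (k + n) = \<sigma>\<^sub>2 * w k"
proof (induction k)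
  case 0
  then show ?case using assms by simp
next
  case (Suc k)
  let ?U = "b * (u k)\<^sup>2 + a * (w k)\<^sup>2"
  have "t (k + n) * ?U = t k * ?U"
    using t_eq[of k] t_eq[of "k + n"] Suc sig by (simp add: power_mult_distrib)
  then have t: "t (k + n) = t k" using speed_nz[of k] by simp
  have x: "x (Suc k + n) = \<sigma>\<^sub>1 * x (Suc k)" "y (Suc k + n) = \<sigma>\<^sub>2 * y (Suc k)"
    using Suc move[of "k + n"] move[of k] t by (simp_all add: algebra_simps)
  let ?D = "(b * x (Suc k))\<^sup>2 - (a * y (Suc k))\<^sup>2"
  have "s (k + n) * ?D = s k * ?D"
    using s_eq[of k] s_eq[of "k + n"] x sig by (simp add: power_mult_distrib)
  moreover have "?D \<noteq> 0" using s_eq[of k] nz by auto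
  ultimately have s: "s (k + n) = s k" by simp
  have "u (Suc k + n) = \<sigma>\<^sub>1 * u k + s k * (\<sigma>\<^sub>1 * x (Suc k)) / a"
    "w (Suc k + n) = \<sigma>\<^sub>2 * w k - s k * (\<sigma>\<^sub>2 * y (Suc k)) / b"
    using Suc reflect[of "k + n"] x s by simp_all
  then show ?case
    using x by (simp add: reflect[of k] distrib_left right_diff_distrib mult.left_commute)
qed

end

section \<open>Billiard trajectories in normalized form\<close>

text \<open>A line \<open>p x + r y = z0\<close> is tangent when
  \<open>(a - g) p^2 + (b + g) r^2 = z0^2\<close>, the equation of the dual conic;
  \<open>(p, r)\<close> is a multiple of the chord turned by a right angle.\<close>

lemma tangent_chord:
  assumes g: "g \<noteq> a" "g \<noteq> - b" and PQ: "P \<noteq> Q"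
    and tan: "tangent_to_confocal a b g (affine hull {P, Q})"
  defines "d \<equiv> Q - P"
  shows "(fst d)\<^sup>2 * (b + g) + (snd d)\<^sup>2 * (a - g) = (fst P * snd d - snd P * fst d)\<^sup>2"
proof -
  obtain x0 y0 z0 where nz: "(x0, y0, z0) \<noteq> (0, 0, 0)"
    and q: "x0\<^sup>2 / (a - g) + y0\<^sup>2 / (b + g) = z0\<^sup>2"
    and L: "affine hull {P, Q} = {(x, y). x0 * x / (a - g) + y0 * y / (b + g) = z0}"
    using tan unfolding tangent_to_confocal_def by blast
  define p where "p = x0 / (a - g)"
  define r where "r = y0 / (b + g)"
  have g': "a - g \<noteq> 0" "b + g \<noteq> 0" using g by auto
  have "P \<in> affine hull {P, Q}" "Q \<in> affine hull {P, Q}" by (auto intro: hull_inc)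
  then have P: "p * fst P + r * snd P = z0" and Q: "p * fst Q + r * snd Q = z0"
    unfolding L by (auto simp: p_def r_def case_prod_beta)
  have x0: "x0 = p * (a - g)" "y0 = r * (b + g)" using g' by (auto simp: p_def r_def)
  have q': "(a - g) * p\<^sup>2 + (b + g) * r\<^sup>2 = z0\<^sup>2"
    using q g' unfolding x0 by (simp add: power2_eq_square mult_ac)
  have pr: "p \<noteq> 0 \<or> r \<noteq> 0" using nz P x0 by auto
  have pd: "p * fst d + r * snd d = 0" using P Q by (simp add: d_def algebra_simps)
  have dnz: "fst d \<noteq> 0 \<or> snd d \<noteq> 0" using PQ by (auto simp: d_def prod_eq_iff)
  obtain m where m: "p = - m * snd d" "r = m * fst d"
  proof (cases "fst d = 0")
    case True
    then have "r = 0" "snd d \<noteq> 0" using pd dnz by auto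
    then show ?thesis using that[of "- p / snd d"] True by simp
  next
    case False
    then show ?thesis using that[of "r / fst d"] pd by (simp add: field_simps add_eq_0_iff)
  qed
  then have "m \<noteq> 0" using pr by auto
  have "m\<^sup>2 * ((fst d)\<^sup>2 * (b + g) + (snd d)\<^sup>2 * (a - g)) = (a - g) * p\<^sup>2 + (b + g) * r\<^sup>2"
    unfolding m by (simp add: power2_eq_square algebra_simps)
  also have "\<dots> = m\<^sup>2 * (fst P * snd d - snd P * fst d)\<^sup>2"
    unfolding q' P[symmetric] unfolding m by (simp add: power2_eq_square algebra_simps)
  finally show ?thesis using \<open>m \<noteq> 0\<close> by simp
qed

lemma ellipse_iff:
  assumes "a > 0" "b > 0"
  shows "P \<in> ellipse a b \<longleftrightarrow> b * (fst P)\<^sup>2 + a * (snd P)\<^sup>2 = a * b"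
  using assms by (cases P) (auto simp: ellipse_def field_simps)

text \<open>The Minkowski complement of the tangent direction \<open>(- y / b, x / a)\<close> is
  spanned by \<open>(x / a, - y / b)\<close>, and the reflection subtracts twice the component
  there.\<close>

lemma reflection_normal_form:
  assumes ab: "a > 0" "b > 0" and refl: "billiard_reflection (tangent_dir a b P) v v'"
  shows "(\<exists>s. v' = (fst v + s * fst P / a, snd v - s * snd P / b)) \<and> mink v' v' = mink v v"
proof -
  define p where "p = tangent_dir a b P"
  obtain z w where zw: "v = z + w" "z \<in> span {p}" "mink w p = 0" "v' = z - w"
    and nl: "\<not> light_like p"
    using refl unfolding billiard_reflection_def p_def by blast
  obtain c where c: "z = c *\<^sub>R p" using zw(2) by (auto simp: span_singleton)
  have wp: "fst w * fst p = snd w * snd p" using zw(3) by (simp add: mink_def)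
  have pnz: "fst p \<noteq> 0 \<or> snd p \<noteq> 0" using nl by (auto simp: light_like_def mink_def)
  obtain m where m: "fst w = m * snd p" "snd w = m * fst p"
  proof (cases "fst p = 0")
    case True
    then have "snd w = 0" "snd p \<noteq> 0" using wp pnz by auto
    then show ?thesis using that[of "fst w / snd p"] True by simp
  next
    case False
    then show ?thesis using that[of "snd w / fst p"] wp by (simp add: field_simps)
  qed
  have p: "fst p = - snd P / b" "snd p = fst P / a" by (simp_all add: p_def tangent_dir_def)
  have "v' = (fst v + (- 2 * m) * fst P / a, snd v - (- 2 * m) * snd P / b)"
    using m p zw by (simp add: prod_eq_iff)
  moreover have "mink v' v' = mink v v - 4 * c * (fst w * fst p - snd w * snd p)"
    unfolding mink_def zw(1,4) c by (simp add: algebra_simps)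
  then have "mink v' v' = mink v v" using wp by simp
  ultimately show ?thesis by blast
qed

locale caustic_trajectory =
  fixes a b g :: real and T :: "nat \<Rightarrow> plane"
  assumes ab: "a > 0" "b > 0" and g: "g \<notin> {- b, 0, a}"
    and trajectory: "billiard_trajectory a b T" and caustic: "has_caustic a b g T"
begin

definition \<delta> :: "nat \<Rightarrow> plane" where "\<delta> k = T (Suc k) - T k"
definition t :: "nat \<Rightarrow> real" where "t k = sqrt \<bar>mink (\<delta> k) (\<delta> k)\<bar>"
definition x :: "nat \<Rightarrow> real" where "x k = fst (T k)"
definition y :: "nat \<Rightarrow> real" where "y k = snd (T k)"
definition u :: "nat \<Rightarrow> real" where "u k = fst (\<delta> k) / t k"
definition w :: "nat \<Rightarrow> real" where "w k = snd (\<delta> k) / t k"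
definition e :: real where "e = sgn g"
text \<open>The minus sign reflects that a chord points from its initial vertex into the
  ellipse.\<close>

definition v0 :: real where "v0 = - sqrt (a * b * \<bar>g\<bar>)"

lemma T_eq: "T k = (x k, y k)"
  by (simp add: x_def y_def)

lemma on_ellipse: "b * (x k)\<^sup>2 + a * (y k)\<^sup>2 = a * b"
  using trajectory ellipse_iff[OF ab] by (auto simp: billiard_trajectory_def x_def y_def)

lemma T_neq: "T k \<noteq> T (Suc k)"
  using trajectory unfolding billiard_trajectory_def by blast

lemma \<delta>_nz: "\<delta> k \<noteq> 0"
  using T_neq[of k] unfolding \<delta>_def by (metis eq_iff_diff_eq_0)

lemma \<delta>_speed: "b * (fst (\<delta> k))\<^sup>2 + a * (snd (\<delta> k))\<^sup>2 > 0"
proof -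
  have "fst (\<delta> k) \<noteq> 0 \<or> snd (\<delta> k) \<noteq> 0" using \<delta>_nz[of k] by (auto simp: prod_eq_iff)
  then have "b * (fst (\<delta> k))\<^sup>2 > 0 \<or> a * (snd (\<delta> k))\<^sup>2 > 0" using ab by auto
  moreover have "b * (fst (\<delta> k))\<^sup>2 \<ge> 0" "a * (snd (\<delta> k))\<^sup>2 \<ge> 0" using ab by auto
  ultimately show ?thesis by linarith
qed

lemma \<delta>_pairing:
  "b * x k * fst (\<delta> k) + a * y k * snd (\<delta> k) = - (b * (fst (\<delta> k))\<^sup>2 + a * (snd (\<delta> k))\<^sup>2) / 2"
proof -
  have "x (Suc k) = x k + fst (\<delta> k)" "y (Suc k) = y k + snd (\<delta> k)"
    by (simp_all add: \<delta>_def x_def y_def)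
  then have "b * (x k + fst (\<delta> k))\<^sup>2 + a * (y k + snd (\<delta> k))\<^sup>2 = a * b"
    using on_ellipse[of "Suc k"] by simp
  then show ?thesis using on_ellipse[of k] by (simp add: power2_sum algebra_simps)
qed

lemma \<delta>_tangent:
  "(fst (\<delta> k))\<^sup>2 * (b + g) + (snd (\<delta> k))\<^sup>2 * (a - g) = (x k * snd (\<delta> k) - y k * fst (\<delta> k))\<^sup>2"
proof -
  have "tangent_to_confocal a b g (affine hull {T k, T (Suc k)})"
    using caustic by (auto simp: has_caustic_def)
  then show ?thesis
    using tangent_chord[of g a b "T k" "T (Suc k)"] g T_neq by (auto simp: \<delta>_def x_def y_def)
qed

lemma \<delta>_mink:
  "(b * x k * fst (\<delta> k) + a * y k * snd (\<delta> k))\<^sup>2 = a * b * (- g * mink (\<delta> k) (\<delta> k))"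
proof -
  have "(b * x k * fst (\<delta> k) + a * y k * snd (\<delta> k))\<^sup>2
      = (b * (fst (\<delta> k))\<^sup>2 + a * (snd (\<delta> k))\<^sup>2) * (b * (x k)\<^sup>2 + a * (y k)\<^sup>2)
        - a * b * (x k * snd (\<delta> k) - y k * fst (\<delta> k))\<^sup>2"
    by algebra
  also have "\<dots> = a * b * (- g * mink (\<delta> k) (\<delta> k))"
    unfolding on_ellipse \<delta>_tangent[symmetric] mink_def by algebra
  finally show ?thesis .
qed

text \<open>A chord pairs nontrivially with its initial vertex, so \<open>\<delta>_mink\<close>
  excludes light-like chords and ties their type to the sign of \<open>g\<close>. Directions can
  therefore be normalized.\<close>

lemma mink_sign: "- g * mink (\<delta> k) (\<delta> k) > 0"
proof -
  have "b * x k * fst (\<delta> k) + a * y k * snd (\<delta> k) \<noteq> 0"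
    using \<delta>_speed[of k] unfolding \<delta>_pairing by simp
  then have "a * b * (- g * mink (\<delta> k) (\<delta> k)) > 0"
    unfolding \<delta>_mink[symmetric] by simp
  then show ?thesis using ab by (metis mult_pos_pos zero_less_mult_pos)
qed

lemma t_pos: "t k > 0"
  using mink_sign[of k] by (auto simp: t_def)

lemma e_g: "e * e = 1" "e * g = \<bar>g\<bar>"
  using g by (auto simp: e_def sgn_if)

lemma mink_eq: "mink (\<delta> k) (\<delta> k) = - e * (t k)\<^sup>2"
  using mink_sign[of k] by (auto simp: t_def e_def sgn_if zero_less_mult_iff mult_less_0_iff)

lemma \<delta>_t: "fst (\<delta> k) = t k * u k" "snd (\<delta> k) = t k * w k"
  using t_pos[of k] by (auto simp: u_def w_def)

lemma unit: "(u k)\<^sup>2 - (w k)\<^sup>2 = - e"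
proof -
  have "(t k)\<^sup>2 * ((u k)\<^sup>2 - (w k)\<^sup>2 + e) = 0"
    using mink_eq[of k] unfolding mink_def \<delta>_t by (simp add: power2_eq_square algebra_simps)
  then show ?thesis using t_pos[of k] by simp
qed

lemma move: "x (Suc k) = x k + t k * u k" "y (Suc k) = y k + t k * w k"
  using \<delta>_t[of k] by (simp_all add: \<delta>_def x_def y_def)

lemma pairing: "b * x k * u k + a * y k * w k = v0"
proof -
  let ?p = "b * x k * u k + a * y k * w k"
  have p: "b * x k * fst (\<delta> k) + a * y k * snd (\<delta> k) = t k * ?p"
    unfolding \<delta>_t by (simp add: algebra_simps)
  have "(t k)\<^sup>2 * ?p\<^sup>2 = (t k)\<^sup>2 * (a * b * (e * g))"
    using \<delta>_mink[of k] unfolding p mink_eq by (simp add: power_mult_distrib mult_ac)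
  then have "?p\<^sup>2 = a * b * \<bar>g\<bar>" using t_pos[of k] by (simp add: e_g)
  then have "\<bar>?p\<bar> = sqrt (a * b * \<bar>g\<bar>)" by (metis real_sqrt_abs)
  moreover have "t k * ?p < 0"
    unfolding p[symmetric] \<delta>_pairing using \<delta>_speed[of k] by simp
  then have "?p < 0" using t_pos[of k] by (simp add: mult_less_0_iff)
  ultimately show ?thesis by (simp add: v0_def)
qed

text \<open>Reflection preserves the Minkowski square, so the factor \<open>c\<close> between
  consecutive chords also scales \<open>t\<close> and drops out of the unit directions.\<close>

lemma reflect_ex: "\<exists>s. u (Suc k) = u k + s * x (Suc k) / a \<and> w (Suc k) = w k - s * y (Suc k) / b"
proof -
  obtain v' c where c: "c > 0"
    and refl: "billiard_reflection (tangent_dir a b (T (Suc k))) (\<delta> k) v'"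
    and nxt: "\<delta> (Suc k) = c *\<^sub>R v'"
    using trajectory unfolding billiard_trajectory_def \<delta>_def by blast
  obtain r where r: "v' = (fst (\<delta> k) + r * x (Suc k) / a, snd (\<delta> k) - r * y (Suc k) / b)"
    and m: "mink v' v' = mink (\<delta> k) (\<delta> k)"
    using reflection_normal_form[OF ab refl] by (auto simp: x_def y_def)
  have "mink (\<delta> (Suc k)) (\<delta> (Suc k)) = c\<^sup>2 * mink (\<delta> k) (\<delta> k)"
    unfolding m[symmetric] nxt by (simp add: mink_def power2_eq_square algebra_simps)
  then have "t (Suc k) = c * t k"
    using c by (simp add: t_def abs_mult real_sqrt_mult)
  then have "u (Suc k) = fst v' / t k" "w (Suc k) = snd v' / t k"
    using c unfolding u_def w_def nxt by simp_all
  then show ?thesis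
    using t_pos[of k] unfolding r
    by (intro exI[of _ "r / t k"]) (simp add: u_def w_def add_divide_distrib diff_divide_distrib)
qed

definition s :: "nat \<Rightarrow> real" where
  "s k = (SOME s. u (Suc k) = u k + s * x (Suc k) / a \<and> w (Suc k) = w k - s * y (Suc k) / b)"

lemma reflect: "u (Suc k) = u k + s k * x (Suc k) / a" "w (Suc k) = w k - s k * y (Suc k) / b"
  using someI_ex[OF reflect_ex[of k]] unfolding s_def by auto

sublocale real: billiard_orbit a b g e v0 x y u w t s
proof
  show "a \<noteq> 0" "b \<noteq> 0" "a + b \<noteq> 0" using ab by auto
  show "g \<noteq> 0" "g \<noteq> a" "g \<noteq> - b" using g by auto
  show "v0 \<noteq> 0" using ab g by (simp add: v0_def)
  show "e * e = 1" by (rule e_g)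
  fix k
  show "b * (u k)\<^sup>2 + a * (w k)\<^sup>2 \<noteq> 0"
  proof -
    have "b * (fst (\<delta> k))\<^sup>2 + a * (snd (\<delta> k))\<^sup>2 = (t k)\<^sup>2 * (b * (u k)\<^sup>2 + a * (w k)\<^sup>2)"
      unfolding \<delta>_t by (simp add: power_mult_distrib algebra_simps)
    then show ?thesis using \<delta>_speed[of k] by auto
  qed
  have "(t k)\<^sup>2 * ((u k)\<^sup>2 * (b + g) + (w k)\<^sup>2 * (a - g)) = (t k)\<^sup>2 * (x k * w k - y k * u k)\<^sup>2"
    using \<delta>_tangent[of k] unfolding \<delta>_t by (simp add: power2_eq_square algebra_simps)
  then show "(u k)\<^sup>2 * (b + g) + (w k)\<^sup>2 * (a - g) = (x k * w k - y k * u k)\<^sup>2"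
    using t_pos[of k] by simp
  show "t k \<noteq> 0" using t_pos[of k] by simp
qed (rule on_ellipse pairing unit move reflect)+

text \<open>Linear equivalence yields Pell solutions with complex coefficients, so the passage back
  to a period takes place on the complexified orbit.\<close>

sublocale complex: billiard_orbit "complex_of_real a" "complex_of_real b" "complex_of_real g"
  "complex_of_real e" "complex_of_real v0" "\<lambda>k. complex_of_real (x k)" "\<lambda>k. complex_of_real (y k)"
  "\<lambda>k. complex_of_real (u k)" "\<lambda>k. complex_of_real (w k)" "\<lambda>k. complex_of_real (t k)"
  "\<lambda>k. complex_of_real (s k)"
proof
  show "complex_of_real a \<noteq> 0" "complex_of_real b \<noteq> 0" "complex_of_real g \<noteq> 0"
    "complex_of_real g \<noteq> complex_of_real a" "complex_of_real v0 \<noteq> 0"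
    using real.nz by simp_all
  show "complex_of_real a + complex_of_real b \<noteq> 0" using real.nz(3) by (metis of_real_add of_real_eq_0_iff)
  show "complex_of_real g \<noteq> - complex_of_real b" using real.nz(6) by (metis of_real_minus of_real_eq_iff)
  show "complex_of_real e * complex_of_real e = 1" using real.e by (metis of_real_1 of_real_mult)
  fix k
  show "complex_of_real (t k) \<noteq> 0" using real.t_nz by simp
  show "complex_of_real b * (complex_of_real (u k))\<^sup>2 + complex_of_real a * (complex_of_real (w k))\<^sup>2 \<noteq> 0"
    using real.speed_nz[of k] unfolding of_real_mult[symmetric] of_real_power[symmetric]
      of_real_add[symmetric] of_real_eq_0_iff .
qed (simp_all only: real.on_ellipse real.pairing real.unit real.tangent real.move real.reflect
    flip: of_real_add of_real_mult of_real_diff of_real_power of_real_minus of_real_divide)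

lemma complex_f: "complex.f = K_poly a b g"
  unfolding complex.f_def unfolding K_poly_def e_def ..

end

section \<open>Linear equivalence and the Pell equation\<close>

lemma K_poly_cubic_curve:
  assumes "a > 0" "b > 0" and g: "g \<notin> {- b, 0, a}"
  shows "cubic_curve {of_real a, - of_real b, of_real g} (of_real (sgn g)) (K_poly a b g)"
proof
  have d: "complex_of_real a \<noteq> - of_real b" "complex_of_real a \<noteq> of_real g"
    "- complex_of_real b \<noteq> of_real g"
    using assms by (auto simp: complex_eq_iff)
  then show "card {complex_of_real a, - of_real b, of_real g} = 3" by simp
  show "complex_of_real (sgn g) \<noteq> 0" using g by (simp add: sgn_if)
  have "(\<Prod>r\<in>{complex_of_real a, - of_real b, of_real g}. [:- r, 1:])
      = [:- of_real a, 1:] * ([:of_real b, 1:] * [:- of_real g, 1:])"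
    using d by simp
  also have "\<dots> = [:of_real a, - 1:] * [:of_real b, 1:] * [:of_real g, - 1:]" by (simp add: algebra_simps)
  finally show "K_poly a b g = smult (of_real (sgn g))
      (\<Prod>r\<in>{complex_of_real a, - of_real b, of_real g}. [:- r, 1:])"
    by (simp only: K_poly_def)
qed

text \<open>The divisor is a \<open>branch_divisor\<close> with multiplicities \<open>i\<close>,
  \<open>j\<close>, \<open>k\<close>. The right side prescribes no value of \<open>A\<close> at
  \<open>g\<close>: it follows from the other two by \<open>pell_parity\<close> and
  \<open>i + j + k = n\<close>.\<close>

lemma lin_equiv_iff_pell:
  assumes ab: "a > 0" "b > 0" and g: "g \<notin> {- b, 0, a}" and n: "n \<ge> 1" and sum: "i + j + k = n"
    and y0: "y0\<^sup>2 = poly (K_poly a b g) 0"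
  shows "lin_equiv (K_poly a b g)
      (frag_cmul (int n) (frag_of (Affine 0 y0)) - frag_cmul (int i) (frag_of (Q_branch g))
        - frag_cmul (int j) (frag_of (Q_branch a)) - frag_cmul (int k) (frag_of (Q_branch (- b)))) 0
    \<longleftrightarrow> (\<exists>A B. pell_solution (K_poly a b g) n A B \<and>
      poly A (of_real a) = (- 1) ^ j * of_real a ^ n \<and>
      poly A (- of_real b) = (- 1) ^ k * (- of_real b) ^ n)"
proof -
  define K where "K = K_poly a b g"
  define S where "S = {complex_of_real a, - of_real b, of_real g}"
  interpret cubic_curve S "of_real (sgn g)" K
    unfolding S_def K_def by (rule K_poly_cubic_curve[OF ab g])
  have d: "complex_of_real a \<noteq> - of_real b" "complex_of_real a \<noteq> of_real g"
    "- complex_of_real b \<noteq> of_real g"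
    using ab g by (auto simp: complex_eq_iff)
  have S0: "0 \<notin> S" using ab g by (auto simp: S_def)
  define m where "m z = (if z = of_real g then i else if z = of_real a then j else k)"
    for z :: complex
  have m: "m (of_real g) = i" "m (of_real a) = j" "m (- of_real b) = k" using d by (auto simp: m_def)
  have sum_m: "sum m S = n" using sum d by (auto simp: S_def m)
  have y0': "y0\<^sup>2 = poly K 0" using y0 by (simp add: K_def)
  define D where "D = frag_cmul (int n) (frag_of (Affine 0 y0)) - frag_cmul (int i) (frag_of (Q_branch g))
        - frag_cmul (int j) (frag_of (Q_branch a)) - frag_cmul (int k) (frag_of (Q_branch (- b)))"
  have D: "Poly_Mapping.lookup D P = branch_divisor n y0 m P" if P: "P \<in> curve K" for P
  proof (cases P)
    case At_Infinity
    then show ?thesis by (simp add: D_def branch_divisor_def lookup_minus)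
  next
    case (Affine z y)
    have y: "y\<^sup>2 = poly K z" using P Affine by (simp add: curve_def)
    show ?thesis
    proof (cases "z \<in> S")
      case True
      then have "y = 0" "z \<noteq> 0" using y poly_f_eq_0_iff[of z] S0 by auto
      moreover have "z = of_real a \<or> z = - of_real b \<or> z = of_real g" using True by (simp add: S_def)
      moreover have "branch_divisor n y0 m (Affine z y) = - int (m z)"
        using True by (simp add: branch_divisor_def)
      ultimately show ?thesis using d unfolding Affine D_def by (auto simp: lookup_minus m)
    next
      case False
      then have "z \<noteq> of_real a" "z \<noteq> - of_real b" "z \<noteq> of_real g" by (auto simp: S_def)
      moreover have "branch_divisor n y0 m (Affine z y) = (if z = 0 \<and> y = y0 then int n else 0)"
        using False by (simp add: branch_divisor_def)
      ultimately show ?thesis unfolding Affine D_def by (simp add: lookup_minus)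
    qed
  qed
  have keys: "Poly_Mapping.keys D \<subseteq> curve K"
  proof
    fix P assume "P \<in> Poly_Mapping.keys D"
    then have "Poly_Mapping.lookup D P \<noteq> 0" by (simp add: in_keys_iff)
    then have "P \<in> {Affine 0 y0, Q_branch g, Q_branch a, Q_branch (- b)}"
      by (auto simp: D_def lookup_minus split: if_splits)
    moreover have "poly K (of_real g) = 0" "poly K (of_real a) = 0" "poly K (- of_real b) = 0"
      using poly_f_eq_0_iff by (auto simp: S_def)
    ultimately show "P \<in> curve K" using y0' by (auto simp: curve_def)
  qed
  have lin: "lin_equiv K D 0 \<longleftrightarrow> (\<exists>p q r s. (p, q) \<noteq> (0, 0) \<and> (r, s) \<noteq> (0, 0) \<and>
      (\<forall>P\<in>curve K. branch_divisor n y0 m P = ord_at K P p q - ord_at K P r s))"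
    unfolding lin_equiv_def principal_divisor_def using keys D by simp
  show ?thesis
    unfolding D_def[symmetric] K_def[symmetric]
  proof
    assume "lin_equiv K D 0"
    then obtain p q r s where pqrs: "(p, q) \<noteq> (0, 0)" "(r, s) \<noteq> (0, 0)"
      "\<And>P. P \<in> curve K \<Longrightarrow> branch_divisor n y0 m P = ord_at K P p q - ord_at K P r s"
      using lin by blast
    obtain A B where "pell_solution K n A B" "\<forall>z\<in>S. poly A z = (- 1) ^ m z * z ^ n"
      using pell_if_principal[OF S0 n y0' sum_m pqrs] by blast
    then show "\<exists>A B. pell_solution K n A B \<and>
      poly A (of_real a) = (- 1) ^ j * of_real a ^ n \<and>
      poly A (- of_real b) = (- 1) ^ k * (- of_real b) ^ n"
      unfolding S_def by (auto simp: m)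
  next
    assume "\<exists>A B. pell_solution K n A B \<and>
      poly A (of_real a) = (- 1) ^ j * of_real a ^ n \<and>
      poly A (- of_real b) = (- 1) ^ k * (- of_real b) ^ n"
    then obtain A B where pell: "pell_solution K n A B"
      and Aab: "poly A (of_real a) = (- 1) ^ j * of_real a ^ n"
        "poly A (- of_real b) = (- 1) ^ k * (- of_real b) ^ n" by blast
    let ?T = "{z \<in> S. poly A z = - (z ^ n)}"
    have nz: "z ^ n \<noteq> 0" if "z \<in> S" for z using that S0 by auto
    have T: "of_real a \<in> ?T \<longleftrightarrow> odd j" "- of_real b \<in> ?T \<longleftrightarrow> odd k"
      using nz[of "of_real a"] nz[of "- of_real b"] Aab
      by (cases "even j"; cases "even k"; auto simp: S_def)+
    have "card ?T = (\<Sum>z\<in>S. of_bool (z \<in> ?T))" using finite_S by (simp add: Collect_conj_eq Int_commute)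
    also have "\<dots> = of_bool (odd j) + (of_bool (odd k) + of_bool (of_real g \<in> ?T))"
      unfolding T[symmetric] using d by (simp add: S_def)
    finally have "even (n + (of_bool (odd j) + (of_bool (odd k) + of_bool (of_real g \<in> ?T :: bool))))"
      using pell_parity[OF S0 n pell] by simp
    then have Tg: "of_real g \<in> ?T \<longleftrightarrow> odd i" using sum by (auto split: if_splits)
    have gS: "of_real g \<in> S" by (simp add: S_def)
    have "(poly A (of_real g))\<^sup>2 = (of_real g ^ n)\<^sup>2"
      using pell poly_f_eq_0_iff[of "of_real g"] gS
      unfolding pell_solution_def
      by (metis (no_types, lifting) diff_zero mult.commute mult_zero_left poly_0 poly_diff poly_mult
          poly_pCons poly_power power_mult add.left_neutral mult.right_neutral mult_zero_right add.right_neutral)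
    then have "poly A (of_real g) = of_real g ^ n \<or> poly A (of_real g) = - (of_real g ^ n)"
      by (simp add: power2_eq_iff)
    then have Ag: "poly A (of_real g) = (- 1) ^ i * of_real g ^ n"
      using Tg gS nz[OF gS] by (cases "even i") auto
    have "poly A z = (- 1) ^ m z * z ^ n" if "z \<in> S" for z
      using that Aab Ag unfolding S_def by (auto simp: m)
    then show "lin_equiv K D 0"
      unfolding lin using principal_if_pell[OF S0 n y0' sum_m pell] by blast
  qed
qed

section \<open>Elliptic coordinates\<close>

text \<open>Clearing denominators covers the degenerate axes as well. The result is quadratic in
  \<open>l\<close>; its roots will be the elliptic coordinates.\<close>

lemma confocal_iff:
  assumes "a > 0" "b > 0"
  shows "P \<in> confocal a b l
    \<longleftrightarrow> (fst P)\<^sup>2 * (b + l) + (snd P)\<^sup>2 * (a - l) - (a - l) * (b + l) = 0"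
proof (cases "l = - b \<or> l = a")
  case True
  then show ?thesis using assms by (cases P) (auto simp: confocal_def)
next
  case False
  then have nz: "a - l \<noteq> 0" "b + l \<noteq> 0" by auto
  then have "(fst P)\<^sup>2 * (b + l) + (snd P)\<^sup>2 * (a - l) - (a - l) * (b + l)
      = ((fst P)\<^sup>2 / (a - l) + (snd P)\<^sup>2 / (b + l) - 1) * ((a - l) * (b + l))"
    by (simp add: divide_simps)
  then show ?thesis using False nz by (cases P) (auto simp: confocal_def)
qed

text \<open>The quadratic is at most \<open>0\<close> at \<open>l = 0\<close> and nonnegative at
  \<open>a\<close> and \<open>- b\<close>, which places one root on each side of \<open>0\<close>.
  Its values at \<open>a\<close> and \<open>- b\<close> are the squares of the Cartesian coordinates
  times \<open>a + b\<close>.\<close>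

lemma elliptic_coords_inside:
  assumes ab: "a > 0" "b > 0" and P: "b * (fst P)\<^sup>2 + a * (snd P)\<^sup>2 \<le> a * b"
  obtains l1 l2 where "elliptic_coords a b P = (l1, l2)"
    "(fst P)\<^sup>2 * (a + b) = (a - l1) * (a - l2)" "(snd P)\<^sup>2 * (a + b) = (b + l1) * (b + l2)"
proof -
  define p where "p = (fst P)\<^sup>2 - (snd P)\<^sup>2 - a + b"
  define q where "q = b * (fst P)\<^sup>2 + a * (snd P)\<^sup>2 - a * b"
  define r where "r = sqrt (p\<^sup>2 - 4 * q)"
  define l1 where "l1 = (- p - r) / 2"
  define l2 where "l2 = (- p + r) / 2"
  have q: "q \<le> 0" using P by (simp add: q_def)
  have "p\<^sup>2 - 4 * q \<ge> 0" using q zero_le_power2[of p] by linarith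
  then have r2: "r\<^sup>2 = p\<^sup>2 - 4 * q" and r: "r \<ge> 0"
    unfolding r_def by auto
  have vieta: "l1 + l2 = - p" "l1 * l2 = q"
    using r2 by (simp_all add: l1_def l2_def field_simps power2_eq_square)
  have F: "(fst P)\<^sup>2 * (b + l) + (snd P)\<^sup>2 * (a - l) - (a - l) * (b + l) = (l - l1) * (l - l2)" for l
  proof -
    have "(l - l1) * (l - l2) = l * l - (l1 + l2) * l + l1 * l2" by algebra
    also have "\<dots> = l * l + p * l + q" unfolding vieta by simp
    finally show ?thesis by (simp add: p_def q_def algebra_simps)
  qed
  have "l1 \<le> l2" using r by (simp add: l1_def l2_def)
  then have l0: "l1 \<le> 0" "0 \<le> l2"
    using vieta(2) q by (smt (verit) mult_neg_neg mult_pos_pos)+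
  have Fa: "(fst P)\<^sup>2 * (a + b) = (a - l1) * (a - l2)" using F[of a] by (simp add: add.commute)
  have Fb: "(snd P)\<^sup>2 * (a + b) = (b + l1) * (b + l2)" using F[of "- b"] by (simp add: algebra_simps)
  have "(a - l1) * (a - l2) \<ge> 0" unfolding Fa[symmetric] using ab by simp
  then have "l2 \<le> a" using l0 ab by (simp add: zero_le_mult_iff)
  have "(b + l1) * (b + l2) \<ge> 0" unfolding Fb[symmetric] using ab by simp
  then have "- b \<le> l1" using l0 ab by (simp add: zero_le_mult_iff)
  have roots: "{l. P \<in> confocal a b l} = {l1, l2}"
    unfolding confocal_iff[OF ab] F by auto
  have "elliptic_coords a b P = (l1, l2)"
    unfolding elliptic_coords_def roots
  proof (rule the_equality)
    show "case (l1, l2) of (m1, m2) \<Rightarrow> - b \<le> m1 \<and> m1 \<le> 0 \<and> 0 \<le> m2 \<and> m2 \<le> a \<and> {l1, l2} = {m1, m2}"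
      using \<open>- b \<le> l1\<close> \<open>l2 \<le> a\<close> l0 by simp
  next
    fix m assume "case m of (m1, m2) \<Rightarrow> - b \<le> m1 \<and> m1 \<le> 0 \<and> 0 \<le> m2 \<and> m2 \<le> a \<and> {l1, l2} = {m1, m2}"
    then show "m = (l1, l2)" using l0 by (auto simp: doubleton_eq_iff split: prod.splits)
  qed
  then show ?thesis using that Fa Fb by blast
qed

lemma elliptic_coords_eqD:
  assumes ab: "a > 0" "b > 0"
    and "b * (fst P)\<^sup>2 + a * (snd P)\<^sup>2 \<le> a * b" "b * (fst Q)\<^sup>2 + a * (snd Q)\<^sup>2 \<le> a * b"
    and eq: "elliptic_coords a b P = elliptic_coords a b Q"
  shows "(fst P)\<^sup>2 = (fst Q)\<^sup>2" "(snd P)\<^sup>2 = (snd Q)\<^sup>2"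
proof -
  obtain l1 l2 where "elliptic_coords a b P = (l1, l2)"
    and P: "(fst P)\<^sup>2 * (a + b) = (a - l1) * (a - l2)" "(snd P)\<^sup>2 * (a + b) = (b + l1) * (b + l2)"
    using elliptic_coords_inside[OF ab assms(3)] .
  obtain m1 m2 where "elliptic_coords a b Q = (m1, m2)"
    and Q: "(fst Q)\<^sup>2 * (a + b) = (a - m1) * (a - m2)" "(snd Q)\<^sup>2 * (a + b) = (b + m1) * (b + m2)"
    using elliptic_coords_inside[OF ab assms(4)] .
  have "l1 = m1" "l2 = m2"
    using eq \<open>elliptic_coords a b P = (l1, l2)\<close> \<open>elliptic_coords a b Q = (m1, m2)\<close> by auto
  then have "(fst P)\<^sup>2 * (a + b) = (fst Q)\<^sup>2 * (a + b)" "(snd P)\<^sup>2 * (a + b) = (snd Q)\<^sup>2 * (a + b)"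
    using P Q by simp_all
  then show "(fst P)\<^sup>2 = (fst Q)\<^sup>2" "(snd P)\<^sup>2 = (snd Q)\<^sup>2" using ab by simp_all
qed

lemma elliptic_coords_cong:
  assumes ab: "a > 0" "b > 0" and "(fst P)\<^sup>2 = (fst Q)\<^sup>2" "(snd P)\<^sup>2 = (snd Q)\<^sup>2"
  shows "elliptic_coords a b P = elliptic_coords a b Q"
  unfolding elliptic_coords_def confocal_iff[OF ab] assms(3,4) ..

lemma segment_inside:
  fixes a b s :: real
  assumes ab: "a > 0" "b > 0" and s: "0 \<le> s" "s \<le> 1"
    and "b * x\<^sup>2 + a * y\<^sup>2 = a * b" "b * x'\<^sup>2 + a * y'\<^sup>2 = a * b"
  shows "b * ((1 - s) * x + s * x')\<^sup>2 + a * ((1 - s) * y + s * y')\<^sup>2 \<le> a * b"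
proof -
  have "b * ((1 - s) * x + s * x')\<^sup>2 + a * ((1 - s) * y + s * y')\<^sup>2
      = (1 - s) * (b * x\<^sup>2 + a * y\<^sup>2) + s * (b * x'\<^sup>2 + a * y'\<^sup>2)
        - s * (1 - s) * (b * (x - x')\<^sup>2 + a * (y - y')\<^sup>2)"
    by algebra
  also have "\<dots> = a * b - s * (1 - s) * (b * (x - x')\<^sup>2 + a * (y - y')\<^sup>2)"
    unfolding assms(5,6) by algebra
  also have "\<dots> \<le> a * b" using ab s by simp
  finally show ?thesis .
qed

text \<open>The midpoint yields \<open>p p' = q q'\<close>, which rules out different signs at the
  two ends unless a value is zero. The fractions have the shape of a segment parametrization at
  \<open>1 / 2\<close>.\<close>

lemma common_sign:
  fixes p q p' q' :: real
  assumes "p\<^sup>2 = q\<^sup>2" "p'\<^sup>2 = q'\<^sup>2" "((1 - 1 / 2) * p + 1 / 2 * p')\<^sup>2 = ((1 - 1 / 2) * q + 1 / 2 * q')\<^sup>2"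
  shows "\<exists>\<sigma>\<in>{1, -1}. p = \<sigma> * q \<and> p' = \<sigma> * q'"
proof -
  have "p * p' = q * q'" using assms by (simp add: power2_eq_square algebra_simps)
  moreover have "p = q \<or> p = - q" "p' = q' \<or> p' = - q'" using assms by (simp_all add: power2_eq_iff)
  ultimately show ?thesis by auto
qed

section \<open>Symmetries of a trajectory\<close>

lemma monic_root_beyond:
  fixes p :: "real poly"
  assumes "degree p \<le> n" "coeff p n = 1" "poly p c < 0"
  shows "\<exists>l>c. poly p l = 0"
proof -
  have "degree p = n" using assms(1,2) le_degree[of p n] by simp
  then have "lead_coeff p = 1" using assms(2) by simp
  then obtain N where N: "\<And>l. l \<ge> N \<Longrightarrow> 1 \<le> poly p l"
    using poly_pinfty_gt_lc[of p] by auto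
  have "0 < poly p (max N (c + 1))" using N[of "max N (c + 1)"] by simp
  moreover have "c < max N (c + 1)" by simp
  ultimately show ?thesis using poly_IVT_pos[OF _ assms(3)] by blast
qed

lemma linear_reflection: "linear (\<lambda>(x, y). (p * x, q * y))"
  for p q :: real
  by (rule linearI) (auto simp: algebra_simps)

section \<open>Sign restrictions for real Pell solutions\<close>

context caustic_trajectory
begin

lemma poly_real_f: "poly real.f l = e * ((a - l) * (b + l) * (g - l))"
  by (simp add: real.f_def algebra_simps)

text \<open>Where \<open>f\<close> is nonnegative, \<open>A^2 = l^(2n) + B^2 f\<close> is positive
  for nonzero \<open>l\<close>; at \<open>0\<close> the definition excludes a zero.\<close>

lemma pell_no_root:
  assumes "pell_solution real.f n A B" "poly real.f l \<ge> 0"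
  shows "poly A l \<noteq> 0"
proof (cases "l = 0")
  case True
  then show ?thesis using assms(1) by (simp add: pell_solution_def)
next
  case False
  have "A\<^sup>2 - B\<^sup>2 * real.f = [:0, 1:] ^ (2 * n)" using assms(1) by (simp add: pell_solution_def)
  from arg_cong[OF this, of "\<lambda>p. poly p l"]
  have "(poly A l)\<^sup>2 = l ^ (2 * n) + (poly B l)\<^sup>2 * poly real.f l" by (simp add: poly_power)
  moreover have "l ^ (2 * n) > 0" using False by (simp add: power_mult)
  moreover have "(poly B l)\<^sup>2 * poly real.f l \<ge> 0" using assms(2) by simp
  ultimately show ?thesis by auto
qed

text \<open>A negative value at \<open>a\<close> would give the monic \<open>A\<close> a root beyond
  \<open>a\<close>, where \<open>f\<close> is nonnegative.\<close>

lemma pell_sign_at_a: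
  assumes pell: "pell_solution real.f n A B" and g: "0 < g" "g < a"
  shows "poly A a \<noteq> - (a ^ n)"
proof
  assume "poly A a = - (a ^ n)"
  then have "poly A a < 0" using ab by simp
  then obtain l where l: "l > a" "poly A l = 0"
    using monic_root_beyond[of A n a] pell by (auto simp: pell_solution_def)
  have "(a - l) * (b + l) * (g - l) \<ge> 0"
    using l g ab by (simp add: mult_nonpos_nonneg mult_nonpos_nonpos)
  then have "poly real.f l \<ge> 0" unfolding poly_real_f using g by (simp add: e_def)
  then show False using pell_no_root[OF pell] l by blast
qed

text \<open>Mirror image of \<open>pell_sign_at_a\<close>: \<open>(- 1)^n A(- l)\<close> is monic,
  and \<open>f\<close> is nonnegative to the left of \<open>- b\<close>.\<close>

lemma pell_sign_at_b:
  assumes pell: "pell_solution real.f n A B" and g: "- b < g" "g < 0"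
  shows "poly A (- b) \<noteq> - ((- b) ^ n)"
proof
  assume A: "poly A (- b) = - ((- b) ^ n)"
  have deg: "degree A = n" "lead_coeff A = 1"
    using pell le_degree[of A n] by (auto simp: pell_solution_def)
  define p where "p = smult ((- 1) ^ n) (pcompose A [:0, - 1:])"
  have "coeff (pcompose A [:0, - 1:]) n = (- 1) ^ n"
    using lead_coeff_comp[of "[:0, - 1:]" A] deg by (simp add: degree_pcompose)
  then have "degree p \<le> n" "coeff p n = 1"
    using deg by (auto simp: p_def degree_pcompose simp flip: power_add)
  moreover have "poly p b < 0"
    using ab by (simp add: p_def poly_pcompose A power_minus[of b] flip: power_add mult.assoc)
  ultimately obtain l where l: "l > b" "poly p l = 0"
    using monic_root_beyond[of p n b] by blast
  have "- ((a + l) * (b - l) * (g + l)) \<ge> 0"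
    using l g ab by (simp add: mult_nonneg_nonpos mult_nonpos_nonneg mult.assoc)
  then have "poly real.f (- l) \<ge> 0" unfolding poly_real_f using g by (simp add: e_def)
  then show False using pell_no_root[OF pell, of "- l"] l by (simp add: p_def poly_pcompose)
qed

text \<open>For a hyperbola \<open>f\<close> is nonnegative between \<open>- b\<close> and
  \<open>a\<close>, so \<open>A\<close> keeps its sign there.\<close>

lemma pell_sign_hyperbola:
  assumes pell: "pell_solution real.f n A B" and g: "g < - b \<or> a < g"
  shows "poly A (- b) * poly A a > 0"
proof (rule ccontr)
  have f: "poly real.f l \<ge> 0" if "- b \<le> l" "l \<le> a" for l
    using g
  proof
    assume "g < - b"
    then have "(a - l) * (b + l) * (g - l) \<le> 0" using that by (simp add: mult_nonneg_nonpos)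
    then show ?thesis unfolding poly_real_f using \<open>g < - b\<close> ab by (simp add: e_def)
  next
    assume "a < g"
    then have "(a - l) * (b + l) * (g - l) \<ge> 0" using that by simp
    then show ?thesis unfolding poly_real_f using \<open>a < g\<close> ab by (simp add: e_def)
  qed
  assume "\<not> poly A (- b) * poly A a > 0"
  moreover have "poly A (- b) \<noteq> 0" "poly A a \<noteq> 0"
    using pell_no_root[OF pell] f ab by auto
  ultimately have "poly A (- b) * poly A a < 0" by (metis mult_eq_0_iff not_less_iff_gr_or_eq)
  then obtain l where "- b < l" "l < a" "poly A l = 0"
    using poly_IVT[of "- b" a A] ab by auto
  then show False using pell_no_root[OF pell f[of l]] by simp
qed

section \<open>Returning up to a reflection in the axes\<close>

definition returns :: "nat \<Rightarrow> real \<Rightarrow> real \<Rightarrow> bool" where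
  "returns n \<sigma>\<^sub>1 \<sigma>\<^sub>2 \<longleftrightarrow> (\<forall>k. T (k + n) = (\<sigma>\<^sub>1 * x k, \<sigma>\<^sub>2 * y k))"

lemma start_if_two_vertices:
  assumes "\<sigma>\<^sub>1\<^sup>2 = 1" "\<sigma>\<^sub>2\<^sup>2 = 1" "T n = (\<sigma>\<^sub>1 * x 0, \<sigma>\<^sub>2 * y 0)" "T (Suc n) = (\<sigma>\<^sub>1 * x 1, \<sigma>\<^sub>2 * y 1)"
  shows "x n = \<sigma>\<^sub>1 * x 0 \<and> u n = \<sigma>\<^sub>1 * u 0 \<and> y n = \<sigma>\<^sub>2 * y 0 \<and> w n = \<sigma>\<^sub>2 * w 0"
proof -
  have d: "fst (\<delta> n) = \<sigma>\<^sub>1 * fst (\<delta> 0)" "snd (\<delta> n) = \<sigma>\<^sub>2 * snd (\<delta> 0)"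
    using assms(3,4) by (simp_all add: \<delta>_def x_def y_def algebra_simps)
  then have "mink (\<delta> n) (\<delta> n) = \<sigma>\<^sub>1\<^sup>2 * (fst (\<delta> 0))\<^sup>2 - \<sigma>\<^sub>2\<^sup>2 * (snd (\<delta> 0))\<^sup>2"
    by (simp add: mink_def power2_eq_square)
  also have "\<dots> = mink (\<delta> 0) (\<delta> 0)"
    using assms(1,2) by (simp add: mink_def power2_eq_square)
  finally have "t n = t 0" by (simp add: t_def)
  then show ?thesis using d assms(3) by (simp add: u_def w_def x_def[of n] y_def[of n])
qed

lemma returns_iff_start:
  assumes "\<sigma>\<^sub>1\<^sup>2 = 1" "\<sigma>\<^sub>2\<^sup>2 = 1"
  shows "returns n \<sigma>\<^sub>1 \<sigma>\<^sub>2 \<longleftrightarrow>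
    x n = \<sigma>\<^sub>1 * x 0 \<and> u n = \<sigma>\<^sub>1 * u 0 \<and> y n = \<sigma>\<^sub>2 * y 0 \<and> w n = \<sigma>\<^sub>2 * w 0"
proof
  assume "returns n \<sigma>\<^sub>1 \<sigma>\<^sub>2"
  then have "T (0 + n) = (\<sigma>\<^sub>1 * x 0, \<sigma>\<^sub>2 * y 0)" "T (1 + n) = (\<sigma>\<^sub>1 * x 1, \<sigma>\<^sub>2 * y 1)"
    unfolding returns_def by blast+
  then show "x n = \<sigma>\<^sub>1 * x 0 \<and> u n = \<sigma>\<^sub>1 * u 0 \<and> y n = \<sigma>\<^sub>2 * y 0 \<and> w n = \<sigma>\<^sub>2 * w 0"
    by (intro start_if_two_vertices assms) simp_all
next
  assume "x n = \<sigma>\<^sub>1 * x 0 \<and> u n = \<sigma>\<^sub>1 * u 0 \<and> y n = \<sigma>\<^sub>2 * y 0 \<and> w n = \<sigma>\<^sub>2 * w 0"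
  then show "returns n \<sigma>\<^sub>1 \<sigma>\<^sub>2"
    using real.periodic_from_start[OF assms, of n] by (simp add: returns_def T_eq)
qed

lemma returns_iff_pell:
  assumes n: "n \<ge> 1"
  shows "returns n ((- 1) ^ j) ((- 1) ^ k) \<longleftrightarrow>
    (\<exists>A B. pell_solution (K_poly a b g) n A B \<and>
      poly A (of_real a) = (- 1) ^ j * of_real a ^ n \<and>
      poly A (- of_real b) = (- 1) ^ k * (- of_real b) ^ n)"
proof -
  have sq: "((- 1 :: real) ^ i)\<^sup>2 = 1" "((- 1 :: complex) ^ i)\<^sup>2 = 1" for i
    by (simp_all flip: power_mult add: mult.commute[of i])
  show ?thesis
    unfolding returns_iff_start[OF sq(1) sq(1)]
  proof
    assume *: "x n = (- 1) ^ j * x 0 \<and> u n = (- 1) ^ j * u 0 \<and> y n = (- 1) ^ k * y 0 \<and> w n = (- 1) ^ k * w 0"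
    show "\<exists>A B. pell_solution (K_poly a b g) n A B \<and>
      poly A (of_real a) = (- 1) ^ j * of_real a ^ n \<and>
      poly A (- of_real b) = (- 1) ^ k * (- of_real b) ^ n"
      unfolding complex_f[symmetric]
      by (rule complex.pell_if_periodic[OF n sq(2) sq(2)]) (use * in simp_all)
  next
    assume "\<exists>A B. pell_solution (K_poly a b g) n A B \<and>
      poly A (of_real a) = (- 1) ^ j * of_real a ^ n \<and>
      poly A (- of_real b) = (- 1) ^ k * (- of_real b) ^ n"
    then obtain A B where "pell_solution complex.f n A B"
      "poly A (of_real a) = (- 1) ^ j * of_real a ^ n"
      "poly A (- of_real b) = (- 1) ^ k * (- of_real b) ^ n"
      unfolding complex_f by blast
    from complex.periodic_if_pell[OF n this]
    have "complex_of_real (x n) = of_real ((- 1) ^ j * x 0)" "complex_of_real (u n) = of_real ((- 1) ^ j * u 0)"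
      "complex_of_real (y n) = of_real ((- 1) ^ k * y 0)" "complex_of_real (w n) = of_real ((- 1) ^ k * w 0)"
      by simp_all
    then show "x n = (- 1) ^ j * x 0 \<and> u n = (- 1) ^ j * u 0 \<and> y n = (- 1) ^ k * y 0 \<and> w n = (- 1) ^ k * w 0"
      unfolding of_real_eq_iff by blast
  qed
qed

text \<open>The real orbit provides a real \<open>A\<close>, to which the sign arguments apply. For
  hyperbolas the sign of \<open>(- b)^n a^n\<close> brings in the parity of
  \<open>n\<close>.\<close>

lemma returns_signs:
  assumes n: "n \<ge> 1" and sig: "\<sigma>\<^sub>1 \<in> {1, -1}" "\<sigma>\<^sub>2 \<in> {1, -1}" and ret: "returns n \<sigma>\<^sub>1 \<sigma>\<^sub>2"
  shows "0 < g \<Longrightarrow> g < a \<Longrightarrow> \<sigma>\<^sub>1 = 1"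
    and "- b < g \<Longrightarrow> g < 0 \<Longrightarrow> \<sigma>\<^sub>2 = 1"
    and "g < - b \<or> a < g \<Longrightarrow> \<sigma>\<^sub>1 = \<sigma>\<^sub>2 \<longleftrightarrow> even n"
proof -
  have sq: "\<sigma>\<^sub>1\<^sup>2 = 1" "\<sigma>\<^sub>2\<^sup>2 = 1" using sig by auto
  obtain A B where pell: "pell_solution real.f n A B"
    and A: "poly A a = \<sigma>\<^sub>1 * a ^ n" "poly A (- b) = \<sigma>\<^sub>2 * (- b) ^ n"
    using real.pell_if_periodic[OF n sq] ret unfolding returns_iff_start[OF sq] by blast
  show "\<sigma>\<^sub>1 = 1" if "0 < g" "g < a"
    using pell_sign_at_a[OF pell that] A(1) sig by auto
  show "\<sigma>\<^sub>2 = 1" if "- b < g" "g < 0"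
    using pell_sign_at_b[OF pell that] A(2) sig by auto
  show "\<sigma>\<^sub>1 = \<sigma>\<^sub>2 \<longleftrightarrow> even n" if "g < - b \<or> a < g"
  proof -
    have "0 < \<sigma>\<^sub>2 * (- b) ^ n * (\<sigma>\<^sub>1 * a ^ n)"
      using pell_sign_hyperbola[OF pell that] unfolding A .
    then show ?thesis using sig ab
      by (cases "even n") (auto simp: zero_less_mult_iff mult_less_0_iff)
  qed
qed

lemma elliptic_periodic_iff:
  "elliptic_periodic a b n T \<longleftrightarrow> (\<exists>\<sigma>\<^sub>1\<in>{1, -1}. \<exists>\<sigma>\<^sub>2\<in>{1, -1}. returns n \<sigma>\<^sub>1 \<sigma>\<^sub>2)"
proof
  assume ell: "elliptic_periodic a b n T"
  define z where "z k s = (1 - s) *\<^sub>R T k + s *\<^sub>R T (Suc k)" for k s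
  have inside: "b * (fst (z k s))\<^sup>2 + a * (snd (z k s))\<^sup>2 \<le> a * b" if "s \<in> {0..1}" for k s
    using segment_inside[OF ab _ _ on_ellipse on_ellipse, of s k "Suc k"] that
    by (simp add: z_def T_eq)
  have eq: "(fst (z n s))\<^sup>2 = (fst (z 0 s))\<^sup>2 \<and> (snd (z n s))\<^sup>2 = (snd (z 0 s))\<^sup>2"
    if "s \<in> {0..1}" for s
  proof -
    have "elliptic_coords a b (z n s) = elliptic_coords a b (z 0 s)"
      using bspec[OF spec[OF ell[unfolded elliptic_periodic_def], of 0] that] by (simp add: z_def)
    from elliptic_coords_eqD[OF ab inside[OF that] inside[OF that] this] show ?thesis ..
  qed
  have "(x n)\<^sup>2 = (x 0)\<^sup>2" "(x (Suc n))\<^sup>2 = (x 1)\<^sup>2"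
    "((1 - 1 / 2) * x n + 1 / 2 * x (Suc n))\<^sup>2 = ((1 - 1 / 2) * x 0 + 1 / 2 * x 1)\<^sup>2"
    \<comment> \<open>The ends and the midpoint of the first segment already determine one sign per
      coordinate.\<close>
    using eq[of 0] eq[of 1] eq[of "1 / 2"] by (simp_all add: z_def T_eq)
  from common_sign[OF this] obtain \<sigma>\<^sub>1
    where 1: "\<sigma>\<^sub>1 \<in> {1, -1}" "x n = \<sigma>\<^sub>1 * x 0 \<and> x (Suc n) = \<sigma>\<^sub>1 * x 1" by blast
  have "(y n)\<^sup>2 = (y 0)\<^sup>2" "(y (Suc n))\<^sup>2 = (y 1)\<^sup>2"
    "((1 - 1 / 2) * y n + 1 / 2 * y (Suc n))\<^sup>2 = ((1 - 1 / 2) * y 0 + 1 / 2 * y 1)\<^sup>2"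
    using eq[of 0] eq[of 1] eq[of "1 / 2"] by (simp_all add: z_def T_eq)
  from common_sign[OF this] obtain \<sigma>\<^sub>2
    where 2: "\<sigma>\<^sub>2 \<in> {1, -1}" "y n = \<sigma>\<^sub>2 * y 0 \<and> y (Suc n) = \<sigma>\<^sub>2 * y 1" by blast
  have sq: "\<sigma>\<^sub>1\<^sup>2 = 1" "\<sigma>\<^sub>2\<^sup>2 = 1" using 1 2 by auto
  have "returns n \<sigma>\<^sub>1 \<sigma>\<^sub>2"
    unfolding returns_iff_start[OF sq]
    by (rule start_if_two_vertices[OF sq]) (use 1 2 in \<open>auto simp: T_eq\<close>)
  then show "\<exists>\<sigma>\<^sub>1\<in>{1, -1}. \<exists>\<sigma>\<^sub>2\<in>{1, -1}. returns n \<sigma>\<^sub>1 \<sigma>\<^sub>2" using 1 2 by blast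
next
  assume "\<exists>\<sigma>\<^sub>1\<in>{1, -1}. \<exists>\<sigma>\<^sub>2\<in>{1, -1}. returns n \<sigma>\<^sub>1 \<sigma>\<^sub>2"
  then obtain \<sigma>\<^sub>1 \<sigma>\<^sub>2 where sig: "\<sigma>\<^sub>1 \<in> {1, -1}" "\<sigma>\<^sub>2 \<in> {1, -1}" and ret: "returns n \<sigma>\<^sub>1 \<sigma>\<^sub>2" by blast
  have sq: "\<sigma>\<^sub>1\<^sup>2 = 1" "\<sigma>\<^sub>2\<^sup>2 = 1" using sig by auto
  have T: "T (k + n) = (\<sigma>\<^sub>1 * x k, \<sigma>\<^sub>2 * y k)" "T (Suc (k + n)) = (\<sigma>\<^sub>1 * x (Suc k), \<sigma>\<^sub>2 * y (Suc k))" for k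
    using ret unfolding returns_def by (metis add_Suc)+
  have square: "((1 - s) * (\<sigma> * p) + s * (\<sigma> * q))\<^sup>2 = ((1 - s) * p + s * q)\<^sup>2" if "\<sigma>\<^sup>2 = 1" for \<sigma> p q s :: real
  proof -
    have "((1 - s) * (\<sigma> * p) + s * (\<sigma> * q))\<^sup>2 = \<sigma>\<^sup>2 * ((1 - s) * p + s * q)\<^sup>2" by algebra
    then show ?thesis using that by simp
  qed
  have "elliptic_coords a b ((1 - s) *\<^sub>R T (k + n) + s *\<^sub>R T (Suc (k + n)))
      = elliptic_coords a b ((1 - s) *\<^sub>R T k + s *\<^sub>R T (Suc k))" for k s
    unfolding T T_eq[of k] T_eq[of "Suc k"]
    by (rule elliptic_coords_cong[OF ab]) (simp_all add: square sq)
  then show "elliptic_periodic a b n T" unfolding elliptic_periodic_def by blast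
qed

lemma periodic_iff: "periodic n T \<longleftrightarrow> returns n 1 1"
  by (simp add: periodic_def returns_def flip: T_eq)

text \<open>If a coordinate could return with a sign other than \<open>1\<close>, it would be zero
  at all vertices, and its velocity with it, against \<open>state_nz\<close>.\<close>

lemma returns_unique:
  assumes "returns n \<sigma>\<^sub>1 \<sigma>\<^sub>2" "returns n 1 1"
  shows "\<sigma>\<^sub>1 = 1" "\<sigma>\<^sub>2 = 1"
proof -
  have eq: "\<sigma>\<^sub>1 * x k = x k" "\<sigma>\<^sub>2 * y k = y k" for k
    using assms unfolding returns_def by (metis mult_1 prod.inject)+
  show "\<sigma>\<^sub>1 = 1"
  proof (rule ccontr)
    assume "\<sigma>\<^sub>1 \<noteq> 1"
    then have "x k = 0" for k using eq(1)[of k] by simp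
    then have "u 0 = 0" using real.move(1)[of 0] real.t_nz by simp
    then show False using real.state_nz(1)[of 0] \<open>\<And>k. x k = 0\<close> by simp
  qed
  show "\<sigma>\<^sub>2 = 1"
  proof (rule ccontr)
    assume "\<sigma>\<^sub>2 \<noteq> 1"
    then have "y k = 0" for k using eq(2)[of k] by simp
    then have "w 0 = 0" using real.move(2)[of 0] real.t_nz by simp
    then show False using real.state_nz(2)[of 0] \<open>\<And>k. y k = 0\<close> by simp
  qed
qed

text \<open>The symmetry maps segment \<open>k\<close> to segment \<open>k + n\<close>; being an
  involution, it maps the trace onto itself.\<close>

lemma trace_symmetric:
  assumes sq: "\<sigma>\<^sub>1\<^sup>2 = 1" "\<sigma>\<^sub>2\<^sup>2 = 1" and ret: "returns n \<sigma>\<^sub>1 \<sigma>\<^sub>2"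
  shows "(\<lambda>(x, y). (\<sigma>\<^sub>1 * x, \<sigma>\<^sub>2 * y)) ` trace_of T = trace_of T"
proof -
  let ?R = "\<lambda>(x, y). (\<sigma>\<^sub>1 * x, \<sigma>\<^sub>2 * y)"
  have T: "?R (T k) = T (k + n)" for k
    using ret by (simp add: returns_def T_eq[of k])
  have img: "?R ` trace_of T \<subseteq> trace_of T"
  proof -
    have "?R ` closed_segment (T k) (T (Suc k)) = closed_segment (T (k + n)) (T (Suc (k + n)))" for k
      unfolding closed_segment_linear_image[OF linear_reflection, symmetric] T by simp
    then show ?thesis unfolding trace_of_def by blast
  qed
  have inv: "?R (?R P) = P" for P
    using sq by (cases P) (simp add: power2_eq_square flip: mult.assoc)
  have "trace_of T \<subseteq> ?R ` trace_of T"
  proof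
    fix P assume "P \<in> trace_of T"
    then have "?R P \<in> trace_of T" using img by blast
    then have "?R (?R P) \<in> ?R ` trace_of T" by (rule imageI)
    then show "P \<in> ?R ` trace_of T" unfolding inv .
  qed
  then show ?thesis using img by blast
qed

lemma symmetric_if_returns:
  "returns n 1 (- 1) \<Longrightarrow> symmetric_x_axis T"
  "returns n (- 1) 1 \<Longrightarrow> symmetric_y_axis T"
  "returns n (- 1) (- 1) \<Longrightarrow> symmetric_origin T"
  using trace_symmetric[of 1 "- 1" n] trace_symmetric[of "- 1" 1 n] trace_symmetric[of "- 1" "- 1" n]
  by (simp_all add: symmetric_x_axis_def symmetric_y_axis_def symmetric_origin_def)

lemma elliptic_not_periodic_iff:
  assumes n: "n \<ge> 1"
  shows "elliptic_periodic a b n T \<and> \<not> periodic n T \<longleftrightarrow>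
    0 < g \<and> g < a \<and> returns n 1 (- 1) \<or>
    - b < g \<and> g < 0 \<and> returns n (- 1) 1 \<or>
    (g < - b \<or> a < g) \<and> even n \<and> returns n (- 1) (- 1) \<or>
    (g < - b \<or> a < g) \<and> odd n \<and> returns n (- 1) 1 \<or>
    (g < - b \<or> a < g) \<and> odd n \<and> returns n 1 (- 1)" (is "?L \<longleftrightarrow> ?R")
proof
  assume ?L
  then obtain \<sigma>\<^sub>1 \<sigma>\<^sub>2 where sig: "\<sigma>\<^sub>1 \<in> {1, -1}" "\<sigma>\<^sub>2 \<in> {1, -1}" and ret: "returns n \<sigma>\<^sub>1 \<sigma>\<^sub>2"
    unfolding elliptic_periodic_iff by blast
  have "\<not> (\<sigma>\<^sub>1 = 1 \<and> \<sigma>\<^sub>2 = 1)" using \<open>?L\<close> ret unfolding periodic_iff by auto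
  then have ne: "\<sigma>\<^sub>1 = 1 \<and> \<sigma>\<^sub>2 = - 1 \<or> \<sigma>\<^sub>1 = - 1 \<and> \<sigma>\<^sub>2 = 1 \<or> \<sigma>\<^sub>1 = - 1 \<and> \<sigma>\<^sub>2 = - 1"
    using sig by auto
  \<comment> \<open>Apart from the identity this admits one symmetry for each kind of ellipse and
    for hyperbolas with even \<open>n\<close>, and two for hyperbolas with odd
    \<open>n\<close>.\<close>
  note signs = returns_signs[OF n sig ret]
  consider "0 < g" "g < a" | "- b < g" "g < 0" | "g < - b \<or> a < g"
    using g by fastforce
  then show ?R
  proof cases
    case 1
    then show ?thesis using signs(1) ne ret by auto
  next
    case 2
    then show ?thesis using signs(2) ne ret by auto
  next
    case 3
    then show ?thesis using signs(3) ne ret by auto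
  qed
next
  assume ?R
  then have "returns n 1 (- 1) \<or> returns n (- 1) 1 \<or> returns n (- 1) (- 1)" by blast
  then obtain \<sigma>\<^sub>1 \<sigma>\<^sub>2 where sig: "\<sigma>\<^sub>1 \<in> {1, -1}" "\<sigma>\<^sub>2 \<in> {1, -1}" and ret: "returns n \<sigma>\<^sub>1 \<sigma>\<^sub>2"
    and ne: "\<not> (\<sigma>\<^sub>1 = 1 \<and> \<sigma>\<^sub>2 = 1)" by fastforce
  then show ?L
    unfolding elliptic_periodic_iff periodic_iff using returns_unique[OF ret] by blast
qed

lemma lin_equiv_iff_returns:
  assumes n: "n \<ge> 1" and sum: "i + j + k = n" and y0: "y0\<^sup>2 = poly (K_poly a b g) 0"
  shows "lin_equiv (K_poly a b g)
      (frag_cmul (int n) (frag_of (Affine 0 y0)) - frag_cmul (int i) (frag_of (Q_branch g))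
        - frag_cmul (int j) (frag_of (Q_branch a)) - frag_cmul (int k) (frag_of (Q_branch (- b)))) 0
    \<longleftrightarrow> returns n ((- 1) ^ j) ((- 1) ^ k)"
  unfolding lin_equiv_iff_pell[OF ab g n sum y0] returns_iff_pell[OF n] ..

end

theorem theorem5p2:
  fixes a b g :: real and n :: nat and y0 :: complex and Q0 Qg Qa Qb :: curve_point
    and K :: "complex poly" and X :: "nat \<Rightarrow> real \<times> real"
    and case_a case_b case_c case_d case_e :: bool
  assumes "a > 0" and "b > 0" and "g \<notin> {- b, 0, a}" and "n \<ge> 1"
    and trajectory: "billiard_trajectory a b X"
    and caustic: "has_caustic a b g X"
  defines "K \<equiv> K_poly a b g"
    and "Q0 \<equiv> Affine 0 y0" and "Qg \<equiv> Q_branch g"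
    and "Qa \<equiv> Q_branch a" and "Qb \<equiv> Q_branch (- b)"
  assumes "Q0 \<in> curve K"
  defines "case_a \<equiv> 0 < g \<and> g < a \<and>
      lin_equiv K (frag_cmul (int n) (frag_of Q0) - frag_cmul (int n - 1) (frag_of Qg) - frag_of Qb) 0"
    and "case_b \<equiv> - b < g \<and> g < 0 \<and>
      lin_equiv K (frag_cmul (int n) (frag_of Q0) - frag_cmul (int n - 1) (frag_of Qg) - frag_of Qa) 0"
    and "case_c \<equiv> (g < - b \<or> a < g) \<and> even n \<and>
      lin_equiv K (frag_cmul (int n) (frag_of Q0) - frag_cmul (int n - 2) (frag_of Qg) - frag_of Qb - frag_of Qa) 0"
    and "case_d \<equiv> (g < - b \<or> a < g) \<and> odd n \<and>
      lin_equiv K (frag_cmul (int n) (frag_of Q0) - frag_cmul (int n - 1) (frag_of Qg) - frag_of Qa) 0"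
    and "case_e \<equiv> (g < - b \<or> a < g) \<and> odd n \<and>
      lin_equiv K (frag_cmul (int n) (frag_of Q0) - frag_cmul (int n - 1) (frag_of Qg) - frag_of Qb) 0"
  shows "(elliptic_periodic a b n X \<and> \<not> periodic n X \<longleftrightarrow>
            case_a \<or> case_b \<or> case_c \<or> case_d \<or> case_e) \<and>
         (case_c \<longrightarrow> symmetric_origin X) \<and>
         (case_b \<or> case_d \<longrightarrow> symmetric_y_axis X) \<and>
         (case_a \<or> case_e \<longrightarrow> symmetric_x_axis X)"
proof -
  interpret caustic_trajectory a b g X
    by standard fact+
  have y0: "y0\<^sup>2 = poly (K_poly a b g) 0"
    using \<open>Q0 \<in> curve K\<close> by (simp add: Q0_def K_def curve_def)
  have b: "lin_equiv K (frag_cmul (int n) (frag_of Q0) - frag_cmul (int n - 1) (frag_of Qg) - frag_of Qb) 0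
      \<longleftrightarrow> returns n 1 (- 1)"
    using lin_equiv_iff_returns[of n "n - 1" 0 1, OF \<open>n \<ge> 1\<close> _ y0] \<open>n \<ge> 1\<close>
    by (simp add: K_def Q0_def Qg_def Qb_def of_nat_diff)
  have a: "lin_equiv K (frag_cmul (int n) (frag_of Q0) - frag_cmul (int n - 1) (frag_of Qg) - frag_of Qa) 0
      \<longleftrightarrow> returns n (- 1) 1"
    using lin_equiv_iff_returns[of n "n - 1" 1 0, OF \<open>n \<ge> 1\<close> _ y0] \<open>n \<ge> 1\<close>
    by (simp add: K_def Q0_def Qg_def Qa_def of_nat_diff)
  have ab: "lin_equiv K (frag_cmul (int n) (frag_of Q0) - frag_cmul (int n - 2) (frag_of Qg)
      - frag_of Qb - frag_of Qa) 0 \<longleftrightarrow> returns n (- 1) (- 1)" if "even n"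
  proof -
    \<comment> \<open>Evenness excludes \<open>n = 1\<close>, where the subtraction
      \<open>n - 2\<close> of natural numbers would be truncated.\<close>
    have "n \<ge> 2" using \<open>n \<ge> 1\<close> that by (cases "n = 1") auto
    then show ?thesis
      using lin_equiv_iff_returns[of n "n - 2" 1 1, OF \<open>n \<ge> 1\<close> _ y0]
      by (simp add: K_def Q0_def Qg_def Qa_def Qb_def of_nat_diff diff_diff_eq add.commute add.left_commute)
  qed
  show ?thesis
    unfolding elliptic_not_periodic_iff[OF \<open>n \<ge> 1\<close>] case_a_def case_b_def case_c_def case_d_def
      case_e_def a b
    using ab symmetric_if_returns[of n] by blast
qed

end
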